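(* If $U$ is an ultrafilter (not necessarily in $V$) on a complete Boolean algebra $\mathbb{B}\in V$, then the following are equivalent: (1) The Boolean ultrapower $\check V_U$ is well-founded. (2) There is an elementary embedding $j:V\to M$ into a transitive class $M$, and there is an $M$-generic filter $G\subseteq j(\mathbb{B})$ such that $j[U]\subseteq G$, where $j[U]=\{j(b) : b\in U\}$.
   Context: $V$ is a universe of sets (a model of ZFC), possibly sitting inside a larger set-theoretic universe in which $U$, and the objects $j$, $M$, $G$ of statement (2), may live; $\mathbb{B}$ is a complete Boolean algebra in $V$. A filter $G\subseteq j(\mathbb{B})$ is $M$-generic if it meets every dense subset of $j(\mathbb{B})$ that is an element of $M$. Elementarity of class embeddings is understood as a scheme. $\mathbb{B}$-names (elements of $V^{\mathbb{B}}$) are defined recursively in $V$: $\tau$ is a $\mathbb{B}$-name if $\tau$ is a set of pairs $\langle\sigma,b\rangle$ with $\sigma$ a $\mathbb{B}$-name and $b\in\mathbb{B}$. Boolean values: $[\![\tau\in\sigma]\!]=\bigvee_{\langle\eta,b\rangle\in\sigma}[\![\tau=\eta]\!]\wedge b$, $[\![\tau=\sigma]\!]=[\![\tau\subseteq\sigma]\!]\wedge[\![\sigma\subseteq\tau]\!]$, $[\![\tau\subseteq\sigma]\!]=\bigwedge_{\eta\in\mathrm{dom}(\tau)}(\neg[\![\eta\in\tau]\!]\vee[\![\eta\in\sigma]\!])$. For $x\in V$, $\check x=\{\langle\check y,1\rangle : y\in x\}$. The ground-model predicate has $[\![\tau\in\check V]\!]=\bigvee_{x\in V}[\![\tau=\check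 x]\!]$. Let $\tau=_U\sigma$ iff $[\![\tau=\sigma]\!]\in U$, and $\tau\in_U\sigma$ iff $[\![\tau\in\sigma]\!]\in U$; $[\tau]_U$ is the $=_U$-equivalence class of $\tau$ (restricted to members of minimal rank). The Boolean ultrapower is the structure $\check V_U=\{[\tau]_U : [\![\tau\in\check V]\!]\in U\}$ under $\in_U$. *)

theory Defs
  imports "HOL-Algebra.Lattice" "HOL-Library.Multiset"
begin

section \<open>The ambient universe\<close>

text \<open>
  A type of this class is the larger set-theoretic universe; its classes are the HOL sets of
  elements. Power set, infinity and choice are not required of it, so that any transitive set
  model of ZFC has such an ambient universe (the sets hereditarily of bounded cardinality).
\<close>

class set_universe =
  fixes elts :: "'a \<Rightarrow> 'a set"
  assumes extensionality: "elts x = elts y \<Longrightarrow> x = y"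
    and foundation: "wf {(y, x). y \<in> elts x}"
    and pairing: "\<exists>z. elts z = {x, y}"
    and union: "\<exists>z. elts z = (\<Union>y\<in>elts x. elts y)"
    and separation: "X \<subseteq> elts x \<Longrightarrow> \<exists>z. elts z = X"
    and replacement: "\<exists>z. elts z = f ` elts x"

definition vset :: "'a::set_universe set \<Rightarrow> 'a" where
  "vset X = (THE x. elts x = X)"

definition vpair :: "'a::set_universe \<Rightarrow> 'a \<Rightarrow> 'a" where
  "vpair x y = vset {vset {x}, vset {x, y}}"

definition vfst :: "'a::set_universe \<Rightarrow> 'a" where
  "vfst p = (THE x. \<exists>y. p = vpair x y)"

definition vsnd :: "'a::set_universe \<Rightarrow> 'a" where
  "vsnd p = (THE y. \<exists>x. p = vpair x y)"

definition vdom :: "'a::set_universe \<Rightarrow> 'a set" where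
  "vdom r = {x. \<exists>y. vpair x y \<in> elts r}"

function vrank :: "'a::set_universe \<Rightarrow> 'a" where
  "vrank x = vset (\<Union>y\<in>elts x. insert (vrank y) (elts (vrank y)))"
  by pat_completeness auto
termination
  by (relation "{(y, x). y \<in> elts x}") (simp_all add: foundation)

declare vrank.simps [simp del]

definition transitive_class :: "'a::set_universe set \<Rightarrow> bool" where
  "transitive_class M \<longleftrightarrow> (\<forall>x\<in>M. elts x \<subseteq> M)"


section \<open>First-order formulas, ZFC and elementary embeddings\<close>

datatype fm = Mem nat nat | Eq nat nat | Neg fm | Conj fm fm | Forall nat fm

primrec sat :: "'a::set_universe set \<Rightarrow> (nat \<Rightarrow> 'a) \<Rightarrow> fm \<Rightarrow> bool" where
  "sat M e (Mem m n) \<longleftrightarrow> e m \<in> elts (e n)"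
| "sat M e (Eq m n) \<longleftrightarrow> e m = e n"
| "sat M e (Neg \<phi>) \<longleftrightarrow> \<not> sat M e \<phi>"
| "sat M e (Conj \<phi> \<psi>) \<longleftrightarrow> sat M e \<phi> \<and> sat M e \<psi>"
| "sat M e (Forall n \<phi>) \<longleftrightarrow> (\<forall>x\<in>M. sat M (e(n := x)) \<phi>)"

text \<open>
  Each conjunct is an axiom of ZFC relativised to \<open>V\<close>; in the two schemas the environment \<open>e\<close>
  supplies the parameters, and choice is stated as the existence of transversals.
\<close>

definition zfc_model :: "'a::set_universe set \<Rightarrow> bool" where
  "zfc_model V \<longleftrightarrow>
     (\<comment> \<open>extensionality\<close>
      \<forall>x\<in>V. \<forall>y\<in>V. (\<forall>z\<in>V. z \<in> elts x \<longleftrightarrow> z \<in> elts y) \<longrightarrow> x = y) \<and>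
     (\<comment> \<open>foundation\<close>
      \<forall>x\<in>V. (\<exists>y\<in>V. y \<in> elts x) \<longrightarrow>
        (\<exists>y\<in>V. y \<in> elts x \<and> (\<forall>z\<in>V. \<not> (z \<in> elts x \<and> z \<in> elts y)))) \<and>
     (\<comment> \<open>pairing\<close>
      \<forall>x\<in>V. \<forall>y\<in>V. \<exists>z\<in>V. \<forall>w\<in>V. w \<in> elts z \<longleftrightarrow> w = x \<or> w = y) \<and>
     (\<comment> \<open>union\<close>
      \<forall>x\<in>V. \<exists>z\<in>V. \<forall>w\<in>V. w \<in> elts z \<longleftrightarrow> (\<exists>y\<in>V. y \<in> elts x \<and> w \<in> elts y)) \<and>
     (\<comment> \<open>power set\<close>
      \<forall>x\<in>V. \<exists>z\<in>V. \<forall>w\<in>V. w \<in> elts z \<longleftrightarrow> (\<forall>y\<in>V. y \<in> elts w \<longrightarrow> y \<in> elts x)) \<and>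
     (\<comment> \<open>infinity\<close>
      \<exists>z\<in>V. (\<exists>x\<in>V. x \<in> elts z \<and> (\<forall>y\<in>V. y \<notin> elts x)) \<and>
        (\<forall>x\<in>V. x \<in> elts z \<longrightarrow>
          (\<exists>s\<in>V. s \<in> elts z \<and> (\<forall>y\<in>V. y \<in> elts s \<longleftrightarrow> y \<in> elts x \<or> y = x)))) \<and>
     (\<comment> \<open>separation\<close>
      \<forall>\<phi> e. range e \<subseteq> V \<longrightarrow>
        (\<forall>x\<in>V. \<exists>z\<in>V. \<forall>w\<in>V. w \<in> elts z \<longleftrightarrow> w \<in> elts x \<and> sat V (e(0 := w)) \<phi>)) \<and>
     (\<comment> \<open>replacement\<close>
      \<forall>\<phi> e. range e \<subseteq> V \<longrightarrow>
        (\<forall>x\<in>V. (\<forall>u\<in>V. u \<in> elts x \<longrightarrow> (\<exists>!w. w \<in> V \<and> sat V (e(0 := u, 1 := w)) \<phi>)) \<longrightarrow>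
          (\<exists>z\<in>V. \<forall>w\<in>V. w \<in> elts z \<longleftrightarrow>
            (\<exists>u\<in>V. u \<in> elts x \<and> sat V (e(0 := u, 1 := w)) \<phi>)))) \<and>
     (\<comment> \<open>choice\<close>
      \<forall>x\<in>V. (\<forall>y\<in>V. y \<in> elts x \<longrightarrow> (\<exists>u\<in>V. u \<in> elts y)) \<and>
        (\<forall>y\<in>V. \<forall>z\<in>V. y \<in> elts x \<and> z \<in> elts x \<and> y \<noteq> z \<longrightarrow>
          (\<forall>u\<in>V. \<not> (u \<in> elts y \<and> u \<in> elts z))) \<longrightarrow>
        (\<exists>c\<in>V. \<forall>y\<in>V. y \<in> elts x \<longrightarrow> (\<exists>!u. u \<in> V \<and> u \<in> elts y \<and> u \<in> elts c)))"

definition elementary_embedding ::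
    "'a::set_universe set \<Rightarrow> 'a set \<Rightarrow> ('a \<Rightarrow> 'a) \<Rightarrow> bool" where
  "elementary_embedding V M j \<longleftrightarrow>
     j ` V \<subseteq> M \<and>
     (\<forall>\<phi> e. range e \<subseteq> V \<longrightarrow> (sat V e \<phi> \<longleftrightarrow> sat M (j \<circ> e) \<phi>))"


section \<open>Boolean algebras, filters and genericity\<close>

text \<open>
  A Boolean algebra is a set of the form \<open>vpair A R\<close>, where \<open>A\<close> is the underlying set and
  \<open>R\<close> a set of pairs that is its order.
\<close>

definition bord :: "'a::set_universe \<Rightarrow> 'a gorder" where
  "bord B = \<lparr>carrier = elts (vfst B), eq = (=), le = (\<lambda>x y. vpair x y \<in> elts (vsnd B))\<rparr>"

definition boolean_lattice :: "'a gorder \<Rightarrow> bool" where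
  "boolean_lattice L \<longleftrightarrow>
     bounded_lattice L \<and>
     (\<forall>x\<in>carrier L. \<forall>y\<in>carrier L. \<forall>z\<in>carrier L.
        x \<sqinter>\<^bsub>L\<^esub> (y \<squnion>\<^bsub>L\<^esub> z) = (x \<sqinter>\<^bsub>L\<^esub> y) \<squnion>\<^bsub>L\<^esub> (x \<sqinter>\<^bsub>L\<^esub> z)) \<and>
     (\<forall>x\<in>carrier L. \<exists>y\<in>carrier L. x \<sqinter>\<^bsub>L\<^esub> y = \<bottom>\<^bsub>L\<^esub> \<and> x \<squnion>\<^bsub>L\<^esub> y = \<top>\<^bsub>L\<^esub>)"

definition bcompl :: "'a gorder \<Rightarrow> 'a \<Rightarrow> 'a" where
  "bcompl L x = (THE y. y \<in> carrier L \<and> x \<sqinter>\<^bsub>L\<^esub> y = \<bottom>\<^bsub>L\<^esub> \<and> x \<squnion>\<^bsub>L\<^esub> y = \<top>\<^bsub>L\<^esub>)"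

text \<open>Completeness is in the sense of \<open>V\<close>: only subsets that are elements of \<open>V\<close> count.\<close>

definition complete_boolean_algebra_in :: "'a::set_universe set \<Rightarrow> 'a \<Rightarrow> bool" where
  "complete_boolean_algebra_in V B \<longleftrightarrow>
     B \<in> V \<and> (\<exists>A R. B = vpair A R) \<and> boolean_lattice (bord B) \<and>
     (\<forall>X\<in>V. elts X \<subseteq> carrier (bord B) \<longrightarrow>
        (\<exists>s. least (bord B) s (Upper (bord B) (elts X))) \<and>
        (\<exists>i. greatest (bord B) i (Lower (bord B) (elts X))))"

definition bfilter :: "'a gorder \<Rightarrow> 'a set \<Rightarrow> bool" where
  "bfilter L F \<longleftrightarrow>
     F \<subseteq> carrier L \<and> F \<noteq> {} \<and> \<bottom>\<^bsub>L\<^esub> \<notin> F \<and>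
     (\<forall>x\<in>F. \<forall>y\<in>carrier L. x \<sqsubseteq>\<^bsub>L\<^esub> y \<longrightarrow> y \<in> F) \<and>
     (\<forall>x\<in>F. \<forall>y\<in>F. x \<sqinter>\<^bsub>L\<^esub> y \<in> F)"

definition bultrafilter :: "'a gorder \<Rightarrow> 'a set \<Rightarrow> bool" where
  "bultrafilter L U \<longleftrightarrow> bfilter L U \<and> (\<forall>x\<in>carrier L. x \<in> U \<or> bcompl L x \<in> U)"

text \<open>As usual in forcing, density refers to the nonzero elements.\<close>

definition bdense :: "'a gorder \<Rightarrow> 'a set \<Rightarrow> bool" where
  "bdense L D \<longleftrightarrow>
     D \<subseteq> carrier L \<and>
     (\<forall>x\<in>carrier L. x \<noteq> \<bottom>\<^bsub>L\<^esub> \<longrightarrow> (\<exists>d\<in>D. d \<noteq> \<bottom>\<^bsub>L\<^esub> \<and> d \<sqsubseteq>\<^bsub>L\<^esub> x))"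

definition generic_filter :: "'a::set_universe set \<Rightarrow> 'a gorder \<Rightarrow> 'a set \<Rightarrow> bool" where
  "generic_filter M L G \<longleftrightarrow>
     bfilter L G \<and> (\<forall>D\<in>M. bdense L (elts D) \<longrightarrow> G \<inter> elts D \<noteq> {})"


section \<open>Names and Boolean values\<close>

inductive bname :: "'a::set_universe \<Rightarrow> 'a \<Rightarrow> bool" for B where
  "(\<And>p. p \<in> elts \<tau> \<Longrightarrow> \<exists>\<sigma> b. p = vpair \<sigma> b \<and> bname B \<sigma> \<and> b \<in> carrier (bord B)) \<Longrightarrow> bname B \<tau>"

definition bnames :: "'a::set_universe set \<Rightarrow> 'a \<Rightarrow> 'a set" where
  "bnames V B = {\<tau> \<in> V. bname B \<tau>}"

lemma elts_vset: "elts z = X \<Longrightarrow> elts (vset X) = X"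
  unfolding vset_def by (metis (mono_tags, lifting) extensionality theI)

lemma elts_vset_doubleton: "elts (vset {x, y}) = {x, y}"
proof -
  obtain z where "elts z = {x, y}"
    using pairing by (rule exE)
  then show ?thesis
    by (rule elts_vset)
qed

lemma elts_vpair: "elts (vpair x y) = {vset {x}, vset {x, y}}"
  unfolding vpair_def by (rule elts_vset_doubleton)

lemma vpair_fst_below:
  assumes "vpair x y \<in> elts r"
  shows "(x, r) \<in> {(y, x). y \<in> elts x}\<^sup>+"
proof -
  have "elts (vset {x}) = {x}"
    using elts_vset_doubleton[of x x] by simp
  then have "x \<in> elts (vset {x})" "vset {x} \<in> elts (vpair x y)"
    by (auto simp: elts_vpair)
  with assms have "(x, vset {x}) \<in> {(y, x). y \<in> elts x}\<^sup>+"
    "(vset {x}, vpair x y) \<in> {(y, x). y \<in> elts x}\<^sup>+"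
    "(vpair x y, r) \<in> {(y, x). y \<in> elts x}\<^sup>+"
    by (auto intro!: r_into_trancl)
  then show ?thesis
    by (iprover intro: trancl_trans)
qed

text \<open>
  In each clause the recursive calls concern names in the domain of one of the arguments.
  Termination follows from the multiset order on the two arguments, where in
  \<open>val_mem B \<tau> \<sigma>\<close> the argument \<open>\<sigma>\<close> is tagged as smaller, since it is at once replaced by an
  element of its domain.
\<close>

function
  val_mem :: "'a::set_universe \<Rightarrow> 'a \<Rightarrow> 'a \<Rightarrow> 'a" and
  val_eq :: "'a \<Rightarrow> 'a \<Rightarrow> 'a \<Rightarrow> 'a" and
  val_sub :: "'a \<Rightarrow> 'a \<Rightarrow> 'a \<Rightarrow> 'a"
where
  "val_mem B \<tau> \<sigma> =
     \<Squnion>\<^bsub>bord B\<^esub> ((\<lambda>(\<eta>, b). val_eq B \<tau> \<eta> \<sqinter>\<^bsub>bord B\<^esub> b) ` {(\<eta>, b). vpair \<eta> b \<in> elts \<sigma>})"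
| "val_eq B \<tau> \<sigma> = val_sub B \<tau> \<sigma> \<sqinter>\<^bsub>bord B\<^esub> val_sub B \<sigma> \<tau>"
| "val_sub B \<tau> \<sigma> =
     \<Sqinter>\<^bsub>bord B\<^esub> ((\<lambda>\<eta>. bcompl (bord B) (val_mem B \<eta> \<tau>) \<squnion>\<^bsub>bord B\<^esub> val_mem B \<eta> \<sigma>) ` vdom \<tau>)"
  by pat_completeness auto
termination
proof -
  let ?below = "{(y, x). y \<in> elts x}\<^sup>+ :: ('a \<times> 'a) set"
  let ?r = "?below <*lex*> less_than"
  let ?w = "\<lambda>z :: ('a \<times> 'a \<times> 'a) + ('a \<times> 'a \<times> 'a) + ('a \<times> 'a \<times> 'a). case z of
      Inl (_, \<tau>, \<sigma>) \<Rightarrow> ({#(\<tau>, 1), (\<sigma>, 0)#}, 0)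
    | Inr (Inl (_, \<tau>, \<sigma>)) \<Rightarrow> ({#(\<tau>, 1), (\<sigma>, 1)#}, 1)
    | Inr (Inr (_, \<tau>, \<sigma>)) \<Rightarrow> ({#(\<tau>, 1), (\<sigma>, 1)#}, 0 :: nat)"
  let ?R = "inv_image (mult ?r <*lex*> less_than) ?w"
  have wf: "wf ?R"
    by (intro wf_inv_image wf_lex_prod wf_mult wf_trancl wf_less_than foundation)
  have one: "({#x, y#}, {#x, z#}) \<in> mult ?r" if "(y, z) \<in> ?r" for x y z
  proof -
    have "({#x#} + {#y#}, {#x#} + {#z#}) \<in> mult ?r"
      by (rule one_step_implies_mult) (use that in auto)
    moreover have "{#x#} + {#y#} = {#x, y#}" "{#x#} + {#z#} = {#x, z#}"
      by (simp_all only: add_mset_commute union_mset_add_mset_left add_0)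
    ultimately show ?thesis
      by (simp only:)
  qed
  have each: "({#x, y#}, {#v, z#}) \<in> mult ?r"
    if "(x, v) \<in> ?r" "(y, v) \<in> ?r \<or> (y, z) \<in> ?r" for x y v z
    using one_step_implies_mult[of "{#v, z#}" "{#x, y#}" ?r "{#}"] that by auto
  have dom: "(x, r) \<in> ?below" if "x \<in> vdom r" for x r
    using that unfolding vdom_def mem_Collect_eq by (elim exE) (rule vpair_fst_below)
  show ?thesis
  proof (relation ?R, rule wf, simp_all only: in_inv_image in_lex_prod sum.case prod.case,
      goal_cases)
    case (1 B \<tau> \<sigma> x \<eta> b)
    then have "(\<eta>, \<sigma>) \<in> ?below"
      by (intro vpair_fst_below[of _ b]) auto
    then show ?case by (intro disjI1[OF one]) simp
  next
    case (4 B \<tau> \<sigma> x)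
    then show ?case by (intro disjI1[OF each]) (simp_all add: dom)
  next
    case (5 B \<tau> \<sigma> x)
    then show ?case by (intro disjI1[OF each]) (simp_all add: dom)
  qed (simp_all only: add_mset_commute less_than_iff zero_less_one simp_thms)
qed

function check :: "'a::set_universe \<Rightarrow> 'a \<Rightarrow> 'a" where
  "check B x = vset ((\<lambda>y. vpair (check B y) \<top>\<^bsub>bord B\<^esub>) ` elts x)"
  by pat_completeness auto
termination
  by (relation "inv_image {(y, x). y \<in> elts x} snd") (simp_all add: foundation)

declare val_mem.simps [simp del] val_eq.simps [simp del]
  val_sub.simps [simp del] check.simps [simp del]

definition val_ground :: "'a::set_universe set \<Rightarrow> 'a \<Rightarrow> 'a \<Rightarrow> 'a" where
  "val_ground V B \<tau> = \<Squnion>\<^bsub>bord B\<^esub> ((\<lambda>x. val_eq B \<tau> (check B x)) ` V)"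


section \<open>The Boolean ultrapower\<close>

definition name_class :: "'a::set_universe set \<Rightarrow> 'a \<Rightarrow> 'a set \<Rightarrow> 'a \<Rightarrow> 'a set" where
  "name_class V B U \<tau> =
     {\<sigma> \<in> bnames V B. val_eq B \<sigma> \<tau> \<in> U \<and>
        (\<forall>\<rho>\<in>bnames V B. val_eq B \<rho> \<tau> \<in> U \<longrightarrow> elts (vrank \<sigma>) \<subseteq> elts (vrank \<rho>))}"

definition boolean_ultrapower :: "'a::set_universe set \<Rightarrow> 'a \<Rightarrow> 'a set \<Rightarrow> 'a set set" where
  "boolean_ultrapower V B U =
     {name_class V B U \<tau> |\<tau>. \<tau> \<in> bnames V B \<and> val_ground V B \<tau> \<in> U}"

definition ultrapower_mem :: "'a::set_universe \<Rightarrow> 'a set \<Rightarrow> 'a set \<Rightarrow> 'a set \<Rightarrow> bool" where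
  "ultrapower_mem B U c d \<longleftrightarrow> (\<exists>\<tau>\<in>c. \<exists>\<sigma>\<in>d. val_mem B \<tau> \<sigma> \<in> U)"

end

theory Submission
  imports Defs
begin

text \<open>
  Let \<open>GN\<close> be the set of names that some member of \<open>U\<close> forces into the ground model, and let \<open>E\<close> be
  membership modulo \<open>U\<close>.  The Boolean ultrapower is the quotient of \<open>(GN, E)\<close> by equality modulo
  \<open>U\<close>, so it is well-founded if and only if \<open>E\<close> is (\<open>wfp_on_ultrapower_iff\<close>).  A name \<open>\<tau>\<close> in \<open>GN\<close> acts
  like a function of the ground model on a maximal antichain: the values \<open>val_eq B \<tau> (check B x)\<close> for \<open>x\<close> in \<open>V\<close>
  are disjoint, and their join is in \<open>U\<close>.

  If \<open>G\<close> is an \<open>M\<close>-generic filter on \<open>j B\<close> that contains the image of \<open>U\<close>, then \<open>G\<close> meets the image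
  of the dense set of conditions that decide the value of \<open>\<tau>\<close>.  This assigns an element of the
  transitive class \<open>M\<close> to \<open>\<tau>\<close>, and by elementarity the assignment turns \<open>E\<close> into membership; hence
  \<open>E\<close> is well-founded (\<open>wf_if_generic\<close>).

  Conversely, let \<open>E\<close> be well-founded, let \<open>\<pi>\<close> be its collapsing map and \<open>M\<close> the range of \<open>\<pi>\<close>.  The
  theorem of Los for Boolean ultrapowers (\<open>Los\<close>) says that a formula holds of \<open>\<pi> \<tau>\<^sub>1, \<dots>, \<pi> \<tau>\<^sub>n\<close> in
  \<open>M\<close> if and only if \<open>U\<close> contains the join of those conditions that decide values of the names for
  which it holds in \<open>V\<close>.  Applied to check names, it shows that \<open>x \<mapsto> \<pi> (check B x)\<close> is elementary.
  The generic filter consists of those \<open>\<pi> \<tau>\<close> for which \<open>U\<close> contains the Boolean value of \<open>\<tau>\<close> being in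
  the canonical generic filter.  It meets the dense sets of \<open>M\<close> (\<open>G_dense\<close>): if a name is forced to
  be dense, then some name is forced to be a member of it and of the generic filter.  To find that
  name, one enumerates the algebra in \<open>V\<close> and takes, below each condition, the first
  element that is forced to do.

  What takes most of the room is that \<open>V\<close> is only closed under definable operations, and that only
  joins of sets in \<open>V\<close> exist.  So it has to be shown that the recursively defined Boolean values are
  definable in \<open>V\<close> (\<open>definable_recursion\<close>, \<open>tm_val_eq\<close>), that choices can be made definably from a
  parameter (\<open>definable_choice\<close>), and that the sets of \<open>V\<close> can be enumerated (\<open>enumeration\<close>).
\<close>

section \<open>Sets and pairs of the ambient universe\<close>

definition small :: "'a::set_universe set \<Rightarrow> bool" where
  "small X \<longleftrightarrow> (\<exists>z. elts z = X)"

lemma elts_vset_small: "small X \<Longrightarrow> elts (vset X) = X"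
  unfolding small_def using elts_vset by blast

lemma small_elts [simp]: "small (elts x)"
  unfolding small_def by blast

lemma vset_elts [simp]: "vset (elts x) = x"
  by (simp add: elts_vset_small extensionality)

lemma small_subset: "X \<subseteq> Y \<Longrightarrow> small Y \<Longrightarrow> small X"
  unfolding small_def by (metis separation)

lemma small_image:
  fixes f :: "'a::set_universe \<Rightarrow> 'a"
  assumes "small X"
  shows "small (f ` X)"
proof -
  obtain z where "elts z = X" using assms unfolding small_def by (elim exE)
  with replacement[where f = f and x = z] show ?thesis unfolding small_def by simp
qed

lemma small_Union:
  fixes F :: "'a::set_universe \<Rightarrow> 'a set"
  assumes "small X" "\<And>x. x \<in> X \<Longrightarrow> small (F x)"
  shows "small (\<Union>x\<in>X. F x)"
proof -
  obtain w where w: "elts w = (\<lambda>x. vset (F x)) ` X"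
    using small_image[OF assms(1), of "\<lambda>x. vset (F x)"] unfolding small_def by (elim exE)
  obtain u where "elts u = (\<Union>y\<in>elts w. elts y)" using union[of w] by (elim exE)
  also have "\<dots> = (\<Union>x\<in>X. F x)" using assms(2) by (simp add: w elts_vset_small)
  finally show ?thesis unfolding small_def by (rule exI)
qed

lemma small_insert:
  assumes "small X"
  shows "small (insert x X)"
proof -
  obtain z where z: "elts z = {vset X, vset {x, x}}" using pairing[of "vset X" "vset {x, x}"] by (elim exE)
  obtain u where "elts u = (\<Union>y\<in>elts z. elts y)" using union[of z] by (elim exE)
  also have "\<dots> = insert x X"
    using assms by (simp add: z elts_vset_small elts_vset_doubleton[of x x, simplified])
  finally show ?thesis unfolding small_def by (rule exI)
qed

lemma small_empty [simp]: "small {}"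
  by (rule small_subset[OF empty_subsetI small_elts])

lemma small_finite: "finite X \<Longrightarrow> small X"
  by (induction rule: finite_induct) (auto intro: small_insert)

lemma elts_vset_finite [simp]: "finite X \<Longrightarrow> elts (vset X) = X"
  by (simp add: small_finite elts_vset_small)

lemma vset_eq_iff: "small X \<Longrightarrow> z = vset X \<longleftrightarrow> elts z = X"
  by (metis elts_vset_small vset_elts)

lemma vpair_iff [simp]: "vpair a b = vpair c d \<longleftrightarrow> a = c \<and> b = d"
proof
  assume "vpair a b = vpair c d"
  then have "{vset {a}, vset {a, b}} = {vset {c}, vset {c, d}}"
    by (metis elts_vpair)
  then have "elts ` {vset {a}, vset {a, b}} = elts ` {vset {c}, vset {c, d}}"
    by simp
  then have "{{a}, {a, b}} = {{c}, {c, d}}"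
    by (simp only: image_insert image_empty elts_vset_finite finite.intros)
  then show "a = c \<and> b = d" by (auto simp: doubleton_eq_iff)
qed simp

lemma vfst_vpair [simp]: "vfst (vpair x y) = x"
  by (simp add: vfst_def)

lemma vsnd_vpair [simp]: "vsnd (vpair x y) = y"
  by (simp add: vsnd_def)

lemma elts_induct [case_names step]:
  assumes "\<And>x. (\<And>y. y \<in> elts x \<Longrightarrow> P y) \<Longrightarrow> P x"
  shows "P x"
  by (rule wf_induct_rule[OF foundation], rule assms) simp

lemma elts_irrefl: "x \<notin> elts x"
  using foundation by (metis (mono_tags) case_prodI mem_Collect_eq wf_not_refl)

lemma transitive_classD: "transitive_class M \<Longrightarrow> x \<in> M \<Longrightarrow> y \<in> elts x \<Longrightarrow> y \<in> M"
  unfolding transitive_class_def by blast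


section \<open>Definability\<close>

definition envs :: "'a set \<Rightarrow> (nat \<Rightarrow> 'a) set" where
  "envs V = {e. range e \<subseteq> V}"

lemma envsD [simp]: "e \<in> envs V \<Longrightarrow> e n \<in> V"
  by (auto simp: envs_def)

lemma envsI: "(\<And>n. e n \<in> V) \<Longrightarrow> e \<in> envs V"
  by (auto simp: envs_def)

lemma envs_comp [simp]: "e \<in> envs V \<Longrightarrow> (\<lambda>n. e (f n)) \<in> envs V"
  by (auto simp: envs_def)

text \<open>\<open>mixenv e p\<close> reserves the even variables for arguments and the odd ones for parameters.\<close>

definition mixenv :: "(nat \<Rightarrow> 'a) \<Rightarrow> (nat \<Rightarrow> 'a) \<Rightarrow> nat \<Rightarrow> 'a" where
  "mixenv e p n = (if even n then e (n div 2) else p (n div 2))"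

definition evod :: "(nat \<Rightarrow> nat) \<Rightarrow> (nat \<Rightarrow> nat) \<Rightarrow> nat \<Rightarrow> nat" where
  "evod h k n = (if even n then 2 * h (n div 2) else 2 * k (n div 2) + 1)"

lemma inj_evod:
  assumes "inj h" "inj k"
  shows "inj (evod h k)"
proof (rule injI)
  fix m n assume eq: "evod h k m = evod h k n"
  have "even (evod h k i) \<longleftrightarrow> even i" for i by (simp add: evod_def)
  then have par: "even m \<longleftrightarrow> even n" using eq by metis
  then have "m div 2 = n div 2"
    using eq assms by (cases "even m") (simp_all add: evod_def inj_eq)
  moreover have "m mod 2 = n mod 2" using par by (simp add: mod2_eq_if)
  ultimately show "m = n" by (metis div_mult_mod_eq)
qed

lemma mixenv_evod: "mixenv e p \<circ> evod h k = mixenv (\<lambda>n. e (h n)) (\<lambda>n. p (k n))"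
  by (auto simp: mixenv_def evod_def fun_eq_iff)

lemma mixenv_double [simp]: "mixenv p q (2 * n) = p n" "mixenv p q (Suc (2 * n)) = q n"
  by (simp_all add: mixenv_def)

primrec rename :: "(nat \<Rightarrow> nat) \<Rightarrow> fm \<Rightarrow> fm" where
  "rename f (Mem m n) = Mem (f m) (f n)"
| "rename f (Eq m n) = Eq (f m) (f n)"
| "rename f (Neg \<phi>) = Neg (rename f \<phi>)"
| "rename f (Conj \<phi> \<psi>) = Conj (rename f \<phi>) (rename f \<psi>)"
| "rename f (Forall n \<phi>) = Forall (f n) (rename f \<phi>)"

lemma sat_rename: "inj f \<Longrightarrow> sat M e (rename f \<phi>) \<longleftrightarrow> sat M (e \<circ> f) \<phi>"
proof (induction \<phi> arbitrary: e)
  case (Forall n \<phi>)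
  have upd: "(e(f n := x)) \<circ> f = (e \<circ> f)(n := x)" for x
    using Forall.prems by (auto simp: fun_eq_iff inj_def)
  show ?case by (simp only: rename.simps sat.simps Forall.IH[OF Forall.prems] upd)
qed auto

text \<open>
  \<open>P\<close> and \<open>Q\<close> are one and the same formula, read in \<open>V\<close> with some parameters and in \<open>M\<close> with
  their images under \<open>j\<close>.  With \<open>M = V\<close> and \<open>j\<close> the identity this is definability in \<open>V\<close> with
  parameters; with an elementary embedding \<open>j\<close> it is what transfers statements from \<open>V\<close> to \<open>M\<close>.
\<close>

definition dfn :: "'a::set_universe set \<Rightarrow> 'a set \<Rightarrow> ('a \<Rightarrow> 'a) \<Rightarrow>
    ((nat \<Rightarrow> 'a) \<Rightarrow> bool) \<Rightarrow> ((nat \<Rightarrow> 'a) \<Rightarrow> bool) \<Rightarrow> bool" where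
  "dfn V M j P Q \<longleftrightarrow> (\<exists>\<phi> p. p \<in> envs V \<and>
     (\<forall>e\<in>envs V. P e \<longleftrightarrow> sat V (mixenv e p) \<phi>) \<and>
     (\<forall>e\<in>envs M. Q e \<longleftrightarrow> sat M (mixenv e (\<lambda>n. j (p n))) \<phi>))"

text \<open>
  Environments work like stacks: \<open>e 0\<close> is the variable bound last, and \<open>\<lambda>n. e (Suc n)\<close> is the
  environment outside its quantifier.  So \<open>trm\<close> says that the graph of a function of the
  environment is definable.  In this form, definability of a formula written in HOL is proved by
  resolution with one rule for each connective.
\<close>

definition trm :: "'a::set_universe set \<Rightarrow> 'a set \<Rightarrow> ('a \<Rightarrow> 'a) \<Rightarrow>
    ((nat \<Rightarrow> 'a) \<Rightarrow> 'a) \<Rightarrow> ((nat \<Rightarrow> 'a) \<Rightarrow> 'a) \<Rightarrow> bool" where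
  "trm V M j t s \<longleftrightarrow> (\<forall>e\<in>envs V. t e \<in> V) \<and> (\<forall>e\<in>envs M. s e \<in> M) \<and>
     dfn V M j (\<lambda>e. e 0 = t (\<lambda>n. e (Suc n))) (\<lambda>e. e 0 = s (\<lambda>n. e (Suc n)))"

locale two_models =
  fixes V M :: "'a::set_universe set" and j :: "'a \<Rightarrow> 'a"
  assumes trans_V: "transitive_class V" and trans_M: "transitive_class M"
    and j_closed: "x \<in> V \<Longrightarrow> j x \<in> M" and nonempty: "V \<noteq> {}"
begin

lemma dfn_cong:
  assumes "dfn V M j P Q" "\<And>e. e \<in> envs V \<Longrightarrow> P' e \<longleftrightarrow> P e" "\<And>e. e \<in> envs M \<Longrightarrow> Q' e \<longleftrightarrow> Q e"
  shows "dfn V M j P' Q'"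
  using assms unfolding dfn_def by simp

lemma dfn_rename:
  assumes "dfn V M j P Q" "inj g"
  shows "dfn V M j (\<lambda>e. P (\<lambda>n. e (g n))) (\<lambda>e. Q (\<lambda>n. e (g n)))"
proof -
  obtain \<phi> p where p: "p \<in> envs V"
    and 1: "\<And>e. e \<in> envs V \<Longrightarrow> P e \<longleftrightarrow> sat V (mixenv e p) \<phi>"
    and 2: "\<And>e. e \<in> envs M \<Longrightarrow> Q e \<longleftrightarrow> sat M (mixenv e (\<lambda>n. j (p n))) \<phi>"
    using assms(1) by (auto simp: dfn_def)
  have "inj (evod g (\<lambda>n. n))" using assms(2) by (simp add: inj_evod)
  then show ?thesis
    unfolding dfn_def using p 1 2
    by (intro exI[of _ "rename (evod g (\<lambda>n. n)) \<phi>"] exI[of _ p]) (simp add: sat_rename mixenv_evod)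
qed

lemma dfn_Neg:
  assumes "dfn V M j P Q"
  shows "dfn V M j (\<lambda>e. \<not> P e) (\<lambda>e. \<not> Q e)"
proof -
  obtain \<phi> p where "p \<in> envs V"
    "\<And>e. e \<in> envs V \<Longrightarrow> P e \<longleftrightarrow> sat V (mixenv e p) \<phi>"
    "\<And>e. e \<in> envs M \<Longrightarrow> Q e \<longleftrightarrow> sat M (mixenv e (\<lambda>n. j (p n))) \<phi>"
    using assms by (auto simp: dfn_def)
  then show ?thesis
    unfolding dfn_def by (intro exI[of _ "Neg \<phi>"] exI[of _ p]) simp
qed

lemma dfn_Conj:
  assumes "dfn V M j P Q" "dfn V M j P' Q'"
  shows "dfn V M j (\<lambda>e. P e \<and> P' e) (\<lambda>e. Q e \<and> Q' e)"
proof -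
  obtain \<phi> p where p: "p \<in> envs V"
    and 1: "\<And>e. e \<in> envs V \<Longrightarrow> P e \<longleftrightarrow> sat V (mixenv e p) \<phi>"
    and 2: "\<And>e. e \<in> envs M \<Longrightarrow> Q e \<longleftrightarrow> sat M (mixenv e (\<lambda>n. j (p n))) \<phi>"
    using assms(1) by (auto simp: dfn_def)
  obtain \<psi> q where q: "q \<in> envs V"
    and 3: "\<And>e. e \<in> envs V \<Longrightarrow> P' e \<longleftrightarrow> sat V (mixenv e q) \<psi>"
    and 4: "\<And>e. e \<in> envs M \<Longrightarrow> Q' e \<longleftrightarrow> sat M (mixenv e (\<lambda>n. j (q n))) \<psi>"
    using assms(2) by (auto simp: dfn_def)
  let ?f = "evod (\<lambda>n. n) (\<lambda>n. 2 * n)" and ?g = "evod (\<lambda>n. n) (\<lambda>n. Suc (2 * n))"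
  have inj: "inj ?f" "inj ?g"
    by (rule inj_evod; simp add: inj_def)+
  have "(\<lambda>n. j (mixenv p q n)) = mixenv (\<lambda>n. j (p n)) (\<lambda>n. j (q n))"
    by (auto simp: mixenv_def)
  moreover have "mixenv p q \<in> envs V"
    using p q by (auto simp: mixenv_def intro!: envsI)
  moreover note inj
  ultimately show ?thesis
    unfolding dfn_def using 1 2 3 4
    by (intro exI[of _ "Conj (rename ?f \<phi>) (rename ?g \<psi>)"] exI[of _ "mixenv p q"])
      (simp add: sat_rename[OF inj(1)] sat_rename[OF inj(2)] mixenv_evod)
qed

text \<open>
  Variable 1 is the first parameter slot: it becomes the bound variable in \<open>dfn_Forall\<close> and holds
  the constant in \<open>dfn_const_subst\<close>; all other variables move up to make room.
\<close>

definition slot :: "nat \<Rightarrow> nat" where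
  "slot m = (if m = 0 then 1 else if even m then m - 2 else m + 2)"

lemma slot:
  shows "inj slot"
    and "mixenv e (case_nat c p) \<circ> slot = mixenv (case_nat c e) p"
    and "((mixenv e (case_nat c p))(Suc 0 := x)) \<circ> slot = mixenv (case_nat x e) p"
proof -
  show "inj slot"
  proof (rule injI)
    fix m n assume eq: "slot m = slot n"
    have "slot i = 1 \<longleftrightarrow> i = 0" "even (slot i) \<longleftrightarrow> i \<noteq> 0 \<and> even i" for i
      unfolding slot_def by presburger+
    then have "m = 0 \<longleftrightarrow> n = 0" "m \<noteq> 0 \<and> even m \<longleftrightarrow> n \<noteq> 0 \<and> even n"
      using eq by metis+
    then show "m = n" using eq by (auto simp: slot_def elim!: evenE split: if_splits)
  qed
  have *: "\<exists>k. n = 2 * Suc k" if "n \<noteq> 0" "even n" for n :: nat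
    using that by (metis evenE mult_is_0 not0_implies_Suc)
  show 1: "mixenv e (case_nat c p) \<circ> slot = mixenv (case_nat c e) p" for c
  proof
    fix n
    consider "n = 0" | k where "n = 2 * Suc k" | k where "n = 2 * k + 1"
      using * by (metis oddE)
    then show "(mixenv e (case_nat c p) \<circ> slot) n = mixenv (case_nat c e) p n"
      by cases (auto simp: slot_def mixenv_def)
  qed
  have "(mixenv e (case_nat c p))(Suc 0 := x) = mixenv e (case_nat x p)"
  proof
    fix n
    consider "n = Suc 0" | "even n" | k where "n = 2 * Suc k + 1"
      by (metis One_nat_def add.left_neutral mult_0_right not0_implies_Suc oddE)
    then show "((mixenv e (case_nat c p))(Suc 0 := x)) n = mixenv e (case_nat x p) n"
      by cases (auto simp: mixenv_def)
  qed
  with 1 show "((mixenv e (case_nat c p))(Suc 0 := x)) \<circ> slot = mixenv (case_nat x e) p"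
    by simp
qed

lemma envs_case_nat [simp]: "x \<in> V' \<Longrightarrow> e \<in> envs V' \<Longrightarrow> case_nat x e \<in> envs V'"
  by (auto simp: envs_def split: nat.splits)

lemma j_case_nat: "(\<lambda>n. j (case_nat c p n)) = case_nat (j c) (\<lambda>n. j (p n))"
  by (auto simp: fun_eq_iff split: nat.splits)

lemma dfn_Forall:
  assumes "dfn V M j (\<lambda>e. P (e 0) (\<lambda>n. e (Suc n))) (\<lambda>e. Q (e 0) (\<lambda>n. e (Suc n)))"
  shows "dfn V M j (\<lambda>e. \<forall>x\<in>V. P x e) (\<lambda>e. \<forall>x\<in>M. Q x e)"
proof -
  obtain \<phi> p where p: "p \<in> envs V"
    and 1: "\<And>e. e \<in> envs V \<Longrightarrow> P (e 0) (\<lambda>n. e (Suc n)) \<longleftrightarrow> sat V (mixenv e p) \<phi>"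
    and 2: "\<And>e. e \<in> envs M \<Longrightarrow> Q (e 0) (\<lambda>n. e (Suc n)) \<longleftrightarrow> sat M (mixenv e (\<lambda>n. j (p n))) \<phi>"
    using assms(1) by (auto simp: dfn_def)
  have "P x e \<longleftrightarrow> sat V (mixenv (case_nat x e) p) \<phi>" if "e \<in> envs V" "x \<in> V" for e x
    using 1[of "case_nat x e"] that by simp
  moreover have "Q x e \<longleftrightarrow> sat M (mixenv (case_nat x e) (\<lambda>n. j (p n))) \<phi>" if "e \<in> envs M" "x \<in> M" for e x
    using 2[of "case_nat x e"] that by simp
  ultimately show ?thesis
    unfolding dfn_def using p
    by (intro exI[of _ "Forall 1 (rename slot \<phi>)"] exI[of _ "case_nat (p 0) p"])
      (simp add: sat_rename[OF slot(1)] slot(3) j_case_nat)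
qed

lemma dfn_const_subst:
  assumes "dfn V M j (\<lambda>e. P (e 0) (\<lambda>n. e (Suc n))) (\<lambda>e. Q (e 0) (\<lambda>n. e (Suc n)))"
    and c: "c \<in> V"
  shows "dfn V M j (\<lambda>e. P c e) (\<lambda>e. Q (j c) e)"
proof -
  obtain \<phi> p where p: "p \<in> envs V"
    and 1: "\<And>e. e \<in> envs V \<Longrightarrow> P (e 0) (\<lambda>n. e (Suc n)) \<longleftrightarrow> sat V (mixenv e p) \<phi>"
    and 2: "\<And>e. e \<in> envs M \<Longrightarrow> Q (e 0) (\<lambda>n. e (Suc n)) \<longleftrightarrow> sat M (mixenv e (\<lambda>n. j (p n))) \<phi>"
    using assms(1) by (auto simp: dfn_def)
  have "P c e \<longleftrightarrow> sat V (mixenv (case_nat c e) p) \<phi>" if "e \<in> envs V" for e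
    using 1[of "case_nat c e"] that c by simp
  moreover have "Q (j c) e \<longleftrightarrow> sat M (mixenv (case_nat (j c) e) (\<lambda>n. j (p n))) \<phi>" if "e \<in> envs M" for e
    using 2[of "case_nat (j c) e"] that j_closed[OF c] by simp
  ultimately show ?thesis
    unfolding dfn_def using p c
    by (intro exI[of _ "rename slot \<phi>"] exI[of _ "case_nat c p"])
      (simp add: sat_rename[OF slot(1)] slot(2) j_case_nat)
qed

lemma dfn_var_Mem: "dfn V M j (\<lambda>e. e m \<in> elts (e n)) (\<lambda>e. e m \<in> elts (e n))"
  unfolding dfn_def
  by (rule exI[of _ "Mem (2*m) (2*n)"]) (use nonempty in \<open>auto simp: mixenv_def intro: envsI\<close>)

lemma dfn_var_Eq: "dfn V M j (\<lambda>e. e m = e n) (\<lambda>e. e m = e n)"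
  unfolding dfn_def
  by (rule exI[of _ "Eq (2*m) (2*n)"]) (use nonempty in \<open>auto simp: mixenv_def intro: envsI\<close>)

end

lemma vset_eqI: "elts z = S \<Longrightarrow> vset S = z"
  by auto

lemma inj_lift_up: "inj g \<Longrightarrow> inj (case_nat 0 (\<lambda>n. Suc (g n)))"
proof (rule injI)
  fix m n assume "inj g" "case_nat 0 (\<lambda>n. Suc (g n)) m = case_nat 0 (\<lambda>n. Suc (g n)) n"
  then show "m = n" by (cases m; cases n) (auto dest: injD)
qed

context two_models
begin

lemma dfn_imp:
  "dfn V M j P Q \<Longrightarrow> dfn V M j P' Q' \<Longrightarrow> dfn V M j (\<lambda>e. P e \<longrightarrow> P' e) (\<lambda>e. Q e \<longrightarrow> Q' e)"
  by (rule dfn_cong[OF dfn_Neg[OF dfn_Conj[OF _ dfn_Neg]]]) auto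

lemma dfn_Disj:
  "dfn V M j P Q \<Longrightarrow> dfn V M j P' Q' \<Longrightarrow> dfn V M j (\<lambda>e. P e \<or> P' e) (\<lambda>e. Q e \<or> Q' e)"
  by (rule dfn_cong[OF dfn_Neg[OF dfn_Conj[OF dfn_Neg dfn_Neg]]]) auto

lemma dfn_iff:
  assumes "dfn V M j P Q" "dfn V M j P' Q'"
  shows "dfn V M j (\<lambda>e. P e \<longleftrightarrow> P' e) (\<lambda>e. Q e \<longleftrightarrow> Q' e)"
  by (rule dfn_cong[OF dfn_Conj[OF dfn_imp[OF assms] dfn_imp[OF assms(2,1)]]]) auto

lemma dfn_Exists:
  assumes "dfn V M j (\<lambda>e. P (e 0) (\<lambda>n. e (Suc n))) (\<lambda>e. Q (e 0) (\<lambda>n. e (Suc n)))"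
  shows "dfn V M j (\<lambda>e. \<exists>x\<in>V. P x e) (\<lambda>e. \<exists>x\<in>M. Q x e)"
  by (rule dfn_cong[OF dfn_Neg[OF dfn_Forall[where P = "\<lambda>x e. \<not> P x e" and Q = "\<lambda>x e. \<not> Q x e"]]])
    (use dfn_Neg[OF assms] in auto)

lemma trm_closed: "trm V M j t s \<Longrightarrow> e \<in> envs V \<Longrightarrow> t e \<in> V"
  "trm V M j t s \<Longrightarrow> e \<in> envs M \<Longrightarrow> s e \<in> M"
  unfolding trm_def by auto

lemma trm_rename:
  assumes "trm V M j t s" "inj g"
  shows "trm V M j (\<lambda>e. t (\<lambda>n. e (g n))) (\<lambda>e. s (\<lambda>n. e (g n)))"
proof -
  have "inj (case_nat 0 (\<lambda>n. Suc (g n)))"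
    using inj_lift_up[OF assms(2)] .
  from dfn_rename[where P = "\<lambda>e. e 0 = t (\<lambda>n. e (Suc n))" and Q = "\<lambda>e. e 0 = s (\<lambda>n. e (Suc n))", OF _ this] assms(1)
  show ?thesis unfolding trm_def by simp
qed

lemmas trm_shift = trm_rename[OF _ inj_Suc]

lemma trm_var: "trm V M j (\<lambda>e. e n) (\<lambda>e. e n)"
  unfolding trm_def using dfn_var_Eq by auto

lemma trm_const: "c \<in> V \<Longrightarrow> j c = d \<Longrightarrow> trm V M j (\<lambda>_. c) (\<lambda>_. d)"
  unfolding trm_def
  using j_closed dfn_const_subst[where P = "\<lambda>c e. e 0 = c" and Q = "\<lambda>c e. e 0 = c", OF dfn_var_Eq[of "Suc 0" 0]]
  by auto

lemma dfn_subst: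
  assumes "dfn V M j (\<lambda>e. P (e 0) (\<lambda>n. e (Suc n))) (\<lambda>e. Q (e 0) (\<lambda>n. e (Suc n)))"
    and "trm V M j t s"
  shows "dfn V M j (\<lambda>e. P (t e) e) (\<lambda>e. Q (s e) e)"
proof (rule dfn_cong[OF dfn_Exists[where P = "\<lambda>x e. x = t e \<and> P x e" and Q = "\<lambda>x e. x = s e \<and> Q x e"]])
  show "dfn V M j (\<lambda>e. e 0 = t (\<lambda>n. e (Suc n)) \<and> P (e 0) (\<lambda>n. e (Suc n)))
    (\<lambda>e. e 0 = s (\<lambda>n. e (Suc n)) \<and> Q (e 0) (\<lambda>n. e (Suc n)))"
    using assms(2) by (intro dfn_Conj assms(1)) (simp add: trm_def)
qed (use trm_closed[OF assms(2)] in auto)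

lemma dfn_subst1:
  assumes "dfn V M j (\<lambda>e. P (e 0)) (\<lambda>e. Q (e 0))" "trm V M j t s"
  shows "dfn V M j (\<lambda>e. P (t e)) (\<lambda>e. Q (s e))"
  by (rule dfn_subst[OF _ assms(2)]) (rule assms(1))

lemma dfn_subst2:
  assumes "dfn V M j (\<lambda>e. P (e (Suc 0)) (e 0)) (\<lambda>e. Q (e (Suc 0)) (e 0))"
    and "trm V M j t s" "trm V M j t' s'"
  shows "dfn V M j (\<lambda>e. P (t e) (t' e)) (\<lambda>e. Q (s e) (s' e))"
  by (rule dfn_subst[where P = "\<lambda>x e. P x (t' e)" and Q = "\<lambda>x e. Q x (s' e)", OF _ assms(2)])
    (rule dfn_subst[where P = "\<lambda>y e. P (e 0) y" and Q = "\<lambda>y e. Q (e 0) y",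
        OF _ trm_shift[OF assms(3)]], rule assms(1))

lemma dfn_subst3:
  assumes "dfn V M j (\<lambda>e. P (e (Suc (Suc 0))) (e (Suc 0)) (e 0)) (\<lambda>e. Q (e (Suc (Suc 0))) (e (Suc 0)) (e 0))"
    and "trm V M j t s" "trm V M j t' s'" "trm V M j t'' s''"
  shows "dfn V M j (\<lambda>e. P (t e) (t' e) (t'' e)) (\<lambda>e. Q (s e) (s' e) (s'' e))"
  by (rule dfn_subst[where P = "\<lambda>x e. P x (t' e) (t'' e)" and Q = "\<lambda>x e. Q x (s' e) (s'' e)", OF _ assms(2)],
      rule dfn_subst[where P = "\<lambda>y e. P (e 0) y (t'' (\<lambda>n. e (Suc n)))" and Q = "\<lambda>y e. Q (e 0) y (s'' (\<lambda>n. e (Suc n)))",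
        OF _ trm_shift[OF assms(3)]],
      rule dfn_subst[where P = "\<lambda>z e. P (e (Suc 0)) (e 0) z" and Q = "\<lambda>z e. Q (e (Suc 0)) (e 0) z",
        OF _ trm_shift[OF trm_shift[OF assms(4)]]], rule assms(1))

lemmas dfn_Mem = dfn_subst2[where P = "\<lambda>x y. x \<in> elts y" and Q = "\<lambda>x y. x \<in> elts y",
    OF dfn_var_Mem[of "Suc 0" 0]]
lemmas dfn_Eq = dfn_subst2[where P = "\<lambda>x y. x = y" and Q = "\<lambda>x y. x = y",
    OF dfn_var_Eq[of "Suc 0" 0]]

lemma dfn_Ball:
  assumes "trm V M j t s"
    and "dfn V M j (\<lambda>e. P (e 0) (\<lambda>n. e (Suc n))) (\<lambda>e. Q (e 0) (\<lambda>n. e (Suc n)))"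
  shows "dfn V M j (\<lambda>e. \<forall>x\<in>elts (t e). P x e) (\<lambda>e. \<forall>x\<in>elts (s e). Q x e)"
proof (rule dfn_cong)
  show "dfn V M j (\<lambda>e. \<forall>x\<in>V. x \<in> elts (t e) \<longrightarrow> P x e) (\<lambda>e. \<forall>x\<in>M. x \<in> elts (s e) \<longrightarrow> Q x e)"
    by (intro dfn_Forall dfn_imp assms(2) dfn_Mem trm_var trm_shift[OF assms(1)])
qed (use trm_closed[OF assms(1)] transitive_classD[OF trans_V] transitive_classD[OF trans_M] in blast)+

lemma dfn_Bex:
  assumes "trm V M j t s"
    and "dfn V M j (\<lambda>e. P (e 0) (\<lambda>n. e (Suc n))) (\<lambda>e. Q (e 0) (\<lambda>n. e (Suc n)))"
  shows "dfn V M j (\<lambda>e. \<exists>x\<in>elts (t e). P x e) (\<lambda>e. \<exists>x\<in>elts (s e). Q x e)"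
  by (rule dfn_cong[OF dfn_Neg[OF dfn_Ball[OF assms(1),
          where P = "\<lambda>x e. \<not> P x e" and Q = "\<lambda>x e. \<not> Q x e"]]])
    (use dfn_Neg[OF assms(2)] in auto)

lemma dfn_subset:
  assumes "trm V M j t s" "trm V M j t' s'"
  shows "dfn V M j (\<lambda>e. elts (t e) \<subseteq> elts (t' e)) (\<lambda>e. elts (s e) \<subseteq> elts (s' e))"
  unfolding subset_eq by (intro dfn_Ball dfn_Mem trm_var trm_shift assms)

text \<open>
  All quantifiers are bounded by sets, so this characterisation has the same meaning in every
  transitive class.
\<close>

lemma vpair_iff_elts: "p = vpair x y \<longleftrightarrow>
    (\<exists>a\<in>elts p. \<exists>b\<in>elts p. (\<forall>z\<in>elts p. z = a \<or> z = b) \<and>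
      x \<in> elts a \<and> (\<forall>z\<in>elts a. z = x) \<and>
      x \<in> elts b \<and> y \<in> elts b \<and> (\<forall>z\<in>elts b. z = x \<or> z = y))" (is "_ \<longleftrightarrow> ?R")
proof
  assume ?R
  then show "p = vpair x y"
  proof (elim bexE conjE)
  fix a b assume ab: "a \<in> elts p" "b \<in> elts p" "\<forall>z\<in>elts p. z = a \<or> z = b"
    "x \<in> elts a" "\<forall>z\<in>elts a. z = x" "x \<in> elts b" "y \<in> elts b" "\<forall>z\<in>elts b. z = x \<or> z = y"
  have "elts p = {a, b}" using ab(1-3) by blast
  moreover have "elts a = {x}" using ab(4,5) by blast
  moreover have "elts b = {x, y}" using ab(6-8) by blast
  ultimately have "elts p = {vset {x}, vset {x, y}}" using vset_eqI[of a] vset_eqI[of b] by simp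
  then show "p = vpair x y" by (intro extensionality) (simp add: elts_vpair)
  qed
qed (simp add: elts_vpair)

lemma dfn_is_vpair:
  assumes "trm V M j r r'" "trm V M j t t'" "trm V M j s s'"
  shows "dfn V M j (\<lambda>e. r e = vpair (t e) (s e)) (\<lambda>e. r' e = vpair (t' e) (s' e))"
proof -
  have "dfn V M j (\<lambda>e. e 2 = vpair (e 1) (e 0)) (\<lambda>e. e 2 = vpair (e 1) (e 0))"
    unfolding vpair_iff_elts
    by (intro dfn_Bex dfn_Conj dfn_Ball dfn_Disj dfn_Eq dfn_Mem trm_var)
  then show ?thesis
    by (intro dfn_subst3[where P = "\<lambda>a b c. a = vpair b c" and Q = "\<lambda>a b c. a = vpair b c", OF _ assms])
      (simp add: numeral_2_eq_2)
qed

lemma dfn_vpair_Mem: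
  assumes "trm V M j t t'" "trm V M j s s'" "trm V M j r r'"
  shows "dfn V M j (\<lambda>e. vpair (t e) (s e) \<in> elts (r e)) (\<lambda>e. vpair (t' e) (s' e) \<in> elts (r' e))"
proof -
  have "dfn V M j (\<lambda>e. \<exists>p\<in>elts (r e). p = vpair (t e) (s e)) (\<lambda>e. \<exists>p\<in>elts (r' e). p = vpair (t' e) (s' e))"
    by (intro dfn_Bex dfn_is_vpair trm_var trm_shift assms)
  then show ?thesis by simp
qed

(* trm_const comes last, since its conclusion matches every term without variables. *)
lemmas dfn_rules = dfn_vpair_Mem dfn_is_vpair dfn_subset dfn_Ball dfn_Bex dfn_Forall dfn_Exists
  dfn_Conj dfn_Disj dfn_imp dfn_iff dfn_Neg dfn_Mem dfn_Eq trm_var trm_const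

end

lemma
  assumes "zfc_model V"
  shows zfc_model_nonempty: "V \<noteq> {}"
    and zfc_model_pair: "\<forall>x\<in>V. \<forall>y\<in>V. \<exists>z\<in>V. \<forall>w\<in>V. w \<in> elts z \<longleftrightarrow> w = x \<or> w = y"
    and zfc_model_union: "\<forall>x\<in>V. \<exists>z\<in>V. \<forall>w\<in>V. w \<in> elts z \<longleftrightarrow> (\<exists>y\<in>V. y \<in> elts x \<and> w \<in> elts y)"
    and zfc_model_power: "\<forall>x\<in>V. \<exists>z\<in>V. \<forall>w\<in>V. w \<in> elts z \<longleftrightarrow> (\<forall>y\<in>V. y \<in> elts w \<longrightarrow> y \<in> elts x)"
    and zfc_model_separation: "\<forall>\<phi> e. range e \<subseteq> V \<longrightarrow>
      (\<forall>x\<in>V. \<exists>z\<in>V. \<forall>w\<in>V. w \<in> elts z \<longleftrightarrow> w \<in> elts x \<and> sat V (e(0 := w)) \<phi>)"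
    and zfc_model_replacement: "\<forall>\<phi> e. range e \<subseteq> V \<longrightarrow>
      (\<forall>x\<in>V. (\<forall>u\<in>V. u \<in> elts x \<longrightarrow> (\<exists>!w. w \<in> V \<and> sat V (e(0 := u, 1 := w)) \<phi>)) \<longrightarrow>
        (\<exists>z\<in>V. \<forall>w\<in>V. w \<in> elts z \<longleftrightarrow>
          (\<exists>u\<in>V. u \<in> elts x \<and> sat V (e(0 := u, 1 := w)) \<phi>)))"
    and zfc_model_choice: "\<forall>x\<in>V. (\<forall>y\<in>V. y \<in> elts x \<longrightarrow> (\<exists>u\<in>V. u \<in> elts y)) \<and>
      (\<forall>y\<in>V. \<forall>z\<in>V. y \<in> elts x \<and> z \<in> elts x \<and> y \<noteq> z \<longrightarrow>
        (\<forall>u\<in>V. \<not> (u \<in> elts y \<and> u \<in> elts z))) \<longrightarrow>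
      (\<exists>c\<in>V. \<forall>y\<in>V. y \<in> elts x \<longrightarrow> (\<exists>!u. u \<in> V \<and> u \<in> elts y \<and> u \<in> elts c))"
proof -
  note ax = assms[unfolded zfc_model_def]
  show "V \<noteq> {}" using ax by (elim conjE bexE) (rule notI, simp)
  note r = ax[THEN conjunct2, THEN conjunct2]
  show "\<forall>x\<in>V. \<forall>y\<in>V. \<exists>z\<in>V. \<forall>w\<in>V. w \<in> elts z \<longleftrightarrow> w = x \<or> w = y"
    by (rule r[THEN conjunct1])
  note r = r[THEN conjunct2]
  show "\<forall>x\<in>V. \<exists>z\<in>V. \<forall>w\<in>V. w \<in> elts z \<longleftrightarrow> (\<exists>y\<in>V. y \<in> elts x \<and> w \<in> elts y)"
    by (rule r[THEN conjunct1])
  note r = r[THEN conjunct2]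
  show "\<forall>x\<in>V. \<exists>z\<in>V. \<forall>w\<in>V. w \<in> elts z \<longleftrightarrow> (\<forall>y\<in>V. y \<in> elts w \<longrightarrow> y \<in> elts x)"
    by (rule r[THEN conjunct1])
  note r = r[THEN conjunct2, THEN conjunct2]
  show "\<forall>\<phi> e. range e \<subseteq> V \<longrightarrow>
      (\<forall>x\<in>V. \<exists>z\<in>V. \<forall>w\<in>V. w \<in> elts z \<longleftrightarrow> w \<in> elts x \<and> sat V (e(0 := w)) \<phi>)"
    by (rule r[THEN conjunct1])
  note r = r[THEN conjunct2]
  show "\<forall>\<phi> e. range e \<subseteq> V \<longrightarrow>
      (\<forall>x\<in>V. (\<forall>u\<in>V. u \<in> elts x \<longrightarrow> (\<exists>!w. w \<in> V \<and> sat V (e(0 := u, 1 := w)) \<phi>)) \<longrightarrow>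
        (\<exists>z\<in>V. \<forall>w\<in>V. w \<in> elts z \<longleftrightarrow>
          (\<exists>u\<in>V. u \<in> elts x \<and> sat V (e(0 := u, 1 := w)) \<phi>)))"
    by (rule r[THEN conjunct1])
  show "\<forall>x\<in>V. (\<forall>y\<in>V. y \<in> elts x \<longrightarrow> (\<exists>u\<in>V. u \<in> elts y)) \<and>
      (\<forall>y\<in>V. \<forall>z\<in>V. y \<in> elts x \<and> z \<in> elts x \<and> y \<noteq> z \<longrightarrow>
        (\<forall>u\<in>V. \<not> (u \<in> elts y \<and> u \<in> elts z))) \<longrightarrow>
      (\<exists>c\<in>V. \<forall>y\<in>V. y \<in> elts x \<longrightarrow> (\<exists>!u. u \<in> V \<and> u \<in> elts y \<and> u \<in> elts c))"
    by (rule r[THEN conjunct2])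
qed

section \<open>Closure of the ground model under definable operations\<close>

locale zf_class =
  fixes V :: "'a::set_universe set"
  assumes transV: "transitive_class V" and zfc: "zfc_model V"
begin

lemma V_nonempty: "V \<noteq> {}"
  using zfc_model_nonempty[OF zfc] .

lemma V_elts: "x \<in> V \<Longrightarrow> y \<in> elts x \<Longrightarrow> y \<in> V"
  using transitive_classD[OF transV] .

lemma eq_vset_V:
  assumes "z \<in> V" "\<And>w. w \<in> V \<Longrightarrow> w \<in> elts z \<longleftrightarrow> w \<in> S" "S \<subseteq> V"
  shows "elts z = S" "vset S \<in> V"
proof -
  show "elts z = S" using assms(2,3) V_elts[OF assms(1)] by blast
  then show "vset S \<in> V" using assms(1) vset_eqI by metis
qed

sublocale two_models V V "\<lambda>x. x"
  by unfold_locales (use transV V_nonempty in auto)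

abbreviation "def P \<equiv> dfn V V (\<lambda>x. x) P P"
abbreviation "tm t \<equiv> trm V V (\<lambda>x. x) t t"
abbreviation "dfun f \<equiv> tm (\<lambda>e. f (e 0))"
abbreviation "dpred P \<equiv> def (\<lambda>e. P (e 0))"

lemma tm_V: "tm (\<lambda>_. c) \<Longrightarrow> c \<in> V"
  using V_nonempty trm_closed(1)[of "\<lambda>_. c" "\<lambda>_. c"] envsI[of "\<lambda>_. _" V] by blast

lemma V_vpair_aux:
  assumes "x \<in> V" "y \<in> V"
  shows "vset {x, y} \<in> V"
proof -
  obtain z where z: "z \<in> V" "\<forall>w\<in>V. w \<in> elts z \<longleftrightarrow> w = x \<or> w = y"
    using bspec[OF bspec[OF zfc_model_pair[OF zfc] assms(1)] assms(2)] by (elim bexE)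
  show ?thesis by (rule eq_vset_V(2)[OF z(1)]) (use z(2) assms in auto)
qed

lemma V_Union_aux:
  assumes "x \<in> V"
  shows "vset (\<Union>y\<in>elts x. elts y) \<in> V"
proof -
  obtain z where z: "z \<in> V" "\<forall>w\<in>V. w \<in> elts z \<longleftrightarrow> (\<exists>y\<in>V. y \<in> elts x \<and> w \<in> elts y)"
    using bspec[OF zfc_model_union[OF zfc] assms] by (elim bexE)
  show ?thesis by (rule eq_vset_V(2)[OF z(1)]) (use z(2) V_elts[OF assms] V_elts in blast)+
qed

definition vpow :: "'a \<Rightarrow> 'a" where
  "vpow x = vset {w \<in> V. elts w \<subseteq> elts x}"

lemma vpow:
  assumes "x \<in> V"
  shows "vpow x \<in> V" "elts (vpow x) = {w \<in> V. elts w \<subseteq> elts x}"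
proof -
  obtain z where z: "z \<in> V" "\<forall>w\<in>V. w \<in> elts z \<longleftrightarrow> (\<forall>y\<in>V. y \<in> elts w \<longrightarrow> y \<in> elts x)"
    using bspec[OF zfc_model_power[OF zfc] assms] by (elim bexE)
  have "elts z = {w \<in> V. elts w \<subseteq> elts x}"
    by (rule eq_vset_V(1)[OF z(1)]) (use z(2) V_elts in blast)+
  then show "vpow x \<in> V" "elts (vpow x) = {w \<in> V. elts w \<subseteq> elts x}"
    using z(1) vset_eqI[of z] by (simp_all add: vpow_def)
qed

lemma V_Collect_aux:
  assumes "def (\<lambda>e. P (e 0) (\<lambda>n. e (Suc n)))" "e \<in> envs V" "x \<in> V"
  shows "vset {w \<in> elts x. P w e} \<in> V"
proof -
  obtain \<phi> p where p: "p \<in> envs V"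
    and \<phi>: "\<And>e. e \<in> envs V \<Longrightarrow> P (e 0) (\<lambda>n. e (Suc n)) \<longleftrightarrow> sat V (mixenv e p) \<phi>"
    using assms(1) by (auto simp: dfn_def)
  have "range (mixenv (case_nat x e) p) \<subseteq> V"
    using p assms(2,3) by (auto simp: mixenv_def envs_def split: nat.splits)
  then obtain z where z: "z \<in> V"
    "\<forall>w\<in>V. w \<in> elts z \<longleftrightarrow> w \<in> elts x \<and> sat V ((mixenv (case_nat x e) p)(0 := w)) \<phi>"
    using zfc_model_separation[OF zfc, rule_format, of "mixenv (case_nat x e) p" x \<phi>] assms(3) by blast
  have "(mixenv (case_nat x e) p)(0 := w) = mixenv (case_nat w e) p" for w
    by (auto simp: mixenv_def fun_eq_iff split: nat.splits)
  then have "sat V ((mixenv (case_nat x e) p)(0 := w)) \<phi> \<longleftrightarrow> P w e" if "w \<in> V" for w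
    using \<phi>[of "case_nat w e"] that assms(2) by simp
  then show ?thesis
    by (intro eq_vset_V(2)[OF z(1)]) (use z(2) V_elts[OF assms(3)] in auto)
qed

text \<open>
  The replacement schema speaks about the variables 0 and 1, whereas \<open>mixenv\<close> puts the two topmost
  arguments into the variables 0 and 2; the formula has to be renamed accordingly.
\<close>

lemma V_image_aux:
  assumes "tm (\<lambda>e. F (e 0) (\<lambda>n. e (Suc n)))" "e \<in> envs V" "X \<in> V"
  shows "vset ((\<lambda>x. F x e) ` elts X) \<in> V"
proof -
  have "def (\<lambda>e. e 0 = F (e 1) (\<lambda>n. e (Suc (Suc n))))"
    using assms(1) unfolding trm_def by simp
  then obtain \<phi> p where p: "p \<in> envs V"
    and \<phi>: "\<And>e. e \<in> envs V \<Longrightarrow> e 0 = F (e 1) (\<lambda>n. e (Suc (Suc n))) \<longleftrightarrow> sat V (mixenv e p) \<phi>"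
    by (auto simp: dfn_def)
  have FV: "F x e \<in> V" if "x \<in> V" for x
    using trm_closed(1)[OF assms(1), of "case_nat x e"] that assms(2) by simp
  define f :: "nat \<Rightarrow> nat" where "f n = (if n = 0 then 1 else if n = 2 then 0 else n + 2)" for n
  define E where "E n = mixenv (case_nat X (case_nat X e)) p (n - 2)" for n
  have "inj f" by (auto simp: inj_def f_def)
  have upd: "(E(0 := u, 1 := w)) \<circ> f = mixenv (case_nat w (case_nat u e)) p" for u w
  proof
    fix n
    consider "n = 0" | "n = 2" | "odd n" | k where "n = 2 * Suc (Suc k)"
      by (metis evenE mult_0_right mult_1_right not0_implies_Suc One_nat_def)
    then show "((E(0 := u, 1 := w)) \<circ> f) n = mixenv (case_nat w (case_nat u e)) p n"
      by cases (auto simp: f_def E_def mixenv_def)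
  qed
  have sat: "sat V (E(0 := u, 1 := w)) (rename f \<phi>) \<longleftrightarrow> w = F u e" if "u \<in> V" "w \<in> V" for u w
    using \<phi>[of "case_nat w (case_nat u e)"] that assms(2) by (simp only: sat_rename[OF \<open>inj f\<close>] upd) simp
  have "range E \<subseteq> V"
    using p assms(2,3) by (auto simp: E_def mixenv_def envs_def split: nat.splits)
  moreover have "\<exists>!w. w \<in> V \<and> sat V (E(0 := u, 1 := w)) (rename f \<phi>)" if "u \<in> V" for u
    using sat[OF that] FV[OF that] by metis
  ultimately obtain z where z: "z \<in> V"
    "\<forall>w\<in>V. w \<in> elts z \<longleftrightarrow> (\<exists>u\<in>V. u \<in> elts X \<and> sat V (E(0 := u, 1 := w)) (rename f \<phi>))"
    using bspec[OF mp[OF spec[OF spec[OF zfc_model_replacement[OF zfc]]]], of E, OF _ assms(3)]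
    by (metis (no_types, lifting))
  show ?thesis
    by (rule eq_vset_V(2)[OF z(1)]) (use z(2) sat FV V_elts[OF assms(3)] in auto)
qed

text \<open>
  The graph of \<open>\<lambda>e. vset (S e)\<close> is defined by extensionality.
\<close>

lemma tm_vset:
  assumes "\<And>e. e \<in> envs V \<Longrightarrow> vset (S e) \<in> V" "\<And>e. e \<in> envs V \<Longrightarrow> small (S e)"
    and "def (\<lambda>e. e 0 \<in> S (\<lambda>n. e (Suc n)))"
  shows "tm (\<lambda>e. vset (S e))"
proof -
  have "inj (case_nat 0 (\<lambda>n. Suc (Suc n)))" using inj_lift_up[OF inj_Suc] .
  from dfn_rename[OF assms(3) this] have "def (\<lambda>e. e 0 \<in> S (\<lambda>n. e (Suc (Suc n))))" by simp
  then have 1: "def (\<lambda>e. \<forall>w\<in>V. w \<in> elts (e 0) \<longleftrightarrow> w \<in> S (\<lambda>n. e (Suc n)))"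
    by (intro dfn_rules)
  have "e 0 = vset (S (\<lambda>n. e (Suc n))) \<longleftrightarrow> (\<forall>w\<in>V. w \<in> elts (e 0) \<longleftrightarrow> w \<in> S (\<lambda>n. e (Suc n)))"
    if "e \<in> envs V" for e
  proof -
    have e': "(\<lambda>n. e (Suc n)) \<in> envs V" using that by simp
    then have "elts (e 0) \<subseteq> V" "S (\<lambda>n. e (Suc n)) \<subseteq> V"
      using assms(1)[OF e'] elts_vset_small[OF assms(2)[OF e']] V_elts envsD[OF that] by blast+
    then show ?thesis
      using vset_eq_iff[OF assms(2)[OF e'], of "e 0"] by blast
  qed
  then show ?thesis
    unfolding trm_def using dfn_cong[OF 1] assms(1) by simp
qed

lemma tm_Collect:
  assumes "tm t" "def (\<lambda>e. P (e 0) (\<lambda>n. e (Suc n)))"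
  shows "tm (\<lambda>e. vset {w \<in> elts (t e). P w e})"
proof (rule tm_vset)
  show "def (\<lambda>e. e 0 \<in> {w \<in> elts (t (\<lambda>n. e (Suc n))). P w (\<lambda>n. e (Suc n))})"
    unfolding mem_Collect_eq by (intro dfn_rules trm_shift assms)
qed (use V_Collect_aux[OF assms(2)] trm_closed(1)[OF assms(1)] in \<open>auto intro: small_subset[OF _ small_elts]\<close>)

lemma tm_image:
  assumes "tm t" "tm (\<lambda>e. F (e 0) (\<lambda>n. e (Suc n)))"
  shows "tm (\<lambda>e. vset ((\<lambda>x. F x e) ` elts (t e)))"
proof (rule tm_vset)
  have "inj (case_nat 0 (\<lambda>n. Suc (Suc n)))" using inj_lift_up[OF inj_Suc] .
  from trm_rename[OF assms(2) this]
  show "def (\<lambda>e. e 0 \<in> (\<lambda>x. F x (\<lambda>n. e (Suc n))) ` elts (t (\<lambda>n. e (Suc n))))"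
    unfolding image_iff by (intro dfn_rules trm_shift assms) simp
qed (use V_image_aux[OF assms(2)] trm_closed(1)[OF assms(1)] in \<open>auto intro: small_image\<close>)

lemma tm_Union:
  assumes "tm t"
  shows "tm (\<lambda>e. vset (\<Union>x\<in>elts (t e). elts x))"
proof (rule tm_vset)
  show "def (\<lambda>e. e 0 \<in> (\<Union>x\<in>elts (t (\<lambda>n. e (Suc n))). elts x))"
    unfolding UN_iff by (intro dfn_rules trm_shift assms)
qed (use V_Union_aux trm_closed(1)[OF assms(1)] in \<open>auto intro: small_Union\<close>)

lemma tm_UN:
  assumes "tm t" "tm (\<lambda>e. F (e 0) (\<lambda>n. e (Suc n)))"
  shows "tm (\<lambda>e. vset (\<Union>x\<in>elts (t e). elts (F x e)))"
proof -
  have "elts (vset ((\<lambda>x. F x e) ` elts (t e))) = (\<lambda>x. F x e) ` elts (t e)" for e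
    by (intro elts_vset_small small_image small_elts)
  with tm_Union[OF tm_image[OF assms]] show ?thesis by simp
qed

lemma tm_pow: assumes "tm t" shows "tm (\<lambda>e. vpow (t e))"
  unfolding vpow_def
proof (rule tm_vset)
  show "def (\<lambda>e. e 0 \<in> {w \<in> V. elts w \<subseteq> elts (t (\<lambda>n. e (Suc n)))})"
    by (rule dfn_cong[of "\<lambda>e. elts (e 0) \<subseteq> elts (t (\<lambda>n. e (Suc n)))"])
      (auto intro!: dfn_rules trm_shift assms)
next
  fix e assume "e \<in> envs V"
  then have te: "t e \<in> V" using trm_closed(1)[OF assms] by simp
  show "vset {w \<in> V. elts w \<subseteq> elts (t e)} \<in> V" using vpow(1)[OF te] by (simp add: vpow_def)
  show "small {w \<in> V. elts w \<subseteq> elts (t e)}" using small_elts[of "vpow (t e)"] by (simp add: vpow(2)[OF te])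
qed

lemma tm_doubleton: assumes "tm t" "tm s" shows "tm (\<lambda>e. vset {t e, s e})"
proof (rule tm_vset)
  show "def (\<lambda>e. e 0 \<in> {t (\<lambda>n. e (Suc n)), s (\<lambda>n. e (Suc n))})"
    unfolding insert_iff empty_iff simp_thms by (intro dfn_rules trm_shift assms)
qed (use V_vpair_aux trm_closed(1) assms in \<open>auto intro: small_finite\<close>)

lemma tm_singleton: assumes "tm t" shows "tm (\<lambda>e. vset {t e})"
  using tm_doubleton[OF assms assms] by simp

lemma tm_vpair: "tm t \<Longrightarrow> tm s \<Longrightarrow> tm (\<lambda>e. vpair (t e) (s e))"
  unfolding vpair_def by (intro tm_doubleton tm_singleton)

lemma tm_Un: assumes "tm t" "tm s" shows "tm (\<lambda>e. vset (elts (t e) \<union> elts (s e)))"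
  using tm_Union[OF tm_doubleton[OF assms]] by simp

lemma V_empty: "vset {} \<in> V"
proof -
  obtain x where x: "x \<in> V" using V_nonempty by blast
  have "tm (\<lambda>e. vset {w \<in> elts x. w \<noteq> w})" by (intro tm_Collect dfn_rules refl x)
  then show ?thesis using tm_V by simp
qed

lemma tm_If:
  assumes "def P" "tm t" "tm s"
  shows "tm (\<lambda>e. if P e then t e else s e)"
proof -
  have "def (\<lambda>e. P (\<lambda>n. e (Suc n)) \<and> e 0 = t (\<lambda>n. e (Suc n)) \<or> \<not> P (\<lambda>n. e (Suc n)) \<and> e 0 = s (\<lambda>n. e (Suc n)))"
    by (intro dfn_rules dfn_rename[OF assms(1)] trm_shift assms) simp_all
  from dfn_cong[OF this] show ?thesis
    unfolding trm_def using trm_closed(1)[OF assms(2)] trm_closed(1)[OF assms(3)] by auto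
qed

lemmas def_rules = dfn_vpair_Mem dfn_is_vpair dfn_subset dfn_Ball dfn_Bex dfn_Forall dfn_Exists
  dfn_Conj dfn_Disj dfn_imp dfn_iff dfn_Neg dfn_Mem dfn_Eq trm_var
  tm_vpair tm_If tm_pow tm_Collect tm_image tm_doubleton tm_singleton tm_Un tm_UN tm_Union trm_const

lemma tm_fun1:
  assumes "dfun F" "tm t"
  shows "tm (\<lambda>e. F (t e))"
proof -
  have "def (\<lambda>e. e 0 = F (e 1))" using assms(1) unfolding trm_def by simp
  then have "def (\<lambda>e. e 0 = F (t (\<lambda>n. e (Suc n))))"
    by (intro dfn_subst2[where P = "\<lambda>x y. y = F x" and Q = "\<lambda>x y. y = F x", OF _ trm_shift[OF assms(2)] trm_var]) simp
  moreover have "F x \<in> V" if "x \<in> V" for x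
    using trm_closed(1)[OF assms(1), of "\<lambda>_. x"] that by (auto simp: envs_def)
  ultimately show ?thesis
    unfolding trm_def using trm_closed(1)[OF assms(2)] by simp
qed

lemma tm_fun2:
  assumes "tm (\<lambda>e. F (e (Suc 0)) (e 0))" "tm t" "tm s"
  shows "tm (\<lambda>e. F (t e) (s e))"
proof -
  have "def (\<lambda>e. e 0 = F (e 2) (e 1))" using assms(1) unfolding trm_def by (simp add: numeral_2_eq_2)
  then have "def (\<lambda>e. e 0 = F (t (\<lambda>n. e (Suc n))) (s (\<lambda>n. e (Suc n))))"
    by (intro dfn_subst3[where P = "\<lambda>x y z. z = F x y" and Q = "\<lambda>x y z. z = F x y",
        OF _ trm_shift[OF assms(2)] trm_shift[OF assms(3)] trm_var])
      (simp add: numeral_2_eq_2)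
  moreover have "F x y \<in> V" if "x \<in> V" "y \<in> V" for x y
    using trm_closed(1)[OF assms(1), of "case_nat y (\<lambda>_. x)"] that by (simp add: envsI)
  ultimately show ?thesis
    unfolding trm_def using trm_closed(1)[OF assms(2)] trm_closed(1)[OF assms(3)] by simp
qed

lemma tm_closed1: "dfun F \<Longrightarrow> x \<in> V \<Longrightarrow> F x \<in> V"
  using tm_fun1[of F "\<lambda>_. x"] tm_V trm_const[of x x] by blast

lemma elts_Collect [simp]: "elts (vset {w \<in> elts x. P w}) = {w \<in> elts x. P w}"
  by (intro elts_vset_small small_subset[OF _ small_elts]) auto

lemma elts_image [simp]: fixes f :: "'a \<Rightarrow> 'a" shows "elts (vset (f ` elts x)) = f ` elts x"
  by (intro elts_vset_small small_image small_elts)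

lemma elts_UN [simp]: fixes f :: "'a \<Rightarrow> 'a" shows "elts (vset (\<Union>y\<in>elts x. elts (f y))) = (\<Union>y\<in>elts x. elts (f y))"
  by (intro elts_vset_small small_Union small_elts)

end

section \<open>Definable recursion\<close>

context zf_class
begin

lemma tm_of_def:
  assumes "\<And>x. x \<in> V \<Longrightarrow> F x \<in> V" "def (\<lambda>e. e 0 = F (e (Suc 0)))"
  shows "dfun F"
  unfolding trm_def using assms by simp

lemma tm_fun1_def: "dfun F \<Longrightarrow> def (\<lambda>e. e 0 = F (e (Suc 0)))"
  unfolding trm_def by simp

text \<open>
  A set closed under predecessors exists in the ambient universe by replacement for arbitrary
  functions, but it is needed as an element of \<open>V\<close>.  Inside \<open>V\<close>, the least closed set around a
  predecessor \<open>y\<close> is a definable function \<open>L y\<close> of \<open>y\<close>, so replacement in \<open>V\<close> collects these sets.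
\<close>

lemma pred_closure:
  assumes p: "dfun p" and wf: "wf {(y, x). x \<in> V \<and> y \<in> elts (p x)}" and "x \<in> V"
  shows "\<exists>T\<in>V. x \<in> elts T \<and> (\<forall>y\<in>elts T. elts (p y) \<subseteq> elts T)"
  using wf \<open>x \<in> V\<close>
proof (induction x rule: wf_induct_rule)
  case (less x)
  define cl where "cl T y \<longleftrightarrow> y \<in> elts T \<and> (\<forall>y\<in>elts T. elts (p y) \<subseteq> elts T)" for T y
  note p' = tm_fun1[OF p]
  have cl: "def (\<lambda>e. cl (t e) (s e))" if "tm t" "tm s" for t s
    by (rule dfn_subst2[where P = cl and Q = cl, OF _ that], unfold cl_def) (intro p' def_rules)
  define L where "L y = (if \<exists>T\<in>V. cl T y then vset {u \<in> V. \<forall>T\<in>V. cl T y \<longrightarrow> u \<in> elts T} else y)" for y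
  have L: "L y \<in> V" "elts (L y) = {u \<in> V. \<forall>T\<in>V. cl T y \<longrightarrow> u \<in> elts T}"
    if "T \<in> V" "cl T y" "y \<in> V" for T y
  proof -
    have "tm (\<lambda>_. vset {u \<in> elts T. \<forall>T\<in>V. cl T y \<longrightarrow> u \<in> elts T})"
      by (intro cl def_rules that refl)
    then have "vset {u \<in> elts T. \<forall>T\<in>V. cl T y \<longrightarrow> u \<in> elts T} \<in> V" by (rule tm_V)
    moreover have "{u \<in> V. \<forall>T\<in>V. cl T y \<longrightarrow> u \<in> elts T} = {u \<in> elts T. \<forall>T\<in>V. cl T y \<longrightarrow> u \<in> elts T}"
      using that V_elts by blast
    ultimately show "L y \<in> V" "elts (L y) = {u \<in> V. \<forall>T\<in>V. cl T y \<longrightarrow> u \<in> elts T}"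
      using that(1,2) by (auto simp: L_def)
  qed
  have LV: "L y \<in> V" if "y \<in> V" for y
  proof (cases "\<exists>T\<in>V. cl T y")
    case True
    then show ?thesis using L(1) that by blast
  qed (use that in \<open>simp add: L_def\<close>)
  have L_iff: "z = L y \<longleftrightarrow> (\<exists>T\<in>V. cl T y) \<and> (\<forall>u\<in>V. u \<in> elts z \<longleftrightarrow> (\<forall>T\<in>V. cl T y \<longrightarrow> u \<in> elts T)) \<or>
      \<not> (\<exists>T\<in>V. cl T y) \<and> z = y" if "z \<in> V" "y \<in> V" for z y
  proof (cases "\<exists>T\<in>V. cl T y")
    case True
    then obtain T where "T \<in> V" "cl T y" by blast
    from L(2)[OF this that(2)] have "z = L y \<longleftrightarrow> elts z = {u \<in> V. \<forall>T\<in>V. cl T y \<longrightarrow> u \<in> elts T}"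
      using extensionality by metis
    also have "\<dots> \<longleftrightarrow> (\<forall>u\<in>V. u \<in> elts z \<longleftrightarrow> (\<forall>T\<in>V. cl T y \<longrightarrow> u \<in> elts T))"
      using V_elts[OF that(1)] by blast
    finally show ?thesis using True by simp
  qed (simp add: L_def)
  have "def (\<lambda>e. (\<exists>T\<in>V. cl T (e (Suc 0))) \<and> (\<forall>u\<in>V. u \<in> elts (e 0) \<longleftrightarrow> (\<forall>T\<in>V. cl T (e (Suc 0)) \<longrightarrow> u \<in> elts T)) \<or>
      \<not> (\<exists>T\<in>V. cl T (e (Suc 0))) \<and> e 0 = e (Suc 0))"
    by (intro cl def_rules)
  then have "def (\<lambda>e. e 0 = L (e (Suc 0)))"
    by (rule dfn_cong) (simp_all only: L_iff envsD)
  then have tmL: "dfun L"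
    using LV by (rule tm_of_def[rotated])
  let ?T = "vset (elts (vset {x}) \<union> elts (vset (\<Union>y\<in>elts (p x). elts (L y))))"
  have "tm (\<lambda>_. ?T)"
    by (intro p' tm_fun1[OF tmL] def_rules refl less.prems)
  then have TV: "?T \<in> V" by (rule tm_V)
  have eT: "elts ?T = {x} \<union> (\<Union>y\<in>elts (p x). elts (L y))"
    by (subst elts_vset_small) (auto intro!: small_insert small_Union)
  have px: "p x \<in> V" using tm_closed1[OF p] less.prems .
  have ex: "\<exists>T\<in>V. cl T y" if "y \<in> elts (p x)" for y
    using less.IH[of y] that less.prems V_elts[OF px] unfolding cl_def by blast
  have Lcl: "cl (L y) y" if y: "y \<in> elts (p x)" for y
  proof -
    obtain T where T: "T \<in> V" "cl T y" using ex[OF y] by blast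
    note L = L(2)[OF T V_elts[OF px y]]
    have "elts (p z) \<subseteq> elts (L y)" if "z \<in> elts (L y)" for z
    proof
      fix u assume u: "u \<in> elts (p z)"
      have "z \<in> V" using that L by blast
      then have "u \<in> V" using u V_elts tm_closed1[OF p] by blast
      moreover have "u \<in> elts T'" if "T' \<in> V" "cl T' y" for T'
        using that u L \<open>z \<in> elts (L y)\<close> unfolding cl_def by blast
      ultimately show "u \<in> elts (L y)" using L by blast
    qed
    moreover have "y \<in> elts (L y)" unfolding L using V_elts[OF px y] by (auto simp: cl_def)
    ultimately show ?thesis unfolding cl_def by blast
  qed
  have "elts (p y) \<subseteq> elts ?T" if "y \<in> elts ?T" for y
    using that Lcl unfolding eT cl_def by blast
  then show ?case using TV eT by blast
qed

text \<open>
  An attempt is an element of \<open>V\<close> that satisfies the recursion equation on a set closed under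
  predecessors.  By induction it agrees with \<open>F\<close> there, so \<open>F x = z\<close> is expressed by the formula
  that some attempt maps \<open>x\<close> to \<open>z\<close>, provided that every \<open>x\<close> is covered by an attempt.  This is
  proved by induction too: if all predecessors of \<open>x\<close> are covered, then \<open>F\<close> is definable on the
  covered part of a closed set around \<open>x\<close>, and replacement turns it into an attempt that can be
  extended to \<open>x\<close>.
\<close>

theorem definable_recursion:
  assumes p: "dfun p" and wf: "wf {(y, x). x \<in> V \<and> y \<in> elts (p x)}"
    and G: "tm (\<lambda>e. G (e (Suc 0)) (e 0))"
    and F: "\<And>x. x \<in> V \<Longrightarrow> vset ((\<lambda>y. vpair y (F y)) ` elts (p x)) \<in> V \<Longrightarrow>
      F x = G x (vset ((\<lambda>y. vpair y (F y)) ` elts (p x)))"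
  shows "dfun F"
proof -
  note p' = tm_fun1[OF p] and G' = tm_fun2[OF G]
  define restr where "restr g s = vset {q \<in> elts g. \<exists>u\<in>elts s. \<exists>w\<in>V. q = vpair u w}" for g s
  have restr: "tm (\<lambda>e. restr (t e) (s e))" if "tm t" "tm s" for t s
    using tm_fun2[where F = restr, OF _ that] unfolding restr_def by (simp add: def_rules)
  define att where "att g T y \<longleftrightarrow> y \<in> elts T \<and> (\<forall>y\<in>elts T. elts (p y) \<subseteq> elts T \<and>
    (\<forall>w\<in>V. vpair y w \<in> elts g \<longleftrightarrow> w = G y (restr g (p y))))" for g T y
  have att: "def (\<lambda>e. att (t e) (s e) (r e))" if "tm t" "tm s" "tm r" for t s r
    by (rule dfn_subst3[where P = att and Q = att, OF _ that], unfold att_def) (intro p' G' restr def_rules)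
  have pV: "p x \<in> V" if "x \<in> V" for x using tm_closed1[OF p that] .
  have FV: "F x \<in> V \<and> vset ((\<lambda>y. vpair y (F y)) ` elts (p x)) \<in> V \<and>
      (\<forall>w\<in>V. vpair x w \<in> elts g \<longleftrightarrow> w = F x)"
    if "att g T x" "g \<in> V" "T \<in> V" for g T x
  proof -
    have "x \<in> V" using that V_elts unfolding att_def by blast
    with wf show ?thesis using that(1)
    proof (induction x rule: wf_induct_rule)
      case (less x)
      have sub: "elts (p x) \<subseteq> elts T" using less.prems(2) unfolding att_def by blast
      then have IH: "F y \<in> V" "\<And>w. w \<in> V \<Longrightarrow> vpair y w \<in> elts g \<longleftrightarrow> w = F y" if "y \<in> elts (p x)" for y
        using less.IH[of y] that less.prems V_elts[OF pV] unfolding att_def by blast+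
      have "{q \<in> elts g. \<exists>u\<in>elts (p x). \<exists>w\<in>V. q = vpair u w} = (\<lambda>y. vpair y (F y)) ` elts (p x)"
        using IH by blast
      then have eq: "restr g (p x) = vset ((\<lambda>y. vpair y (F y)) ` elts (p x))"
        unfolding restr_def by simp
      have "tm (\<lambda>_. restr g (p x))" by (intro restr p' def_rules that less.prems refl)
      then have rV: "restr g (p x) \<in> V" by (rule tm_V)
      have "tm (\<lambda>_. G x (restr g (p x)))" by (intro G' restr p' def_rules that less.prems refl)
      moreover have "G x (restr g (p x)) = F x" using F[OF less.prems(1)] rV eq by simp
      ultimately show ?case
        using tm_V rV less.prems(2) eq unfolding att_def by metis
    qed
  qed
  define has where "has y \<longleftrightarrow> (\<exists>g\<in>V. \<exists>T\<in>V. att g T y)" for y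
  have has: "def (\<lambda>e. has (t e))" if "tm t" for t
    by (rule dfn_subst1[where P = has and Q = has, OF _ that], unfold has_def) (intro att def_rules)
  define F1 where "F1 y = (if has y then F y else y)" for y
  have F1_iff: "z = F1 y \<longleftrightarrow> has y \<and> (\<exists>g\<in>V. \<exists>T\<in>V. att g T y \<and> vpair y z \<in> elts g) \<or> \<not> has y \<and> z = y"
    if "z \<in> V" for z y
    using FV that unfolding F1_def has_def by (auto; blast)
  have F1_def': "def (\<lambda>e. has (e (Suc 0)) \<and> (\<exists>g\<in>V. \<exists>T\<in>V. att g T (e (Suc 0)) \<and> vpair (e (Suc 0)) (e 0) \<in> elts g)
      \<or> \<not> has (e (Suc 0)) \<and> e 0 = e (Suc 0))"
    by (intro has att def_rules)
  have "def (\<lambda>e. e 0 = F1 (e (Suc 0)))"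
    by (rule dfn_cong[OF F1_def']; rule F1_iff; rule envsD)
  moreover have "F1 y \<in> V" if "y \<in> V" for y
    using that FV unfolding F1_def has_def by auto
  ultimately have tmF1: "dfun F1" by (intro tm_of_def)
  have all: "has x" if "x \<in> V" for x
    using wf that
  proof (induction x rule: wf_induct_rule)
    case (less x)
    have IH: "has y" if "y \<in> elts (p x)" for y
      using less that V_elts[OF pV] by blast
    obtain T0 where T0: "T0 \<in> V" "x \<in> elts T0" "\<And>y. y \<in> elts T0 \<Longrightarrow> elts (p y) \<subseteq> elts T0"
      using pred_closure[OF p wf less.prems] by blast
    define T where "T = vset {y \<in> elts T0. has y \<or> y = x}"
    define g where "g = vset ((\<lambda>y. vpair y (if y = x then F x else F1 y)) ` elts T)"
    have "tm (\<lambda>_. vset ((\<lambda>y. vpair y (F1 y)) ` elts (p x)))"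
      by (intro p' tm_fun1[OF tmF1] def_rules less.prems refl)
    then have "vset ((\<lambda>y. vpair y (F1 y)) ` elts (p x)) \<in> V" by (rule tm_V)
    then have "F x = G x (vset ((\<lambda>y. vpair y (F1 y)) ` elts (p x)))"
      using F[OF less.prems] IH by (simp add: F1_def cong: image_cong_simp)
    moreover have "tm (\<lambda>_. G x (vset ((\<lambda>y. vpair y (F1 y)) ` elts (p x))))"
      by (intro G' p' tm_fun1[OF tmF1] def_rules less.prems refl)
    ultimately have Fx: "F x \<in> V" using tm_V by simp
    have "tm (\<lambda>_. T)"
      unfolding T_def by (intro has def_rules T0 less.prems refl)
    then have TV: "T \<in> V" by (rule tm_V)
    have "tm (\<lambda>_. g)"
      unfolding g_def by (intro tm_fun1[OF tmF1] def_rules TV Fx less.prems refl)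
    then have gV: "g \<in> V" by (rule tm_V)
    have eT: "elts T = {y \<in> elts T0. has y \<or> y = x}" by (simp add: T_def)
    then have geq: "g = vset ((\<lambda>y. vpair y (F y)) ` elts T)"
      unfolding g_def F1_def by (intro arg_cong[where f = vset] image_cong) auto
    have has_pred: "has z" if "has y" "z \<in> elts (p y)" for y z
      using that unfolding has_def att_def by blast
    have closed: "elts (p y) \<subseteq> elts T" if "y \<in> elts T" for y
      using that T0(3) has_pred IH unfolding eT by blast
    have "vpair y w \<in> elts g \<longleftrightarrow> w = G y (restr g (p y))" if y: "y \<in> elts T" for y w
    proof -
      have "y \<in> V" using V_elts TV y by blast
      have FVy: "F z \<in> V" if "z \<in> elts T" for z
        using that Fx FV unfolding eT has_def by blast
      have "{q \<in> elts g. \<exists>u\<in>elts (p y). \<exists>w\<in>V. q = vpair u w} = (\<lambda>y. vpair y (F y)) ` elts (p y)"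
        using closed[OF y] FVy unfolding geq by (auto 0 3)
      then have eq: "restr g (p y) = vset ((\<lambda>y. vpair y (F y)) ` elts (p y))"
        unfolding restr_def by simp
      have "tm (\<lambda>_. restr g (p y))" by (intro restr p' def_rules gV \<open>y \<in> V\<close> refl)
      then have "G y (restr g (p y)) = F y"
        using F[OF \<open>y \<in> V\<close>] tm_V eq by simp
      then show ?thesis using y unfolding geq by auto
    qed
    then have "att g T x"
      using closed T0(2) unfolding att_def eT by blast
    then show ?case using gV TV unfolding has_def by blast
  qed
  have "def (\<lambda>e. e 0 = F (e (Suc 0)))"
    by (rule dfn_cong[OF tm_fun1_def[OF tmF1]]) (simp_all add: F1_def all)
  moreover have "F x \<in> V" if "x \<in> V" for x
    using FV all[OF that] unfolding has_def by blast
  ultimately show ?thesis by (intro tm_of_def)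
qed

lemma vpair_V [simp]: "vpair x y \<in> V \<longleftrightarrow> x \<in> V \<and> y \<in> V"
proof
  assume "vpair x y \<in> V"
  then have "vset {x, y} \<in> V" using V_elts by (auto simp: elts_vpair)
  then show "x \<in> V \<and> y \<in> V" using V_elts by force
next
  assume xy: "x \<in> V \<and> y \<in> V"
  have "tm (\<lambda>_. vpair x y)" by (intro def_rules refl) (use xy in auto)
  then show "vpair x y \<in> V" by (rule tm_V)
qed

end

text \<open>Projections with an explicit value on sets that are not pairs, so that they are definable.\<close>

definition vfst0 :: "'a::set_universe \<Rightarrow> 'a" where
  "vfst0 z = (if \<exists>x y. z = vpair x y then vfst z else z)"

definition vsnd0 :: "'a::set_universe \<Rightarrow> 'a" where
  "vsnd0 z = (if \<exists>x y. z = vpair x y then vsnd z else z)"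

lemma vfst0_vpair [simp]: "vfst0 (vpair x y) = x" and vsnd0_vpair [simp]: "vsnd0 (vpair x y) = y"
  unfolding vfst0_def vsnd0_def by auto

context zf_class
begin

lemma tm_vfst0_aux: "dfun vfst0"
proof (rule tm_of_def)
  show "vfst0 x \<in> V" if "x \<in> V" for x using that by (auto simp: vfst0_def)
  have 1: "def (\<lambda>e. (\<exists>y\<in>V. e (Suc 0) = vpair (e 0) y) \<or> \<not> (\<exists>x\<in>V. \<exists>y\<in>V. e (Suc 0) = vpair x y) \<and> e 0 = e (Suc 0))"
    by (intro def_rules)
  have 2: "z = vfst0 u \<longleftrightarrow> (\<exists>y\<in>V. u = vpair z y) \<or> \<not> (\<exists>x\<in>V. \<exists>y\<in>V. u = vpair x y) \<and> z = u"
    if "u \<in> V" for u z using that by (auto simp: vfst0_def)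
  show "def (\<lambda>e. e 0 = vfst0 (e (Suc 0)))"
    by (rule dfn_cong[OF 1]; rule 2; rule envsD)
qed

lemma tm_vsnd0_aux: "dfun vsnd0"
proof (rule tm_of_def)
  show "vsnd0 x \<in> V" if "x \<in> V" for x using that by (auto simp: vsnd0_def)
  have 1: "def (\<lambda>e. (\<exists>x\<in>V. e (Suc 0) = vpair x (e 0)) \<or> \<not> (\<exists>x\<in>V. \<exists>y\<in>V. e (Suc 0) = vpair x y) \<and> e 0 = e (Suc 0))"
    by (intro def_rules)
  have 2: "z = vsnd0 u \<longleftrightarrow> (\<exists>x\<in>V. u = vpair x z) \<or> \<not> (\<exists>x\<in>V. \<exists>y\<in>V. u = vpair x y) \<and> z = u"
    if "u \<in> V" for u z using that by (auto simp: vsnd0_def)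
  show "def (\<lambda>e. e 0 = vsnd0 (e (Suc 0)))"
    by (rule dfn_cong[OF 1]; rule 2; rule envsD)
qed

lemmas tm_vfst0 = tm_fun1[OF tm_vfst0_aux]
lemmas tm_vsnd0 = tm_fun1[OF tm_vsnd0_aux]

end


section \<open>Ordinals\<close>

definition ord :: "'a::set_universe \<Rightarrow> bool" where
  "ord x \<longleftrightarrow> (\<forall>y\<in>elts x. elts y \<subseteq> elts x \<and> (\<forall>z\<in>elts y. elts z \<subseteq> elts y))"

lemma ord_elts: "ord x \<Longrightarrow> y \<in> elts x \<Longrightarrow> ord y"
  unfolding ord_def by blast

lemma ord_trans: "ord x \<Longrightarrow> y \<in> elts x \<Longrightarrow> z \<in> elts y \<Longrightarrow> z \<in> elts x"
  unfolding ord_def by blast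

lemma ord_linear: "ord x \<Longrightarrow> ord y \<Longrightarrow> x \<in> elts y \<or> x = y \<or> y \<in> elts x"
proof (induction x arbitrary: y rule: elts_induct)
  case (step x)
  note outer = step.IH step.prems(1)
  from step.prems(2) show ?case
  proof (induction y rule: elts_induct)
    case (step y)
    show ?case
    proof (rule ccontr)
      assume *: "\<not> ?thesis"
      have "u \<in> elts y" if "u \<in> elts x" for u
        using outer(1)[OF that ord_elts[OF outer(2) that] step.prems] * that ord_trans[OF outer(2) that] by blast
      moreover have "v \<in> elts x" if "v \<in> elts y" for v
        using step.IH[OF that ord_elts[OF step.prems that]] * that ord_trans[OF step.prems that] by blast
      ultimately show False using * extensionality by blast
    qed
  qed
qed

lemma elts_vrank: "elts (vrank x) = (\<Union>y\<in>elts x. insert (vrank y) (elts (vrank y)))"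
  by (subst vrank.simps) (intro elts_vset_small small_Union small_elts small_insert)

lemma ord_vrank: "ord (vrank x)"
proof (induction x rule: elts_induct)
  case (step x)
  show ?case
    unfolding ord_def
  proof
    fix u assume "u \<in> elts (vrank x)"
    then obtain y where y: "y \<in> elts x" "u = vrank y \<or> u \<in> elts (vrank y)" by (auto simp: elts_vrank[of x])
    then have "ord u" using step ord_elts by blast
    moreover have "elts u \<subseteq> elts (vrank x)"
      using y ord_trans[OF step[OF y(1)]] by (auto simp: elts_vrank[of x])
    ultimately show "elts u \<subseteq> elts (vrank x) \<and> (\<forall>z\<in>elts u. elts z \<subseteq> elts u)"
      unfolding ord_def by blast
  qed
qed

text \<open>
  Scott's trick: ranks are ordinals, hence linearly ordered, so a nonempty class has members of
  least rank.
\<close>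

lemma ex_min_vrank:
  assumes "P x"
  shows "\<exists>y. P y \<and> (\<forall>z. P z \<longrightarrow> elts (vrank y) \<subseteq> elts (vrank z))"
proof -
  have "wf (inv_image {(y, x). y \<in> elts x} vrank)" by (intro wf_inv_image foundation)
  then obtain y where "P y" "\<And>z. vrank z \<in> elts (vrank y) \<Longrightarrow> \<not> P z"
    using assms wfE_min[of _ x "Collect P"] by (metis (no_types, lifting) case_prodI in_inv_image mem_Collect_eq)
  then show ?thesis
    using ord_linear[OF ord_vrank ord_vrank] ord_trans[OF ord_vrank] by (metis subsetI)
qed

section \<open>Collection and choice in the ground model\<close>

text \<open>For an ordinal \<open>x\<close> this is the level \<open>V\<^sub>x\<close>; in general it is the level indexed by the rank of \<open>x\<close>.\<close>

function (in zf_class) cum :: "'a \<Rightarrow> 'a" where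
  "cum x = vset (\<Union>y\<in>elts x. elts (vpow (cum y)))"
  by pat_completeness auto
termination (in zf_class)
  by (relation "{(y, x). y \<in> elts x}") (simp_all add: foundation)

text \<open>
  Total by recursion on all sets; only its values on ordinals matter.  It lists the elements of
  \<open>A\<close> one after the other, as long as there are new ones to choose.
\<close>

function enum :: "('a::set_universe \<Rightarrow> 'a) \<Rightarrow> 'a \<Rightarrow> 'a \<Rightarrow> 'a" where
  "enum c A x = c (vset {w \<in> elts A. w \<notin> enum c A ` elts x})"
  by pat_completeness auto
termination
  by (relation "inv_image {(y, x). y \<in> elts x} (snd \<circ> snd)") (simp_all add: foundation)

context zf_class
begin

declare cum.simps [simp del] enum.simps [simp del]

lemma wf_elts_V: "wf {(y, x). x \<in> V \<and> y \<in> elts x}"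
  by (rule wf_subset[OF foundation]) auto

lemma tm_cum_aux: "dfun cum"
proof (rule definable_recursion[where p = "\<lambda>x. x" and G = "\<lambda>x g. vset (\<Union>q\<in>elts g. elts (vpow (vsnd0 q)))"])
  show "tm (\<lambda>e. vset (\<Union>q\<in>elts (e 0). elts (vpow (vsnd0 q))))" by (intro tm_vsnd0 def_rules)
  show "cum x = vset (\<Union>q\<in>elts (vset ((\<lambda>y. vpair y (cum y)) ` elts x)). elts (vpow (vsnd0 q)))" for x
    by (subst cum.simps) simp
qed (rule trm_var wf_elts_V)+

lemmas tm_cum = tm_fun1[OF tm_cum_aux]

lemma cum_V: "x \<in> V \<Longrightarrow> cum x \<in> V"
  using tm_closed1[OF tm_cum_aux] .

lemma elts_cum: "x \<in> V \<Longrightarrow> elts (cum x) = (\<Union>y\<in>elts x. {w \<in> V. elts w \<subseteq> elts (cum y)})"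
proof -
  assume x: "x \<in> V"
  have "elts (cum x) = (\<Union>y\<in>elts x. elts (vpow (cum y)))" by (subst cum.simps) (rule elts_UN)
  then show ?thesis using vpow(2)[OF cum_V[OF V_elts[OF x]]] by simp
qed

text \<open>
  This replaces the rank function inside \<open>V\<close>: comparing ranks in the ambient universe suffices to
  bound a set by a level of the hierarchy of \<open>V\<close>.
\<close>

lemma subset_cum:
  assumes "x \<in> V" "y \<in> V" "elts (vrank x) \<subseteq> elts (vrank y)"
  shows "elts x \<subseteq> elts (cum y)"
  using assms
proof (induction x arbitrary: y rule: elts_induct)
  case (step x)
  show ?case
  proof
    fix u assume u: "u \<in> elts x"
    then have "vrank u \<in> elts (vrank x)" by (auto simp: elts_vrank[of x])
    then have "vrank u \<in> elts (vrank y)" using step.prems by blast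
    then obtain w where w: "w \<in> elts y" "vrank u = vrank w \<or> vrank u \<in> elts (vrank w)"
      by (auto simp: elts_vrank[of y])
    then have "elts (vrank u) \<subseteq> elts (vrank w)" using ord_trans[OF ord_vrank] by auto
    then have "elts u \<subseteq> elts (cum w)"
      using step.IH[OF u V_elts[OF step.prems(1) u] V_elts[OF step.prems(2) w(1)]] by blast
    then show "u \<in> elts (cum y)"
      using w(1) V_elts[OF step.prems(1) u] by (auto simp: elts_cum[OF step.prems(2)])
  qed
qed

text \<open>
  The witnesses of least rank for \<open>x\<close> form a set (all of them are subsets of one level), so the
  choice axiom applies to the family of these sets.
\<close>

theorem definable_choice:
  assumes Q: "def (\<lambda>e. Q (e (Suc 0)) (e 0))" and X: "X \<in> V"
    and ex: "\<forall>x\<in>elts X. \<exists>y\<in>V. Q x y"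
  shows "\<exists>g. dfun g \<and> (\<forall>x\<in>elts X. Q x (g x))"
proof -
  note Q' = dfn_subst2[where P = Q and Q = Q, OF Q]
  define S where "S x = {y \<in> V. Q x y \<and> (\<forall>y'\<in>V. Q x y' \<longrightarrow> elts y \<subseteq> elts (cum y'))}" for x
  have S_V: "vset (S x) \<in> V \<and> small (S x)" if "x \<in> V" for x
  proof (cases "\<exists>y\<in>V. Q x y")
    case True
    then obtain y where y: "y \<in> V" "Q x y" by blast
    have "tm (\<lambda>_. vset {z \<in> elts (vpow (cum y)). Q x z \<and> (\<forall>y'\<in>V. Q x y' \<longrightarrow> elts z \<subseteq> elts (cum y'))})"
      by (intro Q' tm_cum def_rules that y refl)
    then have "vset {z \<in> elts (vpow (cum y)). Q x z \<and> (\<forall>y'\<in>V. Q x y' \<longrightarrow> elts z \<subseteq> elts (cum y'))} \<in> V"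
      by (rule tm_V)
    moreover have "{z \<in> elts (vpow (cum y)). Q x z \<and> (\<forall>y'\<in>V. Q x y' \<longrightarrow> elts z \<subseteq> elts (cum y'))} = S x"
      using y unfolding S_def vpow(2)[OF cum_V[OF y(1)]] by blast
    ultimately show ?thesis using small_subset[OF _ small_elts] by (metis (no_types, lifting) mem_Collect_eq subsetI)
  next
    case False
    then have "S x = {}" unfolding S_def by blast
    then show ?thesis using V_empty by simp
  qed
  have tmS: "tm (\<lambda>e. vset (S (e 0)))"
  proof (rule tm_vset)
    show "def (\<lambda>e. e 0 \<in> S (e (Suc 0)))"
    proof (rule dfn_cong)
      show "def (\<lambda>e. Q (e (Suc 0)) (e 0) \<and> (\<forall>y'\<in>V. Q (e (Suc 0)) y' \<longrightarrow> elts (e 0) \<subseteq> elts (cum y')))"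
        by (intro Q' tm_cum def_rules)
    qed (simp_all add: S_def)
  qed (use S_V in auto)
  note tmS' = tm_fun1[where F = "\<lambda>x. vset (S x)", OF tmS]
  have S_elts: "elts (vset (S x)) = S x" if "x \<in> V" for x
    using S_V[OF that] by (simp add: elts_vset_small)
  have S_ne: "S x \<noteq> {}" if x: "x \<in> elts X" for x
  proof -
    obtain y where y: "y \<in> V \<and> Q x y" "\<And>z. z \<in> V \<and> Q x z \<Longrightarrow> elts (vrank y) \<subseteq> elts (vrank z)"
      using ex_min_vrank[of "\<lambda>y. y \<in> V \<and> Q x y"] ex x by blast
    then have "y \<in> S x" unfolding S_def using subset_cum by blast
    then show ?thesis by blast
  qed
  define W where "W x = vset ((\<lambda>y. vpair x y) ` elts (vset (S x)))" for x
  have W_elts: "elts (W x) = vpair x ` S x" if "x \<in> V" for x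
    using elts_image[of "vpair x" "vset (S x)"] by (simp only: W_def S_elts[OF that])
  have "tm (\<lambda>_. vset (W ` elts X))"
    unfolding W_def by (intro tmS' def_rules X refl)
  then have FV: "vset (W ` elts X) \<in> V" by (rule tm_V)
  note XV = V_elts[OF X]
  have "\<forall>y\<in>V. y \<in> elts (vset (W ` elts X)) \<longrightarrow> (\<exists>u\<in>V. u \<in> elts y)"
  proof (intro ballI impI)
    fix y assume y: "y \<in> V" "y \<in> elts (vset (W ` elts X))"
    then obtain x where x: "x \<in> elts X" "y = W x" by auto
    then obtain z where "z \<in> S x" using S_ne by blast
    then have "vpair x z \<in> elts y" using x W_elts[OF XV] by simp
    then show "\<exists>u\<in>V. u \<in> elts y" using V_elts[OF y(1)] by blast
  qed
  moreover have "\<forall>y\<in>V. \<forall>z\<in>V. y \<in> elts (vset (W ` elts X)) \<and> z \<in> elts (vset (W ` elts X)) \<and> y \<noteq> z \<longrightarrow>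
        (\<forall>u\<in>V. \<not> (u \<in> elts y \<and> u \<in> elts z))"
    using W_elts XV by auto
  ultimately obtain c where c: "c \<in> V"
    "\<forall>y\<in>V. y \<in> elts (vset (W ` elts X)) \<longrightarrow> (\<exists>!u. u \<in> V \<and> u \<in> elts y \<and> u \<in> elts c)"
    using bspec[OF zfc_model_choice[OF zfc] FV] by blast
  define g where "g x = vset (\<Union>u\<in>elts (vset {y \<in> elts (vset (S x)). vpair x y \<in> elts c}). elts u)" for x
  have "dfun g"
    unfolding g_def by (intro tmS' def_rules c refl)
  moreover have "Q x (g x)" if x: "x \<in> elts X" for x
  proof -
    have "W x \<in> V" using V_elts[OF FV] x by auto
    then have "\<exists>!u. u \<in> V \<and> u \<in> elts (W x) \<and> u \<in> elts c" using c(2) x by auto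
    then obtain u where u: "u \<in> elts (W x) \<and> u \<in> elts c" "\<And>v. v \<in> elts (W x) \<Longrightarrow> v \<in> elts c \<Longrightarrow> v = u"
      using V_elts[OF \<open>W x \<in> V\<close>] by blast
    then obtain y where y: "y \<in> S x" "u = vpair x y" using W_elts[OF XV[OF x]] by auto
    have "{y \<in> elts (vset (S x)). vpair x y \<in> elts c} = {y}"
      unfolding S_elts[OF XV[OF x]]
    proof (intro equalityI subsetI)
      fix z assume "z \<in> {y \<in> S x. vpair x y \<in> elts c}"
      then show "z \<in> {y}" using u(2)[of "vpair x z"] y(2) W_elts[OF XV[OF x]] by simp
    qed (use u(1) y in simp)
    then have "g x = y" unfolding g_def by simp
    then show ?thesis using y(1) unfolding S_def by blast
  qed
  ultimately show ?thesis by (intro exI[of _ g] conjI ballI)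
qed

lemma def_ord: assumes "tm t" shows "def (\<lambda>e. ord (t e))"
  by (rule dfn_subst1[where P = ord and Q = ord, OF _ assms]) (unfold ord_def, intro def_rules)

text \<open>
  Burali-Forti: if all ordinals of \<open>V\<close> belonged to \<open>X\<close>, then they would form an ordinal that is an
  element of itself.
\<close>

lemma ord_unbounded:
  assumes "X \<in> V"
  obtains \<alpha> where "\<alpha> \<in> V" "ord \<alpha>" "\<alpha> \<notin> elts X"
proof -
  let ?o = "vset {x \<in> elts X. ord x}"
  have "tm (\<lambda>_. ?o)" by (intro def_ord def_rules assms refl)
  then have V: "?o \<in> V" by (rule tm_V)
  show ?thesis
  proof (rule ccontr)
    assume "\<not> thesis"
    then have *: "x \<in> elts ?o \<longleftrightarrow> x \<in> V \<and> ord x" for x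
      using that V_elts[OF assms] by auto
    then have "ord ?o"
      unfolding ord_def[of ?o] using V_elts ord_elts ord_trans by (meson subsetI)
    then show False using * V elts_irrefl by blast
  qed
qed

text \<open>
  Zermelo's argument.  As long as \<open>enum\<close> has not exhausted \<open>A\<close>, it takes new values.  If it never
  did exhaust \<open>A\<close>, it would be injective on the ordinals of \<open>V\<close>, and replacement for its inverse
  would put all of them into one set.
\<close>

theorem enumeration:
  assumes A: "A \<in> V"
  obtains f \<alpha> where "dfun f" "\<alpha> \<in> V" "ord \<alpha>" "elts A \<subseteq> f ` elts \<alpha>"
proof -
  have "def (\<lambda>e. e 0 \<in> elts (e (Suc 0)) \<or> (\<forall>y\<in>elts (e (Suc 0)). \<not> y = y))" by (intro def_rules)
  then have "\<exists>c. dfun c \<and> (\<forall>Z\<in>elts (vpow A). c Z \<in> elts Z \<or> (\<forall>y\<in>elts Z. \<not> y = y))"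
  proof (rule definable_choice[where Q = "\<lambda>Z y. y \<in> elts Z \<or> (\<forall>y\<in>elts Z. \<not> y = y)"])
    show "vpow A \<in> V" by (rule vpow(1)[OF A])
    show "\<forall>Z\<in>elts (vpow A). \<exists>y\<in>V. y \<in> elts Z \<or> (\<forall>y\<in>elts Z. \<not> y = y)"
      using V_elts[OF V_elts[OF vpow(1)[OF A]]] V_nonempty by blast
  qed
  then obtain c where c: "dfun c"
    "\<And>Z. Z \<in> elts (vpow A) \<Longrightarrow> c Z \<in> elts Z \<or> (\<forall>y\<in>elts Z. \<not> y = y)"
    by (elim exE conjE) (rule that, assumption, elim ballE; blast)
  define f where "f = enum c A"
  have f: "f x = c (vset {w \<in> elts A. w \<notin> f ` elts x})" for x
    unfolding f_def by (rule enum.simps)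
  have tmf: "dfun f"
  proof (rule definable_recursion[where p = "\<lambda>x. x"
        and G = "\<lambda>x g. c (vset {w \<in> elts A. \<not> (\<exists>q\<in>elts g. vsnd0 q = w)})"])
    show "tm (\<lambda>e. c (vset {w \<in> elts A. \<not> (\<exists>q\<in>elts (e 0). vsnd0 q = w)}))"
      by (intro tm_fun1[OF c(1)] tm_vsnd0 def_rules A refl)
    show "f x = c (vset {w \<in> elts A. \<not> (\<exists>q\<in>elts (vset ((\<lambda>y. vpair y (f y)) ` elts x)). vsnd0 q = w)})" for x
      by (subst f) (rule arg_cong[where f = "\<lambda>S. c (vset S)"], auto)
  qed (rule trm_var wf_elts_V)+
  have "\<exists>\<alpha>\<in>V. ord \<alpha> \<and> elts A \<subseteq> f ` elts \<alpha>"
  proof (rule ccontr)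
    assume neg: "\<not> ?thesis"
    have new: "f x \<in> elts A" "f x \<notin> f ` elts x" if "x \<in> V" "ord x" for x
    proof -
      let ?Z = "vset {w \<in> elts A. w \<notin> f ` elts x}"
      have "tm (\<lambda>_. vset {w \<in> elts A. \<not> (\<exists>y\<in>elts x. w = f y)})"
        by (intro tm_fun1[OF tmf] def_rules A that refl)
      then have "vset {w \<in> elts A. \<not> (\<exists>y\<in>elts x. w = f y)} \<in> V" by (rule tm_V)
      then have "?Z \<in> V" by (simp add: image_iff)
      then have "?Z \<in> elts (vpow A)" by (auto simp: vpow(2)[OF A])
      moreover have "elts ?Z \<noteq> {}" using neg that by auto
      ultimately have "f x \<in> elts ?Z" using c(2)[of ?Z] f[of x] by auto
      then show "f x \<in> elts A" "f x \<notin> f ` elts x" by auto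
    qed
    have inj: "x = y" if "x \<in> V" "ord x" "y \<in> V" "ord y" "f x = f y" for x y
      using ord_linear[OF that(2,4)] new[OF that(1,2)] new[OF that(3,4)] that(5) by (metis imageI)
    define h where "h u = (if \<exists>x\<in>V. ord x \<and> f x = u then THE x. x \<in> V \<and> ord x \<and> f x = u else u)" for u
    have h: "h (f x) = x" if "x \<in> V" "ord x" for x
    proof -
      have "(THE y. y \<in> V \<and> ord y \<and> f y = f x) = x" by (rule the_equality) (use that inj in blast)+
      then show ?thesis unfolding h_def using that by auto
    qed
    have 1: "def (\<lambda>e. (ord (e 0) \<and> f (e 0) = e (Suc 0)) \<or> (\<not> (\<exists>x\<in>V. ord x \<and> f x = e (Suc 0)) \<and> e 0 = e (Suc 0)))"
      by (intro def_ord tm_fun1[OF tmf] def_rules)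
    have 2: "z = h u \<longleftrightarrow> (ord z \<and> f z = u) \<or> (\<not> (\<exists>x\<in>V. ord x \<and> f x = u) \<and> z = u)" if "z \<in> V" for z u
    proof (cases "\<exists>x\<in>V. ord x \<and> f x = u")
      case True
      then obtain x where x: "x \<in> V" "ord x" "f x = u" by blast
      have "h u = x" using h[OF x(1,2)] x(3) by simp
      moreover have "z = x \<longleftrightarrow> ord z \<and> f z = u" using inj[OF x(1,2) that] x by blast
      ultimately show ?thesis using True by simp
    qed (use that in \<open>auto simp: h_def\<close>)
    have "def (\<lambda>e. e 0 = h (e (Suc 0)))"
      by (rule dfn_cong[OF 1]; rule 2; rule envsD)
    moreover have "h u \<in> V" if "u \<in> V" for u
    proof (cases "\<exists>x\<in>V. ord x \<and> f x = u")
      case True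
      then show ?thesis using h by auto
    qed (use that in \<open>auto simp: h_def\<close>)
    ultimately have tmh: "dfun h" by (intro tm_of_def)
    have "tm (\<lambda>_. vset (h ` elts A))" by (intro tm_fun1[OF tmh] def_rules A refl)
    then have "vset (h ` elts A) \<in> V" by (rule tm_V)
    then obtain \<alpha> where \<alpha>: "\<alpha> \<in> V" "ord \<alpha>" "\<alpha> \<notin> elts (vset (h ` elts A))" by (rule ord_unbounded)
    have "h (f \<alpha>) \<in> h ` elts A" using new(1)[OF \<alpha>(1,2)] by (rule imageI)
    then show False using h[OF \<alpha>(1,2)] \<alpha>(3) by simp
  qed
  then show ?thesis using that tmf by blast
qed

end

section \<open>Complete Boolean algebras in the ground model\<close>

locale boolean_model = zf_class +
  fixes B :: 'a
  assumes cba: "complete_boolean_algebra_in V B"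
begin

abbreviation "L \<equiv> bord B"
abbreviation "cr \<equiv> carrier (bord B)"
abbreviation "A \<equiv> vfst B"
abbreviation "R \<equiv> vsnd B"
abbreviation lq (infix \<open>\<preceq>\<close> 50) where "x \<preceq> y \<equiv> x \<sqsubseteq>\<^bsub>L\<^esub> y"
abbreviation mt (infixl \<open>\<cdot>\<close> 70) where "x \<cdot> y \<equiv> x \<sqinter>\<^bsub>L\<^esub> y"
abbreviation jn (infixl \<open>\<oplus>\<close> 65) where "x \<oplus> y \<equiv> x \<squnion>\<^bsub>L\<^esub> y"
abbreviation zB (\<open>\<zero>\<close>) where "\<zero> \<equiv> \<bottom>\<^bsub>L\<^esub>"
abbreviation oB (\<open>\<one>\<close>) where "\<one> \<equiv> \<top>\<^bsub>L\<^esub>"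
abbreviation "bsup S \<equiv> \<Squnion>\<^bsub>L\<^esub> S"
abbreviation "binf S \<equiv> \<Sqinter>\<^bsub>L\<^esub> S"
abbreviation "neg \<equiv> bcompl L"

lemma B_eq: "B = vpair A R"
  using cba unfolding complete_boolean_algebra_in_def by auto

lemma ARV: "A \<in> V" "R \<in> V"
  using cba B_eq vpair_V[of A R] unfolding complete_boolean_algebra_in_def by metis+

lemma cr_elts: "cr = elts A" by (simp add: bord_def)
lemma le_iff: "x \<preceq> y \<longleftrightarrow> vpair x y \<in> elts R" by (simp add: bord_def)
lemma cr_V: "x \<in> cr \<Longrightarrow> x \<in> V" using V_elts[OF ARV(1)] by (simp add: cr_elts)

sublocale BL: bounded_lattice L
  using cba unfolding complete_boolean_algebra_in_def boolean_lattice_def by blast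

lemma distrib: "x \<in> cr \<Longrightarrow> y \<in> cr \<Longrightarrow> z \<in> cr \<Longrightarrow> x \<cdot> (y \<oplus> z) = x \<cdot> y \<oplus> x \<cdot> z"
  and ex_neg: "x \<in> cr \<Longrightarrow> \<exists>y\<in>cr. x \<cdot> y = \<zero> \<and> x \<oplus> y = \<one>"
  using cba unfolding complete_boolean_algebra_in_def boolean_lattice_def by blast+

lemma sets_V:
  assumes "X \<in> V" "elts X \<subseteq> cr"
  shows "\<exists>s. least L s (Upper L (elts X))" "\<exists>i. greatest L i (Lower L (elts X))"
  using cba assms unfolding complete_boolean_algebra_in_def by blast+

lemma le_refl: "x \<in> cr \<Longrightarrow> x \<preceq> x" by simp
lemma le_antisym: "x \<preceq> y \<Longrightarrow> y \<preceq> x \<Longrightarrow> x \<in> cr \<Longrightarrow> y \<in> cr \<Longrightarrow> x = y"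
  by (rule BL.le_antisym)
lemma le_tr: "x \<preceq> y \<Longrightarrow> y \<preceq> z \<Longrightarrow> x \<in> cr \<Longrightarrow> y \<in> cr \<Longrightarrow> z \<in> cr \<Longrightarrow> x \<preceq> z"
  by (rule BL.le_trans)

text \<open>
  Bounds of \<open>S\<close> are bounds of \<open>S \<inter> cr\<close>.  Hence joins and meets exist, and are definable, as soon as
  this part of \<open>S\<close> is an element of \<open>V\<close>; with this convention the lattice operations are total.
\<close>

definition inV :: "'a set \<Rightarrow> bool" where
  "inV S \<longleftrightarrow> vset (S \<inter> cr) \<in> V"

lemma inV_elts: "elts (vset (S \<inter> cr)) = S \<inter> cr"
  by (intro elts_vset_small small_subset[of "S \<inter> cr" cr]) (auto simp: cr_elts)

lemma Upper_Int: "Upper L (S \<inter> cr) = Upper L S" and Lower_Int: "Lower L (S \<inter> cr) = Lower L S"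
  unfolding Upper_def Lower_def by blast+

lemma bsup_least_Upper: "inV S \<Longrightarrow> least L (bsup S) (Upper L S)"
  unfolding inV_def sup_def using sets_V(1)[of "vset (S \<inter> cr)"] inV_elts[of S] Upper_Int[of S]
  by (metis inf_le2 someI_ex)

lemma binf_greatest_Lower: "inV S \<Longrightarrow> greatest L (binf S) (Lower L S)"
  unfolding inV_def inf_def using sets_V(2)[of "vset (S \<inter> cr)"] inV_elts[of S] Lower_Int[of S]
  by (metis inf_le2 someI_ex)

lemma bsup_closed: "inV S \<Longrightarrow> bsup S \<in> cr"
  by (rule least_closed[OF bsup_least_Upper])

lemma bsup_upper: "inV S \<Longrightarrow> s \<in> S \<Longrightarrow> s \<in> cr \<Longrightarrow> s \<preceq> bsup S"
  using bsup_least_Upper unfolding least_def Upper_def by blast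

lemma bsup_least: "inV S \<Longrightarrow> u \<in> cr \<Longrightarrow> (\<And>s. s \<in> S \<Longrightarrow> s \<in> cr \<Longrightarrow> s \<preceq> u) \<Longrightarrow> bsup S \<preceq> u"
  using bsup_least_Upper[of S] unfolding least_def Upper_def by blast

lemma binf_closed: "inV S \<Longrightarrow> binf S \<in> cr"
  by (rule greatest_closed[OF binf_greatest_Lower])

lemma binf_lower: "inV S \<Longrightarrow> s \<in> S \<Longrightarrow> s \<in> cr \<Longrightarrow> binf S \<preceq> s"
  using binf_greatest_Lower unfolding greatest_def Lower_def by blast

lemma binf_greatest: "inV S \<Longrightarrow> u \<in> cr \<Longrightarrow> (\<And>s. s \<in> S \<Longrightarrow> s \<in> cr \<Longrightarrow> u \<preceq> s) \<Longrightarrow> u \<preceq> binf S"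
  using binf_greatest_Lower[of S] unfolding greatest_def Lower_def by blast

lemma inV_term: "tm (\<lambda>_. vset {w \<in> elts A. w \<in> S}) \<Longrightarrow> inV S"
  unfolding inV_def using tm_V by (simp add: cr_elts Int_def conj_commute)

lemma inV_of_def: assumes "def (\<lambda>e. e 0 \<in> S)" shows "inV S"
  by (rule inV_term, intro tm_Collect trm_const ARV refl) (rule assms)

lemma inV_env:
  assumes "def (\<lambda>e. e 0 \<in> S (\<lambda>n. e (Suc n)))" "e \<in> envs V"
  shows "inV (S e)"
proof -
  have "tm (\<lambda>e. vset {w \<in> elts A. w \<in> S e})"
    by (intro tm_Collect trm_const ARV refl) (rule assms(1))
  then have "vset {w \<in> elts A. w \<in> S e} \<in> V" using assms(2) by (rule trm_closed(1))
  then show ?thesis by (simp add: inV_def cr_elts Int_def conj_commute)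
qed

lemma shift2: "inj (case_nat 0 (\<lambda>n. Suc (Suc n)))"
  using inj_lift_up[OF inj_Suc] .

lemma tm_bsup:
  assumes S: "def (\<lambda>e. e 0 \<in> S (\<lambda>n. e (Suc n)))"
  shows "tm (\<lambda>e. bsup (S e))"
proof -
  from dfn_rename[OF S shift2] have S': "def (\<lambda>e. e 0 \<in> S (\<lambda>n. e (Suc (Suc n))))" by simp
  have S'': "def (\<lambda>e. e 0 \<in> S (\<lambda>n. e (Suc (Suc (Suc n)))))"
    using dfn_rename[OF S inj_lift_up[of "\<lambda>n. Suc (Suc n)"]] by (simp add: inj_def)
  have 1: "def (\<lambda>e. e 0 \<in> elts A \<and> (\<forall>s\<in>elts A. s \<in> S (\<lambda>n. e (Suc n)) \<longrightarrow> vpair s (e 0) \<in> elts R) \<and>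
      (\<forall>u\<in>elts A. (\<forall>s\<in>elts A. s \<in> S (\<lambda>n. e (Suc n)) \<longrightarrow> vpair s u \<in> elts R) \<longrightarrow> vpair (e 0) u \<in> elts R))"
    by (intro def_rules S' S'' ARV refl)
  have "e 0 = bsup (S (\<lambda>n. e (Suc n))) \<longleftrightarrow> e 0 \<in> cr \<and> (\<forall>s\<in>cr. s \<in> S (\<lambda>n. e (Suc n)) \<longrightarrow> s \<preceq> e 0) \<and>
      (\<forall>u\<in>cr. (\<forall>s\<in>cr. s \<in> S (\<lambda>n. e (Suc n)) \<longrightarrow> s \<preceq> u) \<longrightarrow> e 0 \<preceq> u)" (is "?l \<longleftrightarrow> ?r")
    if "e \<in> envs V" for e
  proof -
    have i: "inV (S (\<lambda>n. e (Suc n)))" using inV_env[OF S] that by simp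
    show ?thesis
    proof
      assume ?l then show ?r using bsup_closed[OF i] bsup_upper[OF i] bsup_least[OF i] by simp
    next
      assume ?r then show ?l
        using bsup_closed[OF i] bsup_upper[OF i] bsup_least[OF i] by (intro le_antisym) simp_all
    qed
  qed
  then have "def (\<lambda>e. e 0 = bsup (S (\<lambda>n. e (Suc n))))"
    by (intro dfn_cong[OF 1]; unfold le_iff[symmetric] cr_elts[symmetric])
  then show ?thesis
    unfolding trm_def using bsup_closed[OF inV_env[OF S]] cr_V by simp
qed

lemma tm_binf:
  assumes S: "def (\<lambda>e. e 0 \<in> S (\<lambda>n. e (Suc n)))"
  shows "tm (\<lambda>e. binf (S e))"
proof -
  from dfn_rename[OF S shift2] have S': "def (\<lambda>e. e 0 \<in> S (\<lambda>n. e (Suc (Suc n))))" by simp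
  have S'': "def (\<lambda>e. e 0 \<in> S (\<lambda>n. e (Suc (Suc (Suc n)))))"
    using dfn_rename[OF S inj_lift_up[of "\<lambda>n. Suc (Suc n)"]] by (simp add: inj_def)
  have 1: "def (\<lambda>e. e 0 \<in> elts A \<and> (\<forall>s\<in>elts A. s \<in> S (\<lambda>n. e (Suc n)) \<longrightarrow> vpair (e 0) s \<in> elts R) \<and>
      (\<forall>u\<in>elts A. (\<forall>s\<in>elts A. s \<in> S (\<lambda>n. e (Suc n)) \<longrightarrow> vpair u s \<in> elts R) \<longrightarrow> vpair u (e 0) \<in> elts R))"
    by (intro def_rules S' S'' ARV refl)
  have "e 0 = binf (S (\<lambda>n. e (Suc n))) \<longleftrightarrow> e 0 \<in> cr \<and> (\<forall>s\<in>cr. s \<in> S (\<lambda>n. e (Suc n)) \<longrightarrow> e 0 \<preceq> s) \<and>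
      (\<forall>u\<in>cr. (\<forall>s\<in>cr. s \<in> S (\<lambda>n. e (Suc n)) \<longrightarrow> u \<preceq> s) \<longrightarrow> u \<preceq> e 0)" (is "?l \<longleftrightarrow> ?r")
    if "e \<in> envs V" for e
  proof -
    have i: "inV (S (\<lambda>n. e (Suc n)))" using inV_env[OF S] that by simp
    show ?thesis
    proof
      assume ?l then show ?r using binf_closed[OF i] binf_lower[OF i] binf_greatest[OF i] by simp
    next
      assume ?r then show ?l
        using binf_closed[OF i] binf_lower[OF i] binf_greatest[OF i] by (intro le_antisym) simp_all
    qed
  qed
  then have "def (\<lambda>e. e 0 = binf (S (\<lambda>n. e (Suc n))))"
    by (intro dfn_cong[OF 1]; unfold le_iff[symmetric] cr_elts[symmetric])
  then show ?thesis
    unfolding trm_def using binf_closed[OF inV_env[OF S]] cr_V by simp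
qed

lemma def_mem_doubleton:
  assumes "tm t" "tm s"
  shows "def (\<lambda>e. e 0 \<in> {t (\<lambda>n. e (Suc n)), s (\<lambda>n. e (Suc n))})"
  unfolding insert_iff empty_iff simp_thms by (intro def_rules trm_shift assms)

lemma tm_meet: "tm t \<Longrightarrow> tm s \<Longrightarrow> tm (\<lambda>e. t e \<cdot> s e)"
  unfolding meet_def by (rule tm_binf[where S = "\<lambda>e. {t e, s e}"]) (rule def_mem_doubleton)

lemma tm_join: "tm t \<Longrightarrow> tm s \<Longrightarrow> tm (\<lambda>e. t e \<oplus> s e)"
  unfolding join_def by (rule tm_bsup[where S = "\<lambda>e. {t e, s e}"]) (rule def_mem_doubleton)

lemma inV_doubleton: "x \<in> V \<Longrightarrow> y \<in> V \<Longrightarrow> inV {x, y}"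
  by (rule inV_of_def) (rule def_mem_doubleton; intro trm_const refl)

lemma zero_closed [simp]: "\<zero> \<in> cr" and one_closed [simp]: "\<one> \<in> cr"
  by auto

lemma zero_le: "x \<in> cr \<Longrightarrow> \<zero> \<preceq> x" and le_one: "x \<in> cr \<Longrightarrow> x \<preceq> \<one>"
  by auto

lemma neg:
  assumes "x \<in> cr"
  shows "neg x \<in> cr" "x \<cdot> neg x = \<zero>" "x \<oplus> neg x = \<one>"
    and le_negI: "\<And>y. y \<in> cr \<Longrightarrow> x \<cdot> y = \<zero> \<Longrightarrow> y \<preceq> neg x"
    and neg_eqI: "\<And>y. y \<in> cr \<Longrightarrow> x \<cdot> y = \<zero> \<Longrightarrow> x \<oplus> y = \<one> \<Longrightarrow> neg x = y"
proof -
  have le: "y \<preceq> z" if y: "y \<in> cr" and z: "z \<in> cr" and "x \<cdot> y = \<zero>" "x \<oplus> z = \<one>" for y z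
  proof -
    have "y = y \<cdot> (x \<oplus> z)"
      using that by (intro le_antisym BL.meet_le) (simp_all add: le_one BL.meet_left)
    also have "\<dots> = y \<cdot> x \<oplus> y \<cdot> z" using distrib[OF y assms z] .
    also have "y \<cdot> x = \<zero>" using that by (simp add: meet_comm)
    also have "\<zero> \<oplus> y \<cdot> z \<preceq> z"
      using y z by (intro BL.join_le) (simp_all add: zero_le BL.meet_right)
    finally show ?thesis .
  qed
  obtain y where y: "y \<in> cr" "x \<cdot> y = \<zero>" "x \<oplus> y = \<one>" using ex_neg[OF assms] by blast
  have "neg x = y"
    unfolding bcompl_def by (rule the_equality) (use y le in \<open>blast intro: le_antisym\<close>)+
  then show 1: "neg x \<in> cr" "x \<cdot> neg x = \<zero>" "x \<oplus> neg x = \<one>" using y by simp_all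
  show "y \<preceq> neg x" if "y \<in> cr" "x \<cdot> y = \<zero>" for y using le[OF that(1) 1(1) that(2) 1(3)] .
  show "neg x = y" if "y \<in> cr" "x \<cdot> y = \<zero>" "x \<oplus> y = \<one>" for y
    by (rule le_antisym[OF le[OF 1(1) that(1) 1(2) that(3)] le[OF that(1) 1(1) that(2) 1(3)] 1(1) that(1)])
qed

text \<open>
  Inequalities are proved by forcing: \<open>a \<preceq> b\<close> holds as soon as every nonzero element below \<open>a\<close>
  has a nonzero element below it that is below \<open>b\<close>; and a nonzero element below a join can be
  shrunk to be below one of the joined elements.
\<close>

definition cond :: "'a \<Rightarrow> bool" where
  "cond x \<longleftrightarrow> x \<in> cr \<and> x \<noteq> \<zero>"

lemma cond_cr [simp]: "cond x \<Longrightarrow> x \<in> cr" by (simp add: cond_def)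

lemma not_cond_le_zero: "cond x \<Longrightarrow> \<not> x \<preceq> \<zero>"
  unfolding cond_def using le_antisym zero_le zero_closed by blast

lemma cond_not_neg: "cond x \<Longrightarrow> a \<in> cr \<Longrightarrow> x \<preceq> a \<Longrightarrow> \<not> x \<preceq> neg a"
  using BL.meet_le[of x a "neg a"] neg(1,2)[of a] not_cond_le_zero by auto

lemma meet_zeroI:
  assumes "a \<in> cr" "b \<in> cr" "\<And>x. cond x \<Longrightarrow> x \<preceq> a \<Longrightarrow> x \<preceq> b \<Longrightarrow> False"
  shows "a \<cdot> b = \<zero>"
  using assms(3)[of "a \<cdot> b"] assms(1,2) by (auto simp: cond_def BL.meet_left BL.meet_right)

lemma le_neg_iff:
  assumes "a \<in> cr" "x \<in> cr"
  shows "x \<preceq> neg a \<longleftrightarrow> (\<forall>y. cond y \<and> y \<preceq> x \<longrightarrow> \<not> y \<preceq> a)"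
proof
  assume x: "x \<preceq> neg a"
  show "\<forall>y. cond y \<and> y \<preceq> x \<longrightarrow> \<not> y \<preceq> a"
  proof (intro allI impI)
    fix y assume y: "cond y \<and> y \<preceq> x"
    then have "y \<preceq> neg a" using x assms neg(1) le_tr[of y x "neg a"] by simp
    then show "\<not> y \<preceq> a" using cond_not_neg[of y a] y assms by blast
  qed
next
  assume "\<forall>y. cond y \<and> y \<preceq> x \<longrightarrow> \<not> y \<preceq> a"
  then show "x \<preceq> neg a" using assms by (intro le_negI meet_zeroI) blast+
qed

lemma forcing_le:
  assumes "a \<in> cr" "b \<in> cr" and dense: "\<And>x. cond x \<Longrightarrow> x \<preceq> a \<Longrightarrow> \<exists>y. cond y \<and> y \<preceq> x \<and> y \<preceq> b"
  shows "a \<preceq> b"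
proof -
  have "a \<cdot> neg b = \<zero>"
  proof (intro meet_zeroI)
    fix x assume x: "cond x" "x \<preceq> a" "x \<preceq> neg b"
    then obtain y where "cond y" "y \<preceq> x" "y \<preceq> b" using dense by blast
    then show False using x le_neg_iff[OF assms(2), of x] by simp
  qed (use assms neg in auto)
  then have "a = a \<cdot> b \<oplus> \<zero>"
    using assms distrib[of a b "neg b"] neg(1-3)[of b] by (metis BL.le_iff_join le_one BL.top_closed)
  also have "\<dots> \<preceq> b"
    using assms by (intro BL.join_le) (simp_all add: zero_le BL.meet_right)
  finally show ?thesis .
qed

lemma bsup_cond:
  assumes "inV S" "cond x" "x \<preceq> bsup S"
  shows "\<exists>s\<in>S \<inter> cr. \<exists>y. cond y \<and> y \<preceq> x \<and> y \<preceq> s"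
proof (rule ccontr)
  assume neg': "\<not> ?thesis"
  have "bsup S \<preceq> neg x"
  proof (rule bsup_least[OF assms(1)])
    fix s assume s: "s \<in> S" "s \<in> cr"
    then show "s \<preceq> neg x" using neg' assms(2) by (subst le_neg_iff) auto
  qed (use assms neg in auto)
  then have "x \<preceq> neg x" using assms bsup_closed[OF assms(1)] neg(1) le_tr by (meson cond_cr)
  then show False using cond_not_neg[OF assms(2), of x] assms(2) by simp
qed

lemma cond_le_bsup:
  assumes "inV S" "x \<in> cr" "s \<in> S" "s \<in> cr" "x \<preceq> s"
  shows "x \<preceq> bsup S"
  using assms bsup_upper bsup_closed le_tr by meson

lemma le_meet_iff: "x \<in> cr \<Longrightarrow> a \<in> cr \<Longrightarrow> b \<in> cr \<Longrightarrow> x \<preceq> a \<cdot> b \<longleftrightarrow> x \<preceq> a \<and> x \<preceq> b"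
  using BL.meet_le[of x a b] BL.meet_left[of a b] BL.meet_right[of a b] le_tr[of x "a \<cdot> b" a]
    le_tr[of x "a \<cdot> b" b] by auto

lemma le_binf_iff:
  assumes "inV S" "x \<in> cr"
  shows "x \<preceq> binf S \<longleftrightarrow> (\<forall>s\<in>S \<inter> cr. x \<preceq> s)"
proof
  assume "x \<preceq> binf S"
  then show "\<forall>s\<in>S \<inter> cr. x \<preceq> s"
    using le_tr[OF _ binf_lower[OF assms(1)] assms(2) binf_closed[OF assms(1)]] by blast
qed (use binf_greatest[OF assms] in blast)

lemma le_imp_iff:
  assumes "a \<in> cr" "b \<in> cr" "x \<in> cr"
  shows "x \<preceq> neg a \<oplus> b \<longleftrightarrow> (\<forall>y. cond y \<and> y \<preceq> x \<longrightarrow> y \<preceq> a \<longrightarrow> y \<preceq> b)"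
proof
  assume x: "x \<preceq> neg a \<oplus> b"
  show "\<forall>y. cond y \<and> y \<preceq> x \<longrightarrow> y \<preceq> a \<longrightarrow> y \<preceq> b"
  proof (intro allI impI)
    fix y assume y: "cond y \<and> y \<preceq> x" "y \<preceq> a"
    show "y \<preceq> b"
    proof (rule forcing_le)
      fix z assume z: "cond z" "z \<preceq> y"
      then have "z \<preceq> bsup {neg a, b}"
        using x y assms neg(1)[of a] BL.join_closed le_tr[of z y x] le_tr[of z x "neg a \<oplus> b"]
        unfolding join_def by (metis cond_cr join_def)
      then obtain w where "cond w" "w \<preceq> z" "w \<preceq> neg a \<or> w \<preceq> b"
        using bsup_cond[OF inV_doubleton[OF cr_V[OF neg(1)[OF assms(1)]] cr_V[OF assms(2)]] z(1)] by auto
      moreover have "w \<preceq> a" if "cond w" "w \<preceq> z" for w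
        using that z y assms le_tr[of w z y] le_tr[of w y a] by simp
      ultimately show "\<exists>w. cond w \<and> w \<preceq> z \<and> w \<preceq> b"
        using cond_not_neg assms(1) by blast
    qed (use y assms in auto)
  qed
next
  assume *: "\<forall>y. cond y \<and> y \<preceq> x \<longrightarrow> y \<preceq> a \<longrightarrow> y \<preceq> b"
  note nc = neg(1)[OF assms(1)]
  show "x \<preceq> neg a \<oplus> b"
  proof (rule forcing_le)
    fix y assume y: "cond y" "y \<preceq> x"
    show "\<exists>z. cond z \<and> z \<preceq> y \<and> z \<preceq> neg a \<oplus> b"
    proof (cases "y \<preceq> neg a")
      case True
      then have "y \<preceq> neg a \<oplus> b"
        using y assms nc le_tr[of y "neg a" "neg a \<oplus> b"] by (simp add: BL.join_left)
      then show ?thesis using y(1) le_refl by auto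
    next
      case False
      then obtain z where z: "cond z" "z \<preceq> y" "z \<preceq> a" using le_neg_iff[OF assms(1), of y] y(1) by auto
      then have "z \<preceq> b" using * y assms le_tr[of z y x] by simp
      then have "z \<preceq> neg a \<oplus> b"
        using z assms nc le_tr[of z b "neg a \<oplus> b"] by (simp add: BL.join_right)
      then show ?thesis using z by blast
    qed
  qed (use assms nc in auto)
qed

end

section \<open>Boolean values of names are computed in the ground model\<close>

context boolean_model
begin

lemma trm_cong:
  assumes "tm t" "\<And>e. e \<in> envs V \<Longrightarrow> t' e = t e"
  shows "tm t'"
  unfolding trm_def
proof (intro conjI ballI)
  have d: "def (\<lambda>e. e 0 = t (\<lambda>n. e (Suc n)))" using assms(1) unfolding trm_def by blast
  show "def (\<lambda>e. e 0 = t' (\<lambda>n. e (Suc n)))"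
    by (rule dfn_cong[OF d]) (simp_all add: assms(2))
qed (simp_all add: assms(2) trm_closed(1)[OF assms(1)])

text \<open>
  The complement of the algebra is a definite description, which denotes nothing in particular
  outside the carrier; with a fixed value there it becomes a definable function.
\<close>

definition cneg :: "'a \<Rightarrow> 'a" where
  "cneg a = (if a \<in> cr then neg a else \<zero>)"

lemma tm_cneg_aux: "dfun cneg"
proof (rule tm_of_def)
  show "cneg x \<in> V" for x using cr_V neg(1) by (simp add: cneg_def)
  have 1: "def (\<lambda>e. (e (Suc 0) \<in> elts A \<and> e 0 \<in> elts A \<and> e (Suc 0) \<cdot> e 0 = \<zero> \<and> e (Suc 0) \<oplus> e 0 = \<one>) \<or>
      (e (Suc 0) \<notin> elts A \<and> e 0 = \<zero>))"
    by (intro tm_meet tm_join def_rules ARV refl cr_V zero_closed one_closed)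
  have 2: "z = cneg x \<longleftrightarrow> (x \<in> elts A \<and> z \<in> elts A \<and> x \<cdot> z = \<zero> \<and> x \<oplus> z = \<one>) \<or> (x \<notin> elts A \<and> z = \<zero>)"
    for x z
    unfolding cneg_def cr_elts[symmetric] using neg(1-3)[of x] neg_eqI[of x z] by auto
  show "def (\<lambda>e. e 0 = cneg (e (Suc 0)))"
    by (rule dfn_cong[OF 1]; rule 2)
qed

lemmas tm_cneg = tm_fun1[OF tm_cneg_aux]

definition vd :: "'a \<Rightarrow> 'a" where
  "vd r = vset {x \<in> elts (vset (\<Union>u\<in>elts (vset (\<Union>p\<in>elts r. elts p)). elts u)). \<exists>y\<in>V. vpair x y \<in> elts r}"

lemma tm_vd_aux: "dfun vd"
  unfolding vd_def by (intro def_rules)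

lemmas tm_vd = tm_fun1[OF tm_vd_aux]

lemma elts_vd: "r \<in> V \<Longrightarrow> elts (vd r) = vdom r"
proof -
  assume r: "r \<in> V"
  have 1: "elts (vset (\<Union>p\<in>elts r. elts p)) = (\<Union>p\<in>elts r. elts p)"
    by (intro elts_vset_small small_Union small_elts)
  have 2: "elts (vset (\<Union>u\<in>(\<Union>p\<in>elts r. elts p). elts u)) = (\<Union>u\<in>(\<Union>p\<in>elts r. elts p). elts u)"
    by (intro elts_vset_small small_Union small_elts)
  have vd: "elts (vd r) = {x \<in> (\<Union>u\<in>(\<Union>p\<in>elts r. elts p). elts u). \<exists>y\<in>V. vpair x y \<in> elts r}"
    by (simp only: vd_def elts_Collect) (simp only: 1 2)
  have in_pair: "x \<in> elts (vset {x})" "vset {x} \<in> elts (vpair x y)" for x y :: 'a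
    by (simp_all add: elts_vpair)
  show ?thesis
  proof (intro equalityI subsetI)
    fix x assume "x \<in> vdom r"
    then obtain y where y: "vpair x y \<in> elts r" unfolding vdom_def by blast
    moreover have "y \<in> V" using V_elts[OF r y] by simp
    ultimately show "x \<in> elts (vd r)" unfolding vd using in_pair by blast
  qed (auto simp: vd vdom_def)
qed

text \<open>
  \<open>val_eq\<close> is recursive on pairs of names; \<open>val_step\<close> computes its value at a pair from the graph
  of its restriction to the pairs of names from the two domains.
\<close>

definition mem_step :: "'a \<Rightarrow> 'a \<Rightarrow> 'a \<Rightarrow> 'a" where
  "mem_step g \<eta> \<sigma> = bsup {u. \<exists>\<xi>\<in>V. \<exists>b\<in>V. vpair \<xi> b \<in> elts \<sigma> \<and>
     (\<exists>v\<in>V. vpair (vpair \<eta> \<xi>) v \<in> elts g \<and> u = v \<cdot> b)}"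

definition sub_step :: "'a \<Rightarrow> 'a \<Rightarrow> 'a \<Rightarrow> 'a" where
  "sub_step g \<tau> \<sigma> = binf {u. \<exists>\<eta>\<in>elts (vd \<tau>). u = cneg (mem_step g \<eta> \<tau>) \<oplus> mem_step g \<eta> \<sigma>}"

definition dom_pairs :: "'a \<Rightarrow> 'a" where
  "dom_pairs z = (let D = vset (elts (vd (vfst0 z)) \<union> elts (vd (vsnd0 z)))
     in vset (\<Union>\<eta>\<in>elts D. elts (vset ((\<lambda>\<xi>. vpair \<eta> \<xi>) ` elts D))))"

definition val_step :: "'a \<Rightarrow> 'a \<Rightarrow> 'a" where
  "val_step z g = sub_step g (vfst0 z) (vsnd0 z) \<cdot> sub_step g (vsnd0 z) (vfst0 z)"

lemma mem_step_def_mem: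
  assumes "tm g" "tm h" "tm s"
  shows "def (\<lambda>e. e 0 \<in> {u. \<exists>\<xi>\<in>V. \<exists>b\<in>V. vpair \<xi> b \<in> elts (s (\<lambda>n. e (Suc n))) \<and>
     (\<exists>v\<in>V. vpair (vpair (h (\<lambda>n. e (Suc n))) \<xi>) v \<in> elts (g (\<lambda>n. e (Suc n))) \<and> u = v \<cdot> b)})"
  unfolding mem_Collect_eq
  by (intro def_rules tm_meet trm_rename[OF assms(1), of "\<lambda>n. Suc (Suc (Suc (Suc n)))"]
      trm_rename[OF assms(2), of "\<lambda>n. Suc (Suc (Suc (Suc n)))"]
      trm_rename[OF assms(3), of "\<lambda>n. Suc (Suc (Suc n))"]) (simp_all add: inj_def)

lemma tm_mem_step: "tm g \<Longrightarrow> tm h \<Longrightarrow> tm s \<Longrightarrow> tm (\<lambda>e. mem_step (g e) (h e) (s e))"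
  unfolding mem_step_def by (rule tm_bsup) (rule mem_step_def_mem)

lemma sub_step_def_mem:
  assumes "tm g" "tm h" "tm s"
  shows "def (\<lambda>e. e 0 \<in> {u. \<exists>\<eta>\<in>elts (vd (h (\<lambda>n. e (Suc n)))).
     u = cneg (mem_step (g (\<lambda>n. e (Suc n))) \<eta> (h (\<lambda>n. e (Suc n)))) \<oplus> mem_step (g (\<lambda>n. e (Suc n))) \<eta> (s (\<lambda>n. e (Suc n)))})"
  unfolding mem_Collect_eq
  by (intro def_rules tm_join tm_vd tm_cneg tm_mem_step trm_shift[OF assms(2)]
    trm_rename[OF assms(1), of "\<lambda>n. Suc (Suc n)"]
    trm_rename[OF assms(2), of "\<lambda>n. Suc (Suc n)"]
    trm_rename[OF assms(3), of "\<lambda>n. Suc (Suc n)"]) (simp_all add: inj_def)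

lemma tm_sub_step: "tm g \<Longrightarrow> tm h \<Longrightarrow> tm s \<Longrightarrow> tm (\<lambda>e. sub_step (g e) (h e) (s e))"
  unfolding sub_step_def by (rule tm_binf) (rule sub_step_def_mem)

lemma mem_step_closed: "g \<in> V \<Longrightarrow> h \<in> V \<Longrightarrow> s \<in> V \<Longrightarrow> mem_step g h s \<in> cr"
  unfolding mem_step_def
  by (intro bsup_closed inV_of_def mem_step_def_mem[where g = "\<lambda>_. g" and h = "\<lambda>_. h" and s = "\<lambda>_. s"]
      trm_const refl)

lemma tm_dom_pairs: "dfun dom_pairs"
  unfolding dom_pairs_def Let_def by (intro def_rules tm_vd tm_vfst0 tm_vsnd0)

lemma vfst0_V: "z \<in> V \<Longrightarrow> vfst0 z \<in> V" and vsnd0_V: "z \<in> V \<Longrightarrow> vsnd0 z \<in> V"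
  using tm_closed1[OF tm_vfst0_aux] tm_closed1[OF tm_vsnd0_aux] by auto

lemma elts_dom_pairs:
  assumes "z \<in> V"
  shows "elts (dom_pairs z) = {vpair \<eta> \<xi> |\<eta> \<xi>. \<eta> \<in> vdom (vfst0 z) \<union> vdom (vsnd0 z) \<and> \<xi> \<in> vdom (vfst0 z) \<union> vdom (vsnd0 z)}"
proof -
  let ?D = "vset (elts (vd (vfst0 z)) \<union> elts (vd (vsnd0 z)))"
  have "small (\<Union>r\<in>{vd (vfst0 z), vd (vsnd0 z)}. elts r)"
    by (intro small_Union small_elts small_finite) simp
  then have "elts ?D = elts (vd (vfst0 z)) \<union> elts (vd (vsnd0 z))" by (intro elts_vset_small) simp
  then have D: "elts ?D = vdom (vfst0 z) \<union> vdom (vsnd0 z)"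
    using elts_vd vfst0_V[OF assms] vsnd0_V[OF assms] by simp
  have "elts (dom_pairs z) = (\<Union>\<eta>\<in>elts ?D. (\<lambda>\<xi>. vpair \<eta> \<xi>) ` elts ?D)"
    by (simp only: dom_pairs_def Let_def elts_UN) (simp only: elts_image)
  then show ?thesis unfolding D by auto
qed

lemma wf_dom_pairs: "wf {(y, x). x \<in> V \<and> y \<in> elts (dom_pairs x)}"
proof -
  let ?r = "{(y, x). y \<in> elts x}\<^sup>+ :: ('a \<times> 'a) set"
  let ?w = "\<lambda>z. {#vfst0 z, vsnd0 z#} :: 'a multiset"
  have w: "wf (inv_image (mult ?r) ?w)"
    by (intro wf_inv_image wf_mult wf_trancl foundation)
  have d: "(?w y, ?w x) \<in> mult ?r" if x: "x \<in> V" and y: "y \<in> elts (dom_pairs x)" for x y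
  proof -
    obtain \<eta> \<xi> where y': "y = vpair \<eta> \<xi>" "\<eta> \<in> vdom (vfst0 x) \<union> vdom (vsnd0 x)"
        "\<xi> \<in> vdom (vfst0 x) \<union> vdom (vsnd0 x)"
      using y elts_dom_pairs[OF x] by blast
    have "(u, r) \<in> ?r" if "u \<in> vdom r" for u r
      using that vpair_fst_below unfolding vdom_def by blast
    then have "\<forall>k\<in>#{#\<eta>, \<xi>#}. \<exists>l\<in>#{#vfst0 x, vsnd0 x#}. (k, l) \<in> ?r"
      using y' by auto
    then show ?thesis
      using one_step_implies_mult[of "{#vfst0 x, vsnd0 x#}" "{#\<eta>, \<xi>#}" ?r "{#}"] y'(1) by simp
  qed
  show ?thesis by (rule wf_subset[OF w]) (use d in auto)
qed

text \<open>
  The equations of \<open>val_step\<close> only evaluate the graph at pairs from the two domains, where it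
  agrees with \<open>val_eq\<close>; so this is an instance of definable recursion.  All sets are allowed as
  arguments, not only names, because the lattice operations are total.
\<close>

lemma tm_val_eq_aux: "tm (\<lambda>e. val_eq B (vfst0 (e 0)) (vsnd0 (e 0)))"
proof (rule definable_recursion[where p = dom_pairs and G = val_step])
  show "tm (\<lambda>e. val_step (e (Suc 0)) (e 0))"
    unfolding val_step_def by (intro tm_meet tm_sub_step tm_vfst0 tm_vsnd0 trm_var)
next
  fix z assume z: "z \<in> V"
  let ?F = "\<lambda>y. val_eq B (vfst0 y) (vsnd0 y)"
  assume gV: "vset ((\<lambda>y. vpair y (?F y)) ` elts (dom_pairs z)) \<in> V"
  define g where "g = vset ((\<lambda>y. vpair y (?F y)) ` elts (dom_pairs z))"
  have g: "g \<in> V" using gV unfolding g_def .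
  let ?D = "vdom (vfst0 z) \<union> vdom (vsnd0 z)"
  have gr: "vpair (vpair \<eta> \<xi>) v \<in> elts g \<longleftrightarrow> v = val_eq B \<eta> \<xi>" if "\<eta> \<in> ?D" "\<xi> \<in> ?D" for \<eta> \<xi> v
  proof -
    have "vpair \<eta> \<xi> \<in> elts (dom_pairs z)" using that elts_dom_pairs[OF z] by blast
    then show ?thesis
      unfolding g_def elts_image image_iff by (auto intro!: bexI[of _ "vpair \<eta> \<xi>"])
  qed
  have mem: "mem_step g \<eta> \<sigma> = val_mem B \<eta> \<sigma>" if \<eta>: "\<eta> \<in> ?D" and \<sigma>: "\<sigma> = vfst0 z \<or> \<sigma> = vsnd0 z" for \<eta> \<sigma>
  proof -
    have \<sigma>V: "\<sigma> \<in> V" using \<sigma> vfst0_V[OF z] vsnd0_V[OF z] by auto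
    have dom: "\<xi> \<in> ?D \<and> \<xi> \<in> V \<and> b \<in> V" if "vpair \<xi> b \<in> elts \<sigma>" for \<xi> b
      using that \<sigma> V_elts[OF \<sigma>V that] unfolding vdom_def by auto
    have FV: "val_eq B \<eta> \<xi> \<in> V" if "\<xi> \<in> ?D" for \<xi>
      using V_elts[OF g, of "vpair (vpair \<eta> \<xi>) (val_eq B \<eta> \<xi>)"] gr[OF \<eta> that] by simp
    have "{u. \<exists>\<xi>\<in>V. \<exists>b\<in>V. vpair \<xi> b \<in> elts \<sigma> \<and> (\<exists>v\<in>V. vpair (vpair \<eta> \<xi>) v \<in> elts g \<and> u = v \<cdot> b)}
        = (\<lambda>(\<xi>, b). val_eq B \<eta> \<xi> \<cdot> b) ` {(\<xi>, b). vpair \<xi> b \<in> elts \<sigma>}" (is "?S = ?T")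
    proof (intro equalityI subsetI)
      fix u assume "u \<in> ?S"
      then obtain \<xi> b v where *: "vpair \<xi> b \<in> elts \<sigma>" "vpair (vpair \<eta> \<xi>) v \<in> elts g" "u = v \<cdot> b"
        by blast
      then have "v = val_eq B \<eta> \<xi>" using gr[OF \<eta>] dom by blast
      then show "u \<in> ?T" using * by (intro image_eqI[of _ _ "(\<xi>, b)"]) simp_all
    next
      fix u assume "u \<in> ?T"
      then obtain \<xi> b where *: "vpair \<xi> b \<in> elts \<sigma>" "u = val_eq B \<eta> \<xi> \<cdot> b" by auto
      then show "u \<in> ?S" using dom[OF *(1)] FV gr[OF \<eta>] by blast
    qed
    then show ?thesis unfolding mem_step_def val_mem.simps by simp
  qed
  have sub: "sub_step g \<tau> \<sigma> = val_sub B \<tau> \<sigma>"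
    if \<tau>: "\<tau> = vfst0 z \<or> \<tau> = vsnd0 z" and \<sigma>: "\<sigma> = vfst0 z \<or> \<sigma> = vsnd0 z" for \<tau> \<sigma>
  proof -
    have V: "\<tau> \<in> V" using \<tau> vfst0_V[OF z] vsnd0_V[OF z] by auto
    have D: "\<eta> \<in> ?D" if "\<eta> \<in> vdom \<tau>" for \<eta> using that \<tau> by auto
    have c: "val_mem B \<eta> \<tau> \<in> cr" if "\<eta> \<in> vdom \<tau>" for \<eta>
      using mem_step_closed[OF g _ V, of \<eta>] mem[OF D \<tau>] that V_elts[of "vd \<tau>"] tm_V[OF tm_vd[OF trm_const[OF V refl]]]
        elts_vd[OF V] by metis
    have "{u. \<exists>\<eta>\<in>elts (vd \<tau>). u = cneg (mem_step g \<eta> \<tau>) \<oplus> mem_step g \<eta> \<sigma>} =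
      (\<lambda>\<eta>. neg (val_mem B \<eta> \<tau>) \<oplus> val_mem B \<eta> \<sigma>) ` vdom \<tau>"
      unfolding elts_vd[OF V] image_def
    proof (rule Collect_cong, rule bex_cong[OF refl])
      fix u \<eta> assume \<eta>: "\<eta> \<in> vdom \<tau>"
      show "u = cneg (mem_step g \<eta> \<tau>) \<oplus> mem_step g \<eta> \<sigma> \<longleftrightarrow> u = neg (val_mem B \<eta> \<tau>) \<oplus> val_mem B \<eta> \<sigma>"
        unfolding mem[OF D[OF \<eta>] \<tau>] mem[OF D[OF \<eta>] \<sigma>] cneg_def using c[OF \<eta>] by simp
    qed
    then show ?thesis unfolding sub_step_def val_sub.simps by simp
  qed
  show "?F z = val_step z (vset ((\<lambda>y. vpair y (?F y)) ` elts (dom_pairs z)))"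
    unfolding g_def[symmetric] val_step_def by (simp add: sub val_eq.simps[of B "vfst0 z"])
qed (rule tm_dom_pairs wf_dom_pairs)+

lemma tm_val_eq: "tm t \<Longrightarrow> tm s \<Longrightarrow> tm (\<lambda>e. val_eq B (t e) (s e))"
  using tm_fun1[OF tm_val_eq_aux tm_vpair] by simp

lemma val_mem_eq:
  assumes "\<tau> \<in> V" "\<sigma> \<in> V"
  shows "val_mem B \<tau> \<sigma> = bsup {u. \<exists>\<eta>\<in>V. \<exists>b\<in>V. vpair \<eta> b \<in> elts \<sigma> \<and> u = val_eq B \<tau> \<eta> \<cdot> b}"
proof -
  have "vpair \<eta> b \<in> elts \<sigma> \<Longrightarrow> \<eta> \<in> V \<and> b \<in> V" for \<eta> b using V_elts[OF assms(2)] by force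
  then have "{u. \<exists>\<eta>\<in>V. \<exists>b\<in>V. vpair \<eta> b \<in> elts \<sigma> \<and> u = val_eq B \<tau> \<eta> \<cdot> b} =
      (\<lambda>(\<eta>, b). val_eq B \<tau> \<eta> \<cdot> b) ` {(\<eta>, b). vpair \<eta> b \<in> elts \<sigma>}" (is "?S = ?T")
    by (auto simp: image_iff)
  then show ?thesis unfolding val_mem.simps by simp
qed

lemma val_mem_set_def:
  assumes "tm t" "tm s"
  shows "def (\<lambda>e. e 0 \<in> {u. \<exists>\<eta>\<in>V. \<exists>b\<in>V. vpair \<eta> b \<in> elts (s (\<lambda>n. e (Suc n))) \<and>
    u = val_eq B (t (\<lambda>n. e (Suc n))) \<eta> \<cdot> b})"
  unfolding mem_Collect_eq
  by (intro def_rules tm_meet tm_val_eq trm_rename[OF assms(1), of "\<lambda>n. Suc (Suc (Suc n))"]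
      trm_rename[OF assms(2), of "\<lambda>n. Suc (Suc (Suc n))"]) (simp_all add: inj_def)

lemma tm_val_mem: assumes "tm t" "tm s" shows "tm (\<lambda>e. val_mem B (t e) (s e))"
  by (rule trm_cong[OF tm_bsup[OF val_mem_set_def[OF assms]]])
    (use trm_closed(1) assms val_mem_eq in blast)

lemma val_mem_inV:
  assumes "\<tau> \<in> V" "\<sigma> \<in> V"
  shows "inV {u. \<exists>\<eta>\<in>V. \<exists>b\<in>V. vpair \<eta> b \<in> elts \<sigma> \<and> u = val_eq B \<tau> \<eta> \<cdot> b}"
  by (rule inV_of_def, rule val_mem_set_def[where t = "\<lambda>_. \<tau>" and s = "\<lambda>_. \<sigma>"]; intro trm_const assms refl)

lemma mem_closed: "\<tau> \<in> V \<Longrightarrow> \<sigma> \<in> V \<Longrightarrow> val_mem B \<tau> \<sigma> \<in> cr"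
  unfolding val_mem_eq by (intro bsup_closed val_mem_inV)

lemma vdom_V: "\<tau> \<in> V \<Longrightarrow> \<eta> \<in> vdom \<tau> \<Longrightarrow> \<eta> \<in> V"
  unfolding vdom_def using V_elts by fastforce

lemma val_sub_eq:
  assumes "\<tau> \<in> V" "\<sigma> \<in> V"
  shows "val_sub B \<tau> \<sigma> = binf {u. \<exists>\<eta>\<in>elts (vd \<tau>). u = cneg (val_mem B \<eta> \<tau>) \<oplus> val_mem B \<eta> \<sigma>}"
proof -
  have "{u. \<exists>\<eta>\<in>elts (vd \<tau>). u = cneg (val_mem B \<eta> \<tau>) \<oplus> val_mem B \<eta> \<sigma>} =
      (\<lambda>\<eta>. neg (val_mem B \<eta> \<tau>) \<oplus> val_mem B \<eta> \<sigma>) ` vdom \<tau>"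
    unfolding elts_vd[OF assms(1)] image_def
    by (rule Collect_cong, rule bex_cong[OF refl])
      (simp only: cneg_def mem_closed[OF vdom_V[OF assms(1)] assms(1)] if_True)
  then show ?thesis unfolding val_sub.simps by simp
qed

lemma val_sub_inV:
  assumes "\<tau> \<in> V" "\<sigma> \<in> V"
  shows "inV {u. \<exists>\<eta>\<in>elts (vd \<tau>). u = cneg (val_mem B \<eta> \<tau>) \<oplus> val_mem B \<eta> \<sigma>}"
  by (rule inV_of_def, unfold mem_Collect_eq)
    (intro def_rules tm_join tm_cneg tm_val_mem tm_vd assms refl)

lemma sub_closed: "\<tau> \<in> V \<Longrightarrow> \<sigma> \<in> V \<Longrightarrow> val_sub B \<tau> \<sigma> \<in> cr"
  unfolding val_sub_eq by (intro binf_closed val_sub_inV)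

lemma eq_closed: "\<tau> \<in> V \<Longrightarrow> \<sigma> \<in> V \<Longrightarrow> val_eq B \<tau> \<sigma> \<in> cr"
  unfolding val_eq.simps using sub_closed by simp

end

section \<open>Boolean-valued equality\<close>

context boolean_model
begin

abbreviation "eqv \<equiv> val_eq B"
abbreviation "memv \<equiv> val_mem B"
abbreviation "subv \<equiv> val_sub B"
abbreviation "ck \<equiv> check B"
abbreviation "NB \<equiv> bnames V B"

lemma NB_bname: "\<tau> \<in> NB \<Longrightarrow> bname B \<tau>" and NB_I: "\<tau> \<in> V \<Longrightarrow> bname B \<tau> \<Longrightarrow> \<tau> \<in> NB"
  by (simp_all add: bnames_def)

lemma NB_V [simp]: "\<tau> \<in> NB \<Longrightarrow> \<tau> \<in> V"
  by (simp add: bnames_def)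

lemma NB_dom:
  assumes "\<tau> \<in> NB" "vpair \<eta> b \<in> elts \<tau>"
  shows "\<eta> \<in> NB" "b \<in> cr"
proof -
  from assms(1) have "bname B \<tau>" by (rule NB_bname)
  then have "\<forall>p\<in>elts \<tau>. \<exists>\<sigma> c. p = vpair \<sigma> c \<and> bname B \<sigma> \<and> c \<in> cr"
    by (elim bname.cases) simp
  from bspec[OF this assms(2)] have "bname B \<eta> \<and> b \<in> cr" by simp
  moreover have "\<eta> \<in> V" using V_elts[OF NB_V[OF assms(1)] assms(2)] by simp
  ultimately show "\<eta> \<in> NB" "b \<in> cr" by (auto intro: NB_I)
qed

lemma NB_vdom: "\<tau> \<in> NB \<Longrightarrow> \<eta> \<in> vdom \<tau> \<Longrightarrow> \<eta> \<in> NB"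
  unfolding vdom_def using NB_dom by blast

lemma NB_induct [consumes 1, case_names name]:
  assumes "\<tau> \<in> NB" "\<And>\<tau>. \<tau> \<in> NB \<Longrightarrow> (\<And>\<eta>. \<eta> \<in> vdom \<tau> \<Longrightarrow> P \<eta>) \<Longrightarrow> P \<tau>"
  shows "P \<tau>"
proof -
  have "wf ({(y, x). y \<in> elts x}\<^sup>+ :: ('a \<times> 'a) set)" by (intro wf_trancl foundation)
  then show ?thesis using assms(1)
  proof (induction \<tau> rule: wf_induct_rule)
    case (less \<tau>)
    show ?case
    proof (rule assms(2)[OF less.prems])
      fix \<eta> assume "\<eta> \<in> vdom \<tau>"
      then show "P \<eta>"
        using less vpair_fst_below NB_vdom unfolding vdom_def by blast
    qed
  qed
qed

lemma le_eqv_iff: "x \<in> cr \<Longrightarrow> \<tau> \<in> V \<Longrightarrow> \<sigma> \<in> V \<Longrightarrow> x \<preceq> eqv \<tau> \<sigma> \<longleftrightarrow> x \<preceq> subv \<tau> \<sigma> \<and> x \<preceq> subv \<sigma> \<tau>"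
  by (subst val_eq.simps) (intro le_meet_iff sub_closed)

lemma eqv_sym: "eqv \<tau> \<sigma> = eqv \<sigma> \<tau>"
  by (subst (1 2) val_eq.simps) (rule meet_comm)

lemma memv_condD:
  assumes "cond x" "x \<preceq> memv \<tau> \<sigma>" "\<tau> \<in> NB" "\<sigma> \<in> NB"
  obtains \<eta> b y where "vpair \<eta> b \<in> elts \<sigma>" "cond y" "y \<preceq> x" "y \<preceq> eqv \<tau> \<eta>" "y \<preceq> b"
proof -
  let ?S = "{u. \<exists>\<eta>\<in>V. \<exists>b\<in>V. vpair \<eta> b \<in> elts \<sigma> \<and> u = eqv \<tau> \<eta> \<cdot> b}"
  note V = NB_V[OF assms(3)] NB_V[OF assms(4)]
  have "\<exists>s\<in>?S \<inter> cr. \<exists>y. cond y \<and> y \<preceq> x \<and> y \<preceq> s"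
    by (rule bsup_cond[OF val_mem_inV[OF V] assms(1)]) (use assms(2) val_mem_eq[OF V] in simp)
  then obtain s y where s: "s \<in> ?S" and y: "cond y" "y \<preceq> x" "y \<preceq> s" by blast
  then obtain \<eta> b where \<eta>: "\<eta> \<in> V" "vpair \<eta> b \<in> elts \<sigma>" "s = eqv \<tau> \<eta> \<cdot> b" by blast
  have "y \<preceq> eqv \<tau> \<eta> \<and> y \<preceq> b"
    using y \<eta> NB_dom[OF assms(4) \<eta>(2)] assms(3) eq_closed[of \<tau> \<eta>] le_meet_iff[of y "eqv \<tau> \<eta>" b] by simp
  then show ?thesis using that \<eta> y by blast
qed

lemma memv_condI:
  assumes "x \<in> cr" "\<tau> \<in> V" "\<sigma> \<in> V" "vpair \<eta> b \<in> elts \<sigma>" "b \<in> cr" "x \<preceq> eqv \<tau> \<eta>" "x \<preceq> b"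
  shows "x \<preceq> memv \<tau> \<sigma>"
proof -
  have V: "\<eta> \<in> V" "b \<in> V" using V_elts[OF assms(3,4)] by simp_all
  note c = eq_closed[OF assms(2) V(1)]
  show ?thesis
    unfolding val_mem_eq[OF assms(2,3)]
  proof (rule cond_le_bsup[OF val_mem_inV[OF assms(2,3)] assms(1), of "eqv \<tau> \<eta> \<cdot> b"])
    show "x \<preceq> eqv \<tau> \<eta> \<cdot> b" using assms c by (simp add: le_meet_iff)
  qed (use V assms c in auto)
qed

lemma le_subv_iff:
  assumes "x \<in> cr" "\<tau> \<in> V" "\<sigma> \<in> V"
  shows "x \<preceq> subv \<tau> \<sigma> \<longleftrightarrow> (\<forall>\<eta>\<in>vdom \<tau>. \<forall>y. cond y \<and> y \<preceq> x \<longrightarrow> y \<preceq> memv \<eta> \<tau> \<longrightarrow> y \<preceq> memv \<eta> \<sigma>)"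
proof -
  let ?b = "\<lambda>\<eta>. cneg (memv \<eta> \<tau>) \<oplus> memv \<eta> \<sigma>"
  have c: "memv \<eta> \<tau> \<in> cr" "memv \<eta> \<sigma> \<in> cr" if "\<eta> \<in> vdom \<tau>" for \<eta>
    by (intro mem_closed vdom_V[OF assms(2) that] assms)+
  have b: "?b \<eta> \<in> cr" "x \<preceq> ?b \<eta> \<longleftrightarrow> (\<forall>y. cond y \<and> y \<preceq> x \<longrightarrow> y \<preceq> memv \<eta> \<tau> \<longrightarrow> y \<preceq> memv \<eta> \<sigma>)"
    if "\<eta> \<in> vdom \<tau>" for \<eta>
    using le_imp_iff[OF c[OF that] assms(1)] c[OF that] neg(1) by (simp_all add: cneg_def)
  have "x \<preceq> subv \<tau> \<sigma> \<longleftrightarrow> (\<forall>\<eta>\<in>vdom \<tau>. x \<preceq> ?b \<eta>)"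
    unfolding val_sub_eq[OF assms(2,3)] le_binf_iff[OF val_sub_inV[OF assms(2,3)] assms(1)]
    by (auto simp: elts_vd[OF assms(2)] b(1))
  also have "\<dots> \<longleftrightarrow> (\<forall>\<eta>\<in>vdom \<tau>. \<forall>y. cond y \<and> y \<preceq> x \<longrightarrow> y \<preceq> memv \<eta> \<tau> \<longrightarrow> y \<preceq> memv \<eta> \<sigma>)"
    by (rule ball_cong[OF refl b(2)])
  finally show ?thesis .
qed

lemma eqv_refl: "x \<in> cr \<Longrightarrow> \<tau> \<in> V \<Longrightarrow> x \<preceq> eqv \<tau> \<tau>"
  by (simp add: le_eqv_iff le_subv_iff)

lemma memv_self:
  "\<sigma> \<in> NB \<Longrightarrow> vpair \<eta> b \<in> elts \<sigma> \<Longrightarrow> x \<in> cr \<Longrightarrow> x \<preceq> b \<Longrightarrow> x \<preceq> memv \<eta> \<sigma>"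
  using NB_dom[of \<sigma> \<eta> b] by (intro memv_condI[of _ _ _ \<eta> b] eqv_refl) auto

lemma subv_mem:
  assumes "cond x" "\<tau> \<in> V" "\<sigma> \<in> V" "\<eta> \<in> vdom \<tau>" "x \<preceq> subv \<tau> \<sigma>" "x \<preceq> memv \<eta> \<tau>"
  shows "x \<preceq> memv \<eta> \<sigma>"
  using assms le_subv_iff[of x \<tau> \<sigma>] le_refl by auto

lemma cle: "cond y \<Longrightarrow> y \<preceq> x \<Longrightarrow> x \<preceq> a \<Longrightarrow> x \<in> cr \<Longrightarrow> a \<in> cr \<Longrightarrow> y \<preceq> a"
  by (rule le_tr) auto

text \<open>
  Transitivity for three names only needs itself for names from the three domains: if \<open>\<zeta>\<close> is forced into \<open>\<tau>\<close>, it
  is forced into \<open>\<sigma>\<close>, hence equal to some \<open>\<xi>\<close> in the domain of \<open>\<sigma>\<close>, which is forced into \<open>\<rho>\<close>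
  and so equal to some \<open>\<xi>'\<close> in the domain of \<open>\<rho>\<close>.
\<close>

lemma subv_chain:
  assumes N: "\<tau> \<in> NB" "\<sigma> \<in> NB" "\<rho> \<in> NB" and x: "cond x" "x \<preceq> subv \<tau> \<sigma>" "x \<preceq> subv \<sigma> \<rho>"
    and tr: "\<And>\<zeta> \<xi> \<xi>' y. \<zeta> \<in> vdom \<tau> \<Longrightarrow> \<xi> \<in> vdom \<sigma> \<Longrightarrow> \<xi>' \<in> vdom \<rho> \<Longrightarrow> cond y \<Longrightarrow>
      y \<preceq> eqv \<zeta> \<xi> \<Longrightarrow> y \<preceq> eqv \<xi> \<xi>' \<Longrightarrow> y \<preceq> eqv \<zeta> \<xi>'"
  shows "x \<preceq> subv \<tau> \<rho>"
proof -
  note V = NB_V[OF N(1)] NB_V[OF N(2)] NB_V[OF N(3)]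
  have "y \<preceq> memv \<zeta> \<rho>" if \<zeta>: "\<zeta> \<in> vdom \<tau>" and y: "cond y" "y \<preceq> x" "y \<preceq> memv \<zeta> \<tau>" for \<zeta> y
  proof -
    note \<zeta>N = NB_vdom[OF N(1) \<zeta>]
    have c: "memv \<zeta> \<rho> \<in> cr" "memv \<zeta> \<sigma> \<in> cr" using mem_closed \<zeta>N V by auto
    have "y \<preceq> subv \<tau> \<sigma>" "y \<preceq> subv \<sigma> \<rho>" using cle[OF y(1,2)] x V sub_closed by auto
    then have ym: "y \<preceq> memv \<zeta> \<sigma>" using subv_mem[OF y(1)] V \<zeta> y(3) by blast
    show ?thesis
    proof (rule forcing_le)
      fix z assume z: "cond z" "z \<preceq> y"
      then have "z \<preceq> memv \<zeta> \<sigma>" using cle ym c y by auto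
      from memv_condD[OF z(1) this \<zeta>N N(2)] obtain \<xi> b w where
        w: "vpair \<xi> b \<in> elts \<sigma>" "cond w" "w \<preceq> z" "w \<preceq> eqv \<zeta> \<xi>" "w \<preceq> b" .
      have \<xi>: "\<xi> \<in> vdom \<sigma>" "\<xi> \<in> NB" using w(1) NB_dom[OF N(2)] unfolding vdom_def by auto
      have "w \<preceq> x" using w z y x le_tr[of w z y] le_tr[of w y x] by simp
      then have "w \<preceq> subv \<sigma> \<rho>" using cle[OF w(2)] x V sub_closed by auto
      moreover have "w \<preceq> memv \<xi> \<sigma>" using memv_self[OF N(2) w(1)] w by simp
      ultimately have "w \<preceq> memv \<xi> \<rho>" using subv_mem[OF w(2)] V \<xi> by blast
      from memv_condD[OF w(2) this \<xi>(2) N(3)] obtain \<xi>' b' u where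
        u: "vpair \<xi>' b' \<in> elts \<rho>" "cond u" "u \<preceq> w" "u \<preceq> eqv \<xi> \<xi>'" "u \<preceq> b'" .
      have \<xi>': "\<xi>' \<in> vdom \<rho>" "b' \<in> cr" using u(1) NB_dom[OF N(3)] unfolding vdom_def by auto
      have "u \<preceq> eqv \<zeta> \<xi>" using cle[OF u(2,3) w(4)] w(2) eq_closed \<zeta>N \<xi> by simp
      then have "u \<preceq> eqv \<zeta> \<xi>'" using tr[OF \<zeta> \<xi>(1) \<xi>'(1) u(2)] u(4) by blast
      then have "u \<preceq> memv \<zeta> \<rho>" using memv_condI[OF _ _ _ u(1) \<xi>'(2)] u \<zeta>N V by simp
      moreover have "u \<preceq> z" using u w z le_tr[of u w z] by simp
      ultimately show "\<exists>u. cond u \<and> u \<preceq> z \<and> u \<preceq> memv \<zeta> \<rho>" using u(2) by blast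
    qed (use y c in auto)
  qed
  then show ?thesis using le_subv_iff[of x \<tau> \<rho>] x(1) V by simp
qed

lemma eqv_trans:
  assumes "\<tau> \<in> NB" "\<sigma> \<in> NB" "\<rho> \<in> NB" "cond x" "x \<preceq> eqv \<tau> \<sigma>" "x \<preceq> eqv \<sigma> \<rho>"
  shows "x \<preceq> eqv \<tau> \<rho>"
  using assms
proof (induction \<tau> arbitrary: \<sigma> \<rho> x rule: NB_induct)
  case (name \<tau>)
  have le: "x \<preceq> subv \<tau> \<sigma>" "x \<preceq> subv \<sigma> \<tau>" "x \<preceq> subv \<sigma> \<rho>" "x \<preceq> subv \<rho> \<sigma>"
    using name.prems name.hyps by (simp_all add: le_eqv_iff)
  have "x \<preceq> subv \<tau> \<rho>"
    using le name.prems name.hyps name.IH NB_vdom by (intro subv_chain[of \<tau> \<sigma> \<rho>]) blast+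
  moreover have "x \<preceq> subv \<rho> \<tau>"
  proof (rule subv_chain[of \<rho> \<sigma> \<tau>])
    fix \<zeta> \<xi> \<xi>' y assume "\<zeta> \<in> vdom \<rho>" "\<xi> \<in> vdom \<sigma>" "\<xi>' \<in> vdom \<tau>" "cond y" "y \<preceq> eqv \<zeta> \<xi>" "y \<preceq> eqv \<xi> \<xi>'"
    then show "y \<preceq> eqv \<zeta> \<xi>'"
      using name.IH[of \<xi>' \<xi> \<zeta> y] name.prems NB_vdom eqv_sym by metis
  qed (use le name.prems name.hyps in auto)
  ultimately show ?case using name.prems name.hyps by (simp add: le_eqv_iff)
qed

lemma memv_subst_left:
  assumes N: "\<eta> \<in> NB" "\<eta>' \<in> NB" "\<tau> \<in> NB" and x: "cond x" "x \<preceq> memv \<eta> \<tau>" "x \<preceq> eqv \<eta> \<eta>'"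
  shows "x \<preceq> memv \<eta>' \<tau>"
proof (rule forcing_le)
  fix z assume z: "cond z" "z \<preceq> x"
  have "z \<preceq> memv \<eta> \<tau>" using cle[OF z x(2)] x mem_closed N by simp
  from memv_condD[OF z(1) this N(1,3)] obtain \<xi> b w where
    w: "vpair \<xi> b \<in> elts \<tau>" "cond w" "w \<preceq> z" "w \<preceq> eqv \<eta> \<xi>" "w \<preceq> b" .
  have "w \<preceq> x" using w z x le_tr[of w z x] by simp
  then have "w \<preceq> eqv \<eta>' \<eta>" using cle[OF w(2) _ x(3)] x(1) eq_closed N eqv_sym by simp
  then have "w \<preceq> eqv \<eta>' \<xi>" using eqv_trans[OF N(2,1) NB_dom(1)[OF N(3) w(1)] w(2)] w(4) by blast
  then have "w \<preceq> memv \<eta>' \<tau>" using memv_condI[OF _ _ _ w(1)] NB_dom(2)[OF N(3) w(1)] w N by simp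
  then show "\<exists>w. cond w \<and> w \<preceq> z \<and> w \<preceq> memv \<eta>' \<tau>" using w by blast
qed (use x N mem_closed in auto)

lemma memv_subst_right:
  assumes N: "\<eta> \<in> NB" "\<tau> \<in> NB" "\<sigma> \<in> NB" and x: "cond x" "x \<preceq> memv \<eta> \<tau>" "x \<preceq> eqv \<tau> \<sigma>"
  shows "x \<preceq> memv \<eta> \<sigma>"
proof (rule forcing_le)
  fix z assume z: "cond z" "z \<preceq> x"
  have "z \<preceq> memv \<eta> \<tau>" using cle[OF z x(2)] x mem_closed N by simp
  from memv_condD[OF z(1) this N(1,2)] obtain \<xi> b w where
    w: "vpair \<xi> b \<in> elts \<tau>" "cond w" "w \<preceq> z" "w \<preceq> eqv \<eta> \<xi>" "w \<preceq> b" .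
  have \<xi>: "\<xi> \<in> vdom \<tau>" "\<xi> \<in> NB" using w(1) NB_dom[OF N(2)] unfolding vdom_def by auto
  have "w \<preceq> x" using w z x le_tr[of w z x] by simp
  then have "w \<preceq> eqv \<tau> \<sigma>" using cle[OF w(2) _ x(3)] x(1) eq_closed N by simp
  then have "w \<preceq> subv \<tau> \<sigma>" using w N by (simp add: le_eqv_iff)
  moreover have "w \<preceq> memv \<xi> \<tau>" using memv_self[OF N(2) w(1)] w by simp
  ultimately have "w \<preceq> memv \<xi> \<sigma>" by (rule subv_mem[OF w(2) NB_V[OF N(2)] NB_V[OF N(3)] \<xi>(1)])
  then have "w \<preceq> memv \<eta> \<sigma>" using memv_subst_left[OF \<xi>(2) N(1,3) w(2)] w(4) eqv_sym by simp
  then show "\<exists>w. cond w \<and> w \<preceq> z \<and> w \<preceq> memv \<eta> \<sigma>" using w by blast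
qed (use x N mem_closed in auto)


section \<open>Check names and mixtures\<close>

lemma elts_ck: "elts (ck x) = (\<lambda>y. vpair (ck y) \<one>) ` elts x"
  by (subst check.simps) (rule elts_image)

lemma tm_ck_aux: "dfun ck"
proof (rule definable_recursion[where p = "\<lambda>x. x" and G = "\<lambda>x g. vset ((\<lambda>q. vpair (vsnd0 q) \<one>) ` elts g)"])
  show "tm (\<lambda>e. vset ((\<lambda>q. vpair (vsnd0 q) \<one>) ` elts (e 0)))"
    by (intro tm_vsnd0 def_rules cr_V one_closed refl)
  show "ck x = vset ((\<lambda>q. vpair (vsnd0 q) \<one>) ` elts (vset ((\<lambda>y. vpair y (ck y)) ` elts x)))" for x
    by (subst check.simps) (simp add: image_image)
qed (rule trm_var wf_elts_V)+

lemmas tm_ck = tm_fun1[OF tm_ck_aux]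

lemma ck_NB: "x \<in> V \<Longrightarrow> ck x \<in> NB"
proof (induction x rule: elts_induct)
  case (step x)
  have "bname B (ck x)"
  proof (rule bname.intros)
    fix p assume "p \<in> elts (ck x)"
    then obtain y where y: "y \<in> elts x" "p = vpair (ck y) \<one>" by (auto simp: elts_ck)
    have "ck y \<in> NB" by (rule step.IH[OF y(1) V_elts[OF step.prems y(1)]])
    then show "\<exists>\<sigma> b. p = vpair \<sigma> b \<and> bname B \<sigma> \<and> b \<in> cr"
      using y by (intro exI[of _ "ck y"] exI[of _ \<one>]) (simp add: NB_bname)
  qed
  then show ?case using tm_closed1[OF tm_ck_aux step.prems] by (intro NB_I)
qed

lemma ck_V [simp]: "x \<in> V \<Longrightarrow> ck x \<in> V"
  using ck_NB NB_V by blast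

lemma le_mem_ck: "x \<in> cr \<Longrightarrow> u \<in> elts y \<Longrightarrow> y \<in> V \<Longrightarrow> x \<preceq> memv (ck u) (ck y)"
  by (rule memv_self[of _ _ \<one>]) (auto simp: elts_ck ck_NB)

lemma mem_ckD:
  assumes "cond x" "x \<preceq> memv \<tau> (ck y)" "\<tau> \<in> NB" "y \<in> V"
  obtains v z where "v \<in> elts y" "cond z" "z \<preceq> x" "z \<preceq> eqv \<tau> (ck v)"
proof -
  from memv_condD[OF assms(1-3) ck_NB[OF assms(4)]] obtain \<eta> b z
    where "vpair \<eta> b \<in> elts (ck y)" "cond z" "z \<preceq> x" "z \<preceq> eqv \<tau> \<eta>" .
  then show ?thesis using that by (auto simp: elts_ck)
qed

lemma eqv_ck_subset:
  assumes "cond x" "x \<preceq> eqv (ck a) (ck b)" "a \<in> V" "b \<in> V" "u \<in> elts a"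
  obtains v z where "v \<in> elts b" "cond z" "z \<preceq> x" "z \<preceq> eqv (ck u) (ck v)"
proof -
  have u: "u \<in> V" by (rule V_elts[OF assms(3,5)])
  have "x \<preceq> memv (ck u) (ck b)"
    by (rule memv_subst_right[OF ck_NB[OF u] ck_NB[OF assms(3)] ck_NB[OF assms(4)] assms(1)
          le_mem_ck[OF cond_cr[OF assms(1)] assms(5,3)] assms(2)])
  from mem_ckD[OF assms(1) this ck_NB[OF u] assms(4)] show ?thesis using that by blast
qed

text \<open>
  Distinct elements of \<open>V\<close> have check names whose equality has Boolean value \<open>\<zero>\<close>, by induction: a
  condition that forces the two sets to be equal can be shrunk to force each element of one to be
  equal to some element of the other.
\<close>

lemma eqv_ckD: "cond x \<Longrightarrow> x \<preceq> eqv (ck a) (ck b) \<Longrightarrow> a \<in> V \<Longrightarrow> b \<in> V \<Longrightarrow> a = b"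
proof (induction a arbitrary: b x rule: elts_induct)
  case (step a)
  have "elts a \<subseteq> elts b"
  proof
    fix u assume u: "u \<in> elts a"
    from eqv_ck_subset[OF step.prems u] obtain v z
      where "v \<in> elts b" "cond z" "z \<preceq> eqv (ck u) (ck v)" by metis
    then show "u \<in> elts b" using step.IH[OF u] V_elts step.prems u by blast
  qed
  moreover have "elts b \<subseteq> elts a"
  proof
    fix v assume v: "v \<in> elts b"
    from eqv_ck_subset[of x b a v] step.prems v obtain u z
      where "u \<in> elts a" "cond z" "z \<preceq> eqv (ck v) (ck u)" by (metis eqv_sym)
    then show "v \<in> elts a" using step.IH[of u z v] V_elts step.prems v eqv_sym by metis
  qed
  ultimately show ?case by (intro extensionality) blast
qed

lemma memv_ckD: "cond x \<Longrightarrow> x \<preceq> memv (ck a) (ck b) \<Longrightarrow> a \<in> V \<Longrightarrow> b \<in> V \<Longrightarrow> a \<in> elts b"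
  by (rule mem_ckD[of x "ck a" b]) (use eqv_ckD ck_NB V_elts in blast)+

lemma eqv_ck_unique:
  assumes "cond x" "\<tau> \<in> NB" "a \<in> V" "b \<in> V" "x \<preceq> eqv \<tau> (ck a)" "x \<preceq> eqv \<tau> (ck b)"
  shows "a = b"
  using eqv_trans[OF ck_NB assms(2) ck_NB, of a b x] assms eqv_sym eqv_ckD by metis

text \<open>
  If the values of \<open>p\<close> are disjoint, then \<open>p x\<close> forces this name to be equal to \<open>f x\<close>: it puts
  exactly the elements of \<open>f x\<close> into the name.
\<close>

definition mixture :: "('a \<Rightarrow> 'a) \<Rightarrow> 'a \<Rightarrow> ('a \<Rightarrow> 'a) \<Rightarrow> 'a" where
  "mixture p X f = vset (\<Union>x\<in>elts X. elts (vset ((\<lambda>y. vpair (ck y) (p x)) ` elts (f x))))"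

lemma elts_mixture: "elts (mixture p X f) = (\<Union>x\<in>elts X. (\<lambda>y. vpair (ck y) (p x)) ` elts (f x))"
  unfolding mixture_def by (simp only: elts_UN) (simp only: elts_image)

lemma mixture_NB:
  assumes "dfun p" "dfun f" "X \<in> V" "\<And>x. x \<in> elts X \<Longrightarrow> p x \<in> cr"
  shows "mixture p X f \<in> NB"
proof -
  have "tm (\<lambda>_. mixture p X f)"
    unfolding mixture_def by (intro tm_fun1[OF assms(1)] tm_fun1[OF assms(2)] tm_ck def_rules assms refl)
  then have "mixture p X f \<in> V" by (rule tm_V)
  moreover have "bname B (mixture p X f)"
  proof (rule bname.intros)
    fix q assume "q \<in> elts (mixture p X f)"
    then obtain x y where x: "x \<in> elts X" "y \<in> elts (f x)" "q = vpair (ck y) (p x)" by (auto simp: elts_mixture)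
    have "y \<in> V" by (rule V_elts[OF tm_closed1[OF assms(2) V_elts[OF assms(3) x(1)]] x(2)])
    then have "ck y \<in> NB" by (rule ck_NB)
    then show "\<exists>\<sigma> b. q = vpair \<sigma> b \<and> bname B \<sigma> \<and> b \<in> cr"
      using x assms(4)[OF x(1)] by (intro exI[of _ "ck y"] exI[of _ "p x"]) (simp add: NB_bname)
  qed
  ultimately show ?thesis by (intro NB_I)
qed

lemma mixture_eqv:
  assumes p: "dfun p" "\<And>x. x \<in> elts X \<Longrightarrow> p x \<in> cr" and f: "dfun f" and X: "X \<in> V"
    and disj: "\<And>x y c. x \<in> elts X \<Longrightarrow> y \<in> elts X \<Longrightarrow> cond c \<Longrightarrow> c \<preceq> p x \<Longrightarrow> c \<preceq> p y \<Longrightarrow> f x = f y"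
    and x: "x \<in> elts X" and c: "cond c" "c \<preceq> p x"
  shows "c \<preceq> eqv (mixture p X f) (ck (f x))"
proof -
  let ?m = "mixture p X f"
  have mN: "?m \<in> NB" using mixture_NB p f X by blast
  have fV: "f y \<in> V" if "y \<in> elts X" for y by (rule tm_closed1[OF f V_elts[OF X that]])
  note cN = ck_NB[OF fV[OF x]]
  have "d \<preceq> memv \<eta> (ck (f x))" if \<eta>: "\<eta> \<in> vdom ?m" and d: "cond d" "d \<preceq> c" "d \<preceq> memv \<eta> ?m" for \<eta> d
  proof (rule forcing_le)
    note \<eta>N = NB_vdom[OF mN \<eta>]
    fix z assume z: "cond z" "z \<preceq> d"
    have "z \<preceq> memv \<eta> ?m" using cle[OF z d(3)] d mem_closed \<eta>N mN by simp
    from memv_condD[OF z(1) this \<eta>N mN] obtain \<xi> b w where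
      w: "vpair \<xi> b \<in> elts ?m" "cond w" "w \<preceq> z" "w \<preceq> eqv \<eta> \<xi>" "w \<preceq> b" .
    then obtain x' y where x': "x' \<in> elts X" "y \<in> elts (f x')" "\<xi> = ck y" "b = p x'"
      by (auto simp: elts_mixture)
    have "w \<preceq> p x" using w z d c le_tr[of w z d] le_tr[of w d c] le_tr[of w c "p x"] p(2)[OF x] by simp
    then have "f x' = f x" using disj[OF x x'(1) w(2)] w(5) x'(4) by simp
    then have yf: "y \<in> elts (f x)" using x' by simp
    have "w \<preceq> memv (ck y) (ck (f x))" using le_mem_ck yf fV[OF x] w(2) by simp
    then have "w \<preceq> memv \<eta> (ck (f x))"
      using memv_subst_left[OF ck_NB \<eta>N cN w(2)] w(4) x'(3) eqv_sym V_elts[OF fV[OF x] yf] by simp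
    then show "\<exists>w. cond w \<and> w \<preceq> z \<and> w \<preceq> memv \<eta> (ck (f x))" using w by blast
  qed (use d mem_closed NB_vdom[OF mN \<eta>] fV[OF x] in auto)
  then have "c \<preceq> subv ?m (ck (f x))" using le_subv_iff c(1) mN fV[OF x] by simp
  moreover have "d \<preceq> memv \<eta> ?m" if \<eta>: "\<eta> \<in> vdom (ck (f x))" and d: "cond d" "d \<preceq> c" for \<eta> d
  proof -
    obtain y where y: "y \<in> elts (f x)" "\<eta> = ck y" using \<eta> by (auto simp: vdom_def elts_ck)
    then have "vpair \<eta> (p x) \<in> elts ?m" using x by (auto simp: elts_mixture)
    then show ?thesis using memv_self[OF mN] d cle[OF d c(2)] c(1) p(2)[OF x] by simp
  qed
  then have "c \<preceq> subv (ck (f x)) ?m" using le_subv_iff c(1) mN fV[OF x] by simp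
  ultimately show ?thesis using le_eqv_iff c(1) mN fV[OF x] by simp
qed


text \<open>
  The possible values of \<open>\<tau>\<close> form a set of the ground model: they are subsets of the set of all
  possible values of the names in the domain of \<open>\<tau>\<close>.
\<close>

definition supp :: "'a \<Rightarrow> 'a" where
  "supp \<tau> = vset {x \<in> V. eqv \<tau> (ck x) \<noteq> \<zero>}"

lemma supp_aux: "\<tau> \<in> NB \<Longrightarrow> \<exists>s\<in>V. elts s = {x \<in> V. eqv \<tau> (ck x) \<noteq> \<zero>}"
proof (induction \<tau> rule: NB_induct)
  case (name \<tau>)
  note N = name.hyps
  define S where "S \<eta> = {x \<in> V. eqv \<eta> (ck x) \<noteq> \<zero>}" for \<eta>
  define has where "has \<eta> \<longleftrightarrow> (\<exists>s\<in>V. \<forall>x\<in>V. x \<in> elts s \<longleftrightarrow> eqv \<eta> (ck x) \<noteq> \<zero>)" for \<eta>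
  have has_iff: "has \<eta> \<longleftrightarrow> (\<exists>s\<in>V. elts s = S \<eta>)" for \<eta>
    unfolding has_def S_def using V_elts by blast
  define S' where "S' \<eta> = (if has \<eta> then vset (S \<eta>) else \<eta>)" for \<eta>
  have S'V: "S' \<eta> \<in> V" if "\<eta> \<in> V" for \<eta>
    using that unfolding S'_def has_iff by (auto simp: vset_elts dest: sym)
  have S'_iff: "z = S' \<eta> \<longleftrightarrow> (has \<eta> \<and> (\<forall>x\<in>V. x \<in> elts z \<longleftrightarrow> eqv \<eta> (ck x) \<noteq> \<zero>)) \<or> \<not> has \<eta> \<and> z = \<eta>"
    if "z \<in> V" for z \<eta>
  proof (cases "has \<eta>")
    case True
    then obtain s where s: "s \<in> V" "elts s = S \<eta>" unfolding has_iff by blast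
    then have "z = S' \<eta> \<longleftrightarrow> elts z = S \<eta>" unfolding S'_def using True vset_eqI extensionality by metis
    also have "\<dots> \<longleftrightarrow> (\<forall>x\<in>V. x \<in> elts z \<longleftrightarrow> eqv \<eta> (ck x) \<noteq> \<zero>)"
      unfolding S_def using V_elts[OF that] by blast
    finally show ?thesis using True by simp
  qed (simp add: S'_def)
  have hd: "def (\<lambda>e. has (t e))" if "tm t" for t
    by (rule dfn_subst1[where P = has and Q = has, OF _ that], unfold has_def)
      (intro def_rules tm_val_eq tm_ck cr_V zero_closed refl)
  have 1: "def (\<lambda>e. (has (e (Suc 0)) \<and> (\<forall>x\<in>V. x \<in> elts (e 0) \<longleftrightarrow> eqv (e (Suc 0)) (ck x) \<noteq> \<zero>)) \<or>
      \<not> has (e (Suc 0)) \<and> e 0 = e (Suc 0))"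
    by (intro hd def_rules tm_val_eq tm_ck cr_V zero_closed refl)
  have "def (\<lambda>e. e 0 = S' (e (Suc 0)))"
    by (rule dfn_cong[OF 1]; rule S'_iff; rule envsD)
  then have tmS': "dfun S'" using S'V by (intro tm_of_def)
  let ?W = "vset {x \<in> elts (vpow (vset (\<Union>\<eta>\<in>elts (vd \<tau>). elts (S' \<eta>)))). eqv \<tau> (ck x) \<noteq> \<zero>}"
  have "tm (\<lambda>_. vset (\<Union>\<eta>\<in>elts (vd \<tau>). elts (S' \<eta>)))"
    by (intro tm_fun1[OF tmS'] tm_vd def_rules NB_V N refl)
  then have YV: "vset (\<Union>\<eta>\<in>elts (vd \<tau>). elts (S' \<eta>)) \<in> V" by (rule tm_V)
  have "tm (\<lambda>_. ?W)"
    by (intro tm_val_eq tm_ck def_rules NB_V N YV cr_V zero_closed refl)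
  then have "?W \<in> V" by (rule tm_V)
  moreover have "elts ?W = S \<tau>"
  proof -
    have sub: "elts x \<subseteq> (\<Union>\<eta>\<in>vdom \<tau>. elts (S' \<eta>))" if x: "x \<in> V" "eqv \<tau> (ck x) \<noteq> \<zero>" for x
    proof
      fix u assume u: "u \<in> elts x"
      have uV: "u \<in> V" by (rule V_elts[OF x(1) u])
      let ?c = "eqv \<tau> (ck x)"
      have c: "cond ?c" using x eq_closed N by (simp add: cond_def)
      then have "?c \<preceq> memv (ck u) \<tau>"
        using memv_subst_right[OF ck_NB[OF uV] ck_NB[OF x(1)] N c le_mem_ck[OF _ u x(1)]] le_refl[of ?c]
          eqv_sym[of \<tau> "ck x"] by simp
      from memv_condD[OF c this ck_NB[OF uV] N] obtain \<eta> b y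
        where y: "vpair \<eta> b \<in> elts \<tau>" "cond y" "y \<preceq> eqv (ck u) \<eta>" by metis
      have \<eta>: "\<eta> \<in> vdom \<tau>" using y(1) unfolding vdom_def by blast
      have "eqv \<eta> (ck u) \<noteq> \<zero>" using y not_cond_le_zero eqv_sym by metis
      then have "u \<in> S \<eta>" using uV unfolding S_def by blast
      moreover obtain s where s: "s \<in> V" "elts s = S \<eta>" using name.IH[OF \<eta>] unfolding S_def by blast
      moreover have "has \<eta>" "vset (S \<eta>) = s" using s has_iff vset_eqI by blast+
      ultimately have "u \<in> elts (S' \<eta>)" unfolding S'_def by simp
      then show "u \<in> (\<Union>\<eta>\<in>vdom \<tau>. elts (S' \<eta>))" using \<eta> by blast
    qed
    have "elts ?W = {x \<in> V. elts x \<subseteq> (\<Union>\<eta>\<in>elts (vd \<tau>). elts (S' \<eta>)) \<and> eqv \<tau> (ck x) \<noteq> \<zero>}"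
      by (simp only: elts_Collect) (simp only: vpow(2)[OF YV] elts_UN mem_Collect_eq conj_assoc)
    then show ?thesis
      unfolding elts_vd[OF NB_V[OF N]] S_def using sub by blast
  qed
  ultimately show ?case unfolding S_def by blast
qed

lemma supp:
  assumes "\<tau> \<in> NB"
  shows "supp \<tau> \<in> V" "elts (supp \<tau>) = {x \<in> V. eqv \<tau> (ck x) \<noteq> \<zero>}"
  using supp_aux[OF assms] unfolding supp_def by (metis vset_elts)+

lemma suppI: "\<tau> \<in> NB \<Longrightarrow> x \<in> V \<Longrightarrow> cond c \<Longrightarrow> c \<preceq> eqv \<tau> (ck x) \<Longrightarrow> x \<in> elts (supp \<tau>)"
  using supp(2) not_cond_le_zero by fastforce

end

section \<open>The ultrafilter and ground-model names\<close>

locale boolean_ultra = boolean_model +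
  fixes U :: "'a set"
  assumes ultra: "bultrafilter (bord B) U"
begin

lemma U_cr: "a \<in> U \<Longrightarrow> a \<in> cr" and U_zero: "\<zero> \<notin> U" and U_ne: "U \<noteq> {}"
  and U_up: "a \<in> U \<Longrightarrow> b \<in> cr \<Longrightarrow> a \<preceq> b \<Longrightarrow> b \<in> U"
  and U_meet: "a \<in> U \<Longrightarrow> b \<in> U \<Longrightarrow> a \<cdot> b \<in> U"
  and U_neg: "a \<in> cr \<Longrightarrow> a \<in> U \<or> neg a \<in> U"
  using ultra unfolding bultrafilter_def bfilter_def by blast+

lemma U_one: "\<one> \<in> U"
  using U_ne U_up U_cr le_one one_closed by blast

lemma U_force1:
  assumes "a \<in> U" "t \<in> cr" "\<And>x. cond x \<Longrightarrow> x \<preceq> a \<Longrightarrow> \<exists>y. cond y \<and> y \<preceq> x \<and> y \<preceq> t"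
  shows "t \<in> U"
  using U_up[OF assms(1,2)] forcing_le[OF U_cr[OF assms(1)] assms(2,3)] by blast

lemma U_force2:
  assumes "a \<in> U" "b \<in> U" "t \<in> cr"
    "\<And>x. cond x \<Longrightarrow> x \<preceq> a \<Longrightarrow> x \<preceq> b \<Longrightarrow> \<exists>y. cond y \<and> y \<preceq> x \<and> y \<preceq> t"
  shows "t \<in> U"
  by (rule U_force1[OF U_meet[OF assms(1,2)] assms(3)])
    (use assms(4) U_cr[OF assms(1)] U_cr[OF assms(2)] in \<open>simp add: le_meet_iff\<close>)

lemma U_force3:
  assumes "a \<in> U" "b \<in> U" "c \<in> U" "t \<in> cr"
    "\<And>x. cond x \<Longrightarrow> x \<preceq> a \<Longrightarrow> x \<preceq> b \<Longrightarrow> x \<preceq> c \<Longrightarrow> \<exists>y. cond y \<and> y \<preceq> x \<and> y \<preceq> t"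
  shows "t \<in> U"
  by (rule U_force2[OF U_meet[OF assms(1,2)] assms(3,4)])
    (use assms(5) U_cr[OF assms(1)] U_cr[OF assms(2)] in \<open>simp add: le_meet_iff\<close>)

lemma U_cond: "a \<in> U \<Longrightarrow> cond a"
  using U_cr U_zero by (auto simp: cond_def)

lemma dense_refl: "cond x \<Longrightarrow> x \<preceq> t \<Longrightarrow> \<exists>y. cond y \<and> y \<preceq> x \<and> y \<preceq> t"
  using le_refl cond_cr by blast

text \<open>Names that are forced by a member of \<open>U\<close> to lie in the ground model.\<close>

definition GN :: "'a set" where
  "GN = {\<tau> \<in> NB. val_ground V B \<tau> \<in> U}"

abbreviation E :: "'a \<Rightarrow> 'a \<Rightarrow> bool" where "E \<tau> \<sigma> \<equiv> memv \<tau> \<sigma> \<in> U"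
abbreviation Q :: "'a \<Rightarrow> 'a \<Rightarrow> bool" where "Q \<tau> \<sigma> \<equiv> eqv \<tau> \<sigma> \<in> U"

lemma GN_NB: "\<tau> \<in> GN \<Longrightarrow> \<tau> \<in> NB" by (simp add: GN_def)

lemma val_ground_inV:
  assumes "\<tau> \<in> NB"
  shows "inV ((\<lambda>x. eqv \<tau> (ck x)) ` V)"
  by (rule inV_of_def, unfold image_iff) (intro def_rules tm_val_eq tm_ck NB_V assms refl)

lemma val_ground_closed: "\<tau> \<in> NB \<Longrightarrow> val_ground V B \<tau> \<in> cr"
  unfolding val_ground_def by (intro bsup_closed val_ground_inV)

lemma val_ground_cond:
  assumes "\<tau> \<in> NB" "cond x" "x \<preceq> val_ground V B \<tau>"
  obtains a y where "a \<in> V" "cond y" "y \<preceq> x" "y \<preceq> eqv \<tau> (ck a)"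
  using bsup_cond[OF val_ground_inV[OF assms(1)] assms(2)] assms(3) unfolding val_ground_def by blast

lemma GN_cond:
  assumes "\<tau> \<in> GN" "cond x" "x \<preceq> val_ground V B \<tau>"
  obtains a y where "a \<in> elts (supp \<tau>)" "cond y" "y \<preceq> x" "y \<preceq> eqv \<tau> (ck a)"
  using val_ground_cond[OF GN_NB[OF assms(1)] assms(2,3)] suppI[OF GN_NB[OF assms(1)]] by metis

lemma GN_U: "\<tau> \<in> GN \<Longrightarrow> val_ground V B \<tau> \<in> U" by (simp add: GN_def)

lemma le_val_ground:
  assumes "\<tau> \<in> NB" "a \<in> V" "x \<in> cr" "x \<preceq> eqv \<tau> (ck a)"
  shows "x \<preceq> val_ground V B \<tau>"
  unfolding val_ground_def
  by (rule cond_le_bsup[OF val_ground_inV[OF assms(1)] assms(3) _ _ assms(4)])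
    (use assms eq_closed in auto)

lemma ck_GN: "c \<in> V \<Longrightarrow> ck c \<in> GN"
proof -
  assume c: "c \<in> V"
  have "\<one> \<preceq> val_ground V B (ck c)"
    using le_val_ground[OF ck_NB[OF c] c, of \<one>] eqv_refl[of \<one> "ck c"] c by simp
  then show ?thesis
    using U_up[OF U_one val_ground_closed[OF ck_NB[OF c]]] ck_NB[OF c] by (simp add: GN_def)
qed

lemma Q_refl: "\<tau> \<in> NB \<Longrightarrow> Q \<tau> \<tau>"
  by (rule U_up[OF U_one]) (auto intro: eq_closed eqv_refl)

lemma Q_sym: "Q \<tau> \<sigma> \<Longrightarrow> Q \<sigma> \<tau>"
  by (simp add: eqv_sym)

lemma E_Q_left:
  assumes "E \<tau> \<sigma>" "Q \<tau> \<tau>'" and N: "\<tau> \<in> NB" "\<tau>' \<in> NB" "\<sigma> \<in> NB"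
  shows "E \<tau>' \<sigma>"
  by (rule U_force2[OF assms(1,2) mem_closed[OF NB_V[OF N(2)] NB_V[OF N(3)]]], rule dense_refl, assumption,
      rule memv_subst_left[OF N])

lemma E_Q_right:
  assumes "E \<tau> \<sigma>" "Q \<sigma> \<sigma>'" and N: "\<tau> \<in> NB" "\<sigma> \<in> NB" "\<sigma>' \<in> NB"
  shows "E \<tau> \<sigma>'"
  by (rule U_force2[OF assms(1,2) mem_closed[OF NB_V[OF N(1)] NB_V[OF N(3)]]], rule dense_refl, assumption,
      rule memv_subst_right[OF N])

text \<open>Well-foundedness of the structure of classes is well-foundedness of \<open>E\<close> on names.\<close>

lemma name_class_ne:
  assumes "\<tau> \<in> NB"
  shows "name_class V B U \<tau> \<noteq> {}"
proof -
  obtain \<sigma> where "\<sigma> \<in> NB \<and> Q \<sigma> \<tau>" "\<And>\<rho>. \<rho> \<in> NB \<and> Q \<rho> \<tau> \<Longrightarrow> elts (vrank \<sigma>) \<subseteq> elts (vrank \<rho>)"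
    using ex_min_vrank[of "\<lambda>\<sigma>. \<sigma> \<in> NB \<and> Q \<sigma> \<tau>"] assms Q_refl by blast
  then have "\<sigma> \<in> name_class V B U \<tau>" unfolding name_class_def by blast
  then show ?thesis by blast
qed

lemma ultrapower_mem_iff:
  assumes "\<tau> \<in> NB" "\<sigma> \<in> NB"
  shows "ultrapower_mem B U (name_class V B U \<tau>) (name_class V B U \<sigma>) \<longleftrightarrow> E \<tau> \<sigma>"
proof
  assume "ultrapower_mem B U (name_class V B U \<tau>) (name_class V B U \<sigma>)"
  then obtain \<tau>' \<sigma>' where *: "\<tau>' \<in> NB" "Q \<tau>' \<tau>" "\<sigma>' \<in> NB" "Q \<sigma>' \<sigma>" "E \<tau>' \<sigma>'"
    unfolding ultrapower_mem_def name_class_def by blast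
  show "E \<tau> \<sigma>" by (rule E_Q_right[OF E_Q_left[OF *(5,2)] *(4)]) (use * assms in auto)
next
  assume E: "E \<tau> \<sigma>"
  obtain \<tau>' \<sigma>' where *: "\<tau>' \<in> name_class V B U \<tau>" "\<sigma>' \<in> name_class V B U \<sigma>"
    using name_class_ne assms by blast
  then have **: "\<tau>' \<in> NB" "Q \<tau>' \<tau>" "\<sigma>' \<in> NB" "Q \<sigma>' \<sigma>" unfolding name_class_def by blast+
  have "E \<tau>' \<sigma>'" by (rule E_Q_right[OF E_Q_left[OF E Q_sym[OF **(2)]] Q_sym[OF **(4)]]) (use ** assms in auto)
  then show "ultrapower_mem B U (name_class V B U \<tau>) (name_class V B U \<sigma>)"
    unfolding ultrapower_mem_def using * by blast
qed

lemma wfp_on_ultrapower_iff: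
  "wfp_on (boolean_ultrapower V B U) (ultrapower_mem B U) \<longleftrightarrow> wfp_on GN E"
proof -
  have "boolean_ultrapower V B U = name_class V B U ` GN"
    unfolding boolean_ultrapower_def GN_def by blast
  then have "wfp_on (boolean_ultrapower V B U) (ultrapower_mem B U) \<longleftrightarrow>
      wfp_on GN (\<lambda>\<tau> \<sigma>. ultrapower_mem B U (name_class V B U \<tau>) (name_class V B U \<sigma>))"
    by (simp add: wfp_on_image)
  also have "\<dots> \<longleftrightarrow> wfp_on GN E"
    unfolding wfp_on_def by (simp add: ultrapower_mem_iff GN_NB)
  finally show ?thesis .
qed


section \<open>Weights\<close>

text \<open>
  A weight is a partition of unity modulo \<open>U\<close>, indexed by a set of the ground model.  A name \<open>\<tau>\<close>
  in \<open>GN\<close> is represented over a weight \<open>p\<close> by a function \<open>f\<close> of the ground model if, almost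
  everywhere, \<open>p x\<close> forces \<open>\<tau>\<close> to be \<open>f x\<close>.
\<close>

definition AA :: "('a \<Rightarrow> 'a) \<Rightarrow> 'a \<Rightarrow> ('a \<Rightarrow> bool) \<Rightarrow> bool" where
  "AA p X P \<longleftrightarrow> bsup {u. \<exists>x\<in>elts X. P x \<and> u = p x} \<in> U"

definition weight :: "('a \<Rightarrow> 'a) \<Rightarrow> 'a \<Rightarrow> bool" where
  "weight p X \<longleftrightarrow> dfun p \<and> X \<in> V \<and> (\<forall>x\<in>elts X. p x \<in> cr) \<and>
     (\<forall>x\<in>elts X. \<forall>y\<in>elts X. \<forall>c. cond c \<and> c \<preceq> p x \<and> c \<preceq> p y \<longrightarrow> x = y) \<and> AA p X (\<lambda>_. True)"

definition Rep :: "('a \<Rightarrow> 'a) \<Rightarrow> 'a \<Rightarrow> ('a \<Rightarrow> 'a) \<Rightarrow> 'a \<Rightarrow> bool" where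
  "Rep p X f \<tau> \<longleftrightarrow> bsup {u. \<exists>x\<in>elts X. u = p x \<cdot> eqv \<tau> (ck (f x))} \<in> U"

lemma weightD:
  assumes "weight p X"
  shows "dfun p" "X \<in> V" "\<And>x. x \<in> elts X \<Longrightarrow> p x \<in> cr"
    "\<And>x y c. x \<in> elts X \<Longrightarrow> y \<in> elts X \<Longrightarrow> cond c \<Longrightarrow> c \<preceq> p x \<Longrightarrow> c \<preceq> p y \<Longrightarrow> x = y"
    "AA p X (\<lambda>_. True)"
  using assms unfolding weight_def by blast+

abbreviation "jv p X P \<equiv> bsup {u. \<exists>x\<in>elts X. P x \<and> u = p x}"

lemma AA_inV:
  assumes "dfun p" "X \<in> V" "dpred P"
  shows "inV {u. \<exists>x\<in>elts X. P x \<and> u = p x}"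
  by (rule inV_of_def, unfold mem_Collect_eq)
    (intro def_rules dfn_subst1[OF assms(3)] tm_fun1[OF assms(1)] assms(2) refl)

lemma def_True: "def (\<lambda>_. True)"
  by (rule dfn_cong[OF dfn_var_Eq[of 0 0]]) simp_all

lemma jv_closed: "weight p X \<Longrightarrow> dpred P \<Longrightarrow> jv p X P \<in> cr"
  by (intro bsup_closed AA_inV weightD)

lemma jv_cond:
  assumes "weight p X" "dpred P" "cond x" "x \<preceq> jv p X P"
  obtains z y where "z \<in> elts X" "P z" "cond y" "y \<preceq> x" "y \<preceq> p z"
  using bsup_cond[OF AA_inV[OF weightD(1,2)[OF assms(1)] assms(2)] assms(3,4)] by blast

lemma le_jv:
  assumes "weight p X" "dpred P" "z \<in> elts X" "P z" "x \<in> cr" "x \<preceq> p z"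
  shows "x \<preceq> jv p X P"
  by (rule cond_le_bsup[OF AA_inV[OF weightD(1,2)[OF assms(1)] assms(2)] assms(5) _ _ assms(6)])
    (use assms weightD(3)[OF assms(1)] in auto)

lemma jv_at:
  assumes w: "weight p X" and d: "dpred P" and y: "z \<in> elts X" "cond y" "y \<preceq> p z" "y \<preceq> jv p X P"
  shows "P z"
proof -
  from jv_cond[OF w d y(2,4)] obtain z' y' where y': "z' \<in> elts X" "P z'" "cond y'" "y' \<preceq> y" "y' \<preceq> p z'" .
  have "y' \<preceq> p z" using cle[OF y'(3,4) y(3)] y weightD(3)[OF w] by simp
  then show ?thesis using weightD(4)[OF w y(1) y'(1,3)] y' by blast
qed

text \<open>
  \<open>AA p X\<close> is an ultrafilter on the definable subsets of \<open>X\<close>, as the next three lemmas show.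
\<close>

lemma AA_mono:
  assumes w: "weight p X" and d: "dpred P" "dpred P'" and P: "AA p X P"
    and imp: "\<And>x. x \<in> elts X \<Longrightarrow> P x \<Longrightarrow> P' x"
  shows "AA p X P'"
  unfolding AA_def
proof (rule U_force1[OF P[unfolded AA_def] jv_closed[OF w d(2)]])
  fix x assume "cond x" "x \<preceq> jv p X P"
  from jv_cond[OF w d(1) this] obtain z y where y: "z \<in> elts X" "P z" "cond y" "y \<preceq> x" "y \<preceq> p z" .
  then show "\<exists>y. cond y \<and> y \<preceq> x \<and> y \<preceq> jv p X P'"
    using le_jv[OF w d(2) y(1) imp[OF y(1,2)] cond_cr[OF y(3)] y(5)] by blast
qed

lemma AA_conj:
  assumes w: "weight p X" and d: "dpred P" "dpred P'"
  shows "AA p X (\<lambda>x. P x \<and> P' x) \<longleftrightarrow> AA p X P \<and> AA p X P'"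
proof
  assume "AA p X (\<lambda>x. P x \<and> P' x)"
  then show "AA p X P \<and> AA p X P'"
    using AA_mono[OF w dfn_Conj[OF d] d(1)] AA_mono[OF w dfn_Conj[OF d] d(2)] by blast
next
  assume *: "AA p X P \<and> AA p X P'"
  show "AA p X (\<lambda>x. P x \<and> P' x)"
    unfolding AA_def
  proof (rule U_force2[OF *[THEN conjunct1, unfolded AA_def] *[THEN conjunct2, unfolded AA_def] jv_closed[OF w dfn_Conj[OF d]]])
    fix x assume x: "cond x" "x \<preceq> jv p X P" "x \<preceq> jv p X P'"
    from jv_cond[OF w d(1) x(1,2)] obtain z y where y: "z \<in> elts X" "P z" "cond y" "y \<preceq> x" "y \<preceq> p z" .
    have "y \<preceq> jv p X P'" using cle[OF y(3,4) x(3)] x(1) jv_closed[OF w d(2)] by simp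
    from jv_cond[OF w d(2) y(3) this] obtain z' y' where
      y': "z' \<in> elts X" "P' z'" "cond y'" "y' \<preceq> y" "y' \<preceq> p z'" .
    have yz: "y' \<preceq> p z" using cle[OF y'(3,4) y(5)] y weightD(3)[OF w] by simp
    then have "z = z'" using weightD(4)[OF w y(1) y'(1,3)] y' by blast
    then have "y' \<preceq> jv p X (\<lambda>x. P x \<and> P' x)"
      using le_jv[OF w dfn_Conj[OF d] y(1) _ cond_cr[OF y'(3)] yz] y y' by blast
    moreover have "y' \<preceq> x" using le_tr[of y' y x] y y' x by simp
    ultimately show "\<exists>y. cond y \<and> y \<preceq> x \<and> y \<preceq> jv p X (\<lambda>x. P x \<and> P' x)" using y' by blast
  qed
qed

lemma AA_not:
  assumes w: "weight p X" and d: "dpred P"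
  shows "AA p X (\<lambda>x. \<not> P x) \<longleftrightarrow> \<not> AA p X P"
proof
  assume *: "AA p X (\<lambda>x. \<not> P x)"
  show "\<not> AA p X P"
  proof
    assume "AA p X P"
    with * have "jv p X (\<lambda>x. \<not> P x \<and> P x) \<in> U"
      using AA_conj[OF w dfn_Neg[OF d] d] unfolding AA_def by blast
    then have "cond (jv p X (\<lambda>x. \<not> P x \<and> P x))" by (rule U_cond)
    then show False
      by (rule jv_cond[OF w dfn_Conj[OF dfn_Neg[OF d] d]]) (use le_refl jv_closed[OF w dfn_Conj[OF dfn_Neg[OF d] d]] in auto)
  qed
next
  assume "\<not> AA p X P"
  then have n: "neg (jv p X P) \<in> U" using U_neg jv_closed[OF w d] unfolding AA_def by blast
  show "AA p X (\<lambda>x. \<not> P x)"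
    unfolding AA_def
  proof (rule U_force2[OF n weightD(5)[OF w, unfolded AA_def] jv_closed[OF w dfn_Neg[OF d]]])
    fix x assume x: "cond x" "x \<preceq> neg (jv p X P)" "x \<preceq> jv p X (\<lambda>_. True)"
    from jv_cond[OF w def_True x(1,3)] obtain z y where y: "z \<in> elts X" "cond y" "y \<preceq> x" "y \<preceq> p z" by metis
    have "\<not> y \<preceq> jv p X P" using x le_neg_iff[OF jv_closed[OF w d], of x] y by simp
    then have "\<not> P z" using le_jv[OF w d y(1) _ cond_cr[OF y(2)] y(4)] by blast
    then have "y \<preceq> jv p X (\<lambda>x. \<not> P x)" using le_jv[OF w dfn_Neg[OF d] y(1) _ cond_cr[OF y(2)] y(4)] by blast
    then show "\<exists>y. cond y \<and> y \<preceq> x \<and> y \<preceq> jv p X (\<lambda>x. \<not> P x)" using y by blast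
  qed
qed

lemma Rep_inV:
  assumes "weight p X" "dfun f" "\<tau> \<in> NB"
  shows "inV {u. \<exists>x\<in>elts X. u = p x \<cdot> eqv \<tau> (ck (f x))}"
  by (rule inV_of_def, unfold mem_Collect_eq)
    (intro def_rules tm_meet tm_val_eq tm_ck tm_fun1[OF assms(2)] tm_fun1[OF weightD(1)[OF assms(1)]]
      weightD(2)[OF assms(1)] NB_V assms(3) refl)

abbreviation "rv p X f \<tau> \<equiv> bsup {u. \<exists>x\<in>elts X. u = p x \<cdot> eqv \<tau> (ck (f x))}"

lemma rv_closed: "weight p X \<Longrightarrow> dfun f \<Longrightarrow> \<tau> \<in> NB \<Longrightarrow> rv p X f \<tau> \<in> cr"
  by (intro bsup_closed Rep_inV)

lemma weight_V: "weight p X \<Longrightarrow> x \<in> elts X \<Longrightarrow> x \<in> V"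
  by (rule V_elts[OF weightD(2)])

lemma weight_fV: "weight p X \<Longrightarrow> dfun f \<Longrightarrow> x \<in> elts X \<Longrightarrow> f x \<in> V"
  by (rule tm_closed1[OF _ weight_V])

lemma rv_cond:
  assumes "weight p X" "dfun f" "\<tau> \<in> NB" "cond x" "x \<preceq> rv p X f \<tau>"
  obtains z y where "z \<in> elts X" "cond y" "y \<preceq> x" "y \<preceq> p z" "y \<preceq> eqv \<tau> (ck (f z))"
proof -
  obtain z y where z: "z \<in> elts X" "cond y" "y \<preceq> x" "y \<preceq> p z \<cdot> eqv \<tau> (ck (f z))"
    using bsup_cond[OF Rep_inV[OF assms(1-3)] assms(4,5)] by blast
  moreover have "eqv \<tau> (ck (f z)) \<in> cr"
    by (rule eq_closed[OF NB_V[OF assms(3)] ck_V[OF weight_fV[OF assms(1,2) z(1)]]])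
  ultimately show ?thesis using that le_meet_iff weightD(3)[OF assms(1) z(1)] by simp
qed

lemma le_rv:
  assumes "weight p X" "dfun f" "\<tau> \<in> NB" "z \<in> elts X" "x \<in> cr" "x \<preceq> p z" "x \<preceq> eqv \<tau> (ck (f z))"
  shows "x \<preceq> rv p X f \<tau>"
proof -
  have c: "eqv \<tau> (ck (f z)) \<in> cr" "p z \<in> cr"
    using eq_closed[OF NB_V[OF assms(3)] ck_V[OF weight_fV[OF assms(1,2,4)]]] weightD(3)[OF assms(1,4)] by auto
  show ?thesis
    by (rule cond_le_bsup[OF Rep_inV[OF assms(1-3)] assms(5), of "p z \<cdot> eqv \<tau> (ck (f z))"])
      (use c assms le_meet_iff in auto)
qed

lemma Rep_mixture:
  assumes w: "weight p X" and f: "dfun f"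
  shows "mixture p X f \<in> GN" "Rep p X f (mixture p X f)"
proof -
  let ?m = "mixture p X f"
  note N = mixture_NB[OF weightD(1)[OF w] f weightD(2,3)[OF w]]
  have eq: "c \<preceq> eqv ?m (ck (f x))" if "x \<in> elts X" "cond c" "c \<preceq> p x" for x c
    by (rule mixture_eqv[OF weightD(1,3)[OF w] f weightD(2)[OF w] _ that])
      (assumption, rule arg_cong[where f = f], rule weightD(4)[OF w])
  show R: "Rep p X f ?m"
    unfolding Rep_def
  proof (rule U_force1[OF weightD(5)[OF w, unfolded AA_def] rv_closed[OF w f N]])
    fix x assume "cond x" "x \<preceq> jv p X (\<lambda>_. True)"
    from jv_cond[OF w def_True this] obtain z y where y: "z \<in> elts X" "cond y" "y \<preceq> x" "y \<preceq> p z" by metis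
    then show "\<exists>y. cond y \<and> y \<preceq> x \<and> y \<preceq> rv p X f ?m"
      using le_rv[OF w f N y(1) cond_cr[OF y(2)] y(4) eq[OF y(1,2,4)]] by blast
  qed
  have "val_ground V B ?m \<in> U"
  proof (rule U_force1[OF R[unfolded Rep_def] val_ground_closed[OF N]])
    fix x assume "cond x" "x \<preceq> rv p X f ?m"
    from rv_cond[OF w f N this] obtain z y where
      y: "z \<in> elts X" "cond y" "y \<preceq> x" "y \<preceq> p z" "y \<preceq> eqv ?m (ck (f z))" .
    then show "\<exists>y. cond y \<and> y \<preceq> x \<and> y \<preceq> val_ground V B ?m"
      using le_val_ground[OF N weight_fV[OF w f y(1)] cond_cr[OF y(2)] y(5)] by blast
  qed
  then show "?m \<in> GN" using N by (simp add: GN_def)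
qed

text \<open>
  A condition below both representing values decides the point of the index set and with it the
  values of both names.
\<close>

lemma rv_cond2:
  assumes w: "weight p X" and f: "dfun f" "dfun g" and N: "\<tau> \<in> NB" "\<sigma> \<in> NB"
    and x: "cond x" "x \<preceq> rv p X f \<tau>" "x \<preceq> rv p X g \<sigma>"
  obtains z y where "z \<in> elts X" "cond y" "y \<preceq> x" "y \<preceq> p z" "y \<preceq> eqv \<tau> (ck (f z))" "y \<preceq> eqv \<sigma> (ck (g z))"
proof -
  from rv_cond[OF w f(1) N(1) x(1,2)] obtain z y where
    y: "z \<in> elts X" "cond y" "y \<preceq> x" "y \<preceq> p z" "y \<preceq> eqv \<tau> (ck (f z))" .
  have "y \<preceq> rv p X g \<sigma>" using cle[OF y(2,3) x(3)] x(1) rv_closed[OF w f(2) N(2)] by simp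
  from rv_cond[OF w f(2) N(2) y(2) this] obtain z' y' where
    y': "z' \<in> elts X" "cond y'" "y' \<preceq> y" "y' \<preceq> p z'" "y' \<preceq> eqv \<sigma> (ck (g z'))" .
  have pz: "y' \<preceq> p z" using cle[OF y'(2,3) y(4)] y weightD(3)[OF w] by simp
  then have "z = z'" using weightD(4)[OF w y(1) y'(1,2)] y' by blast
  moreover have "y' \<preceq> eqv \<tau> (ck (f z))"
    using cle[OF y'(2,3) y(5)] y eq_closed[OF NB_V[OF N(1)] ck_V[OF weight_fV[OF w f(1) y(1)]]] by simp
  moreover have "y' \<preceq> x" using le_tr[of y' y x] y y' x by simp
  ultimately show ?thesis using that[of z y'] y y' pz by simp
qed

text \<open>
  Below both representing values there are densely many conditions that decide the point \<open>z\<close> and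
  the values \<open>f z\<close> and \<open>g z\<close> of the two names.  If these values settle the statement with Boolean
  value \<open>v\<close> as \<open>P\<close> says, then \<open>v\<close> and the join over \<open>P\<close> are equal modulo \<open>U\<close>.
\<close>

lemma Rep_decide:
  assumes w: "weight p X" and f: "dfun f" "dfun g" and N: "\<tau> \<in> NB" "\<sigma> \<in> NB"
    and R: "Rep p X f \<tau>" "Rep p X g \<sigma>" and d: "dpred P" and v: "v \<in> cr"
    and dec: "\<And>z y. z \<in> elts X \<Longrightarrow> cond y \<Longrightarrow> y \<preceq> eqv \<tau> (ck (f z)) \<Longrightarrow> y \<preceq> eqv \<sigma> (ck (g z)) \<Longrightarrow>
      y \<preceq> v \<longleftrightarrow> P z"
  shows "v \<in> U \<longleftrightarrow> AA p X P"
proof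
  note R' = R[unfolded Rep_def]
  assume vU: "v \<in> U"
  show "AA p X P"
    unfolding AA_def
  proof (rule U_force3[OF R' vU jv_closed[OF w d]])
    fix x assume x: "cond x" "x \<preceq> rv p X f \<tau>" "x \<preceq> rv p X g \<sigma>" "x \<preceq> v"
    from rv_cond2[OF w f N x(1-3)] obtain z y where y: "z \<in> elts X" "cond y" "y \<preceq> x" "y \<preceq> p z"
      "y \<preceq> eqv \<tau> (ck (f z))" "y \<preceq> eqv \<sigma> (ck (g z))" .
    have "P z" using dec[OF y(1,2,5,6)] cle[OF y(2,3) x(4)] x(1) v by simp
    then show "\<exists>y. cond y \<and> y \<preceq> x \<and> y \<preceq> jv p X P"
      using le_jv[OF w d y(1) _ cond_cr[OF y(2)] y(4)] y by blast
  qed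
next
  note R' = R[unfolded Rep_def]
  assume "AA p X P"
  then have AA: "jv p X P \<in> U" unfolding AA_def .
  show "v \<in> U"
  proof (rule U_force3[OF R' AA v])
    fix x assume x: "cond x" "x \<preceq> rv p X f \<tau>" "x \<preceq> rv p X g \<sigma>" "x \<preceq> jv p X P"
    from rv_cond2[OF w f N x(1-3)] obtain z y where y: "z \<in> elts X" "cond y" "y \<preceq> x" "y \<preceq> p z"
      "y \<preceq> eqv \<tau> (ck (f z))" "y \<preceq> eqv \<sigma> (ck (g z))" .
    have "y \<preceq> jv p X P" using cle[OF y(2,3) x(4)] x(1) jv_closed[OF w d] by simp
    then have "y \<preceq> v" using jv_at[OF w d y(1,2,4)] dec[OF y(1,2,5,6)] by blast
    then show "\<exists>y. cond y \<and> y \<preceq> x \<and> y \<preceq> v" using y by blast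
  qed
qed

lemma Rep_mem_iff:
  assumes w: "weight p X" and f: "dfun f" "dfun g" and N: "\<tau> \<in> NB" "\<sigma> \<in> NB"
    and R: "Rep p X f \<tau>" "Rep p X g \<sigma>"
  shows "E \<tau> \<sigma> \<longleftrightarrow> AA p X (\<lambda>x. f x \<in> elts (g x))"
proof (rule Rep_decide[OF w f N R _ mem_closed[OF NB_V[OF N(1)] NB_V[OF N(2)]]])
  show "def (\<lambda>e. f (e 0) \<in> elts (g (e 0)))" by (intro def_rules tm_fun1[OF f(1)] tm_fun1[OF f(2)])
  fix z y assume z: "z \<in> elts X" and y: "cond y" "y \<preceq> eqv \<tau> (ck (f z))" "y \<preceq> eqv \<sigma> (ck (g z))"
  note fz = weight_fV[OF w f(1) z] and gz = weight_fV[OF w f(2) z]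
  note fN = ck_NB[OF fz] and gN = ck_NB[OF gz]
  show "y \<preceq> memv \<tau> \<sigma> \<longleftrightarrow> f z \<in> elts (g z)"
  proof
    assume "y \<preceq> memv \<tau> \<sigma>"
    then have "y \<preceq> memv (ck (f z)) \<sigma>" by (rule memv_subst_left[OF N(1) fN N(2) y(1) _ y(2)])
    then have "y \<preceq> memv (ck (f z)) (ck (g z))" by (rule memv_subst_right[OF fN N(2) gN y(1) _ y(3)])
    then show "f z \<in> elts (g z)" by (rule memv_ckD[OF y(1) _ fz gz])
  next
    assume "f z \<in> elts (g z)"
    then have "y \<preceq> memv (ck (f z)) (ck (g z))" using le_mem_ck[OF cond_cr[OF y(1)] _ gz] by simp
    then have "y \<preceq> memv \<tau> (ck (g z))" using memv_subst_left[OF fN N(1) gN y(1)] y(2) eqv_sym by simp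
    then show "y \<preceq> memv \<tau> \<sigma>" using memv_subst_right[OF N(1) gN N(2) y(1)] y(3) eqv_sym by simp
  qed
qed

lemma Rep_eq_iff:
  assumes w: "weight p X" and f: "dfun f" "dfun g" and N: "\<tau> \<in> NB" "\<sigma> \<in> NB"
    and R: "Rep p X f \<tau>" "Rep p X g \<sigma>"
  shows "Q \<tau> \<sigma> \<longleftrightarrow> AA p X (\<lambda>x. f x = g x)"
proof (rule Rep_decide[OF w f N R _ eq_closed[OF NB_V[OF N(1)] NB_V[OF N(2)]]])
  show "def (\<lambda>e. f (e 0) = g (e 0))" by (intro def_rules tm_fun1[OF f(1)] tm_fun1[OF f(2)])
  fix z y assume z: "z \<in> elts X" and y: "cond y" "y \<preceq> eqv \<tau> (ck (f z))" "y \<preceq> eqv \<sigma> (ck (g z))"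
  note fz = weight_fV[OF w f(1) z] and gz = weight_fV[OF w f(2) z]
  show "y \<preceq> eqv \<tau> \<sigma> \<longleftrightarrow> f z = g z"
  proof
    assume "y \<preceq> eqv \<tau> \<sigma>"
    then have "y \<preceq> eqv \<tau> (ck (g z))" by (rule eqv_trans[OF N ck_NB[OF gz] y(1) _ y(3)])
    then show "f z = g z" by (rule eqv_ck_unique[OF y(1) N(1) fz gz y(2)])
  next
    assume "f z = g z"
    then show "y \<preceq> eqv \<tau> \<sigma>"
      using eqv_trans[OF N(1) ck_NB[OF fz] N(2) y(1,2)] y(3) eqv_sym by simp
  qed
qed

text \<open>Every name in \<open>GN\<close> is represented over the weight given by its own values.\<close>

lemma tm_id: "tm (\<lambda>e. (\<lambda>x. x) (e 0))"
  by (rule trm_var)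

lemma weight_values:
  assumes N: "\<tau> \<in> NB" and W: "W \<in> V" and a: "a \<in> U"
    and dense: "\<And>x. cond x \<Longrightarrow> x \<preceq> a \<Longrightarrow> \<exists>w\<in>elts W. \<exists>y. cond y \<and> y \<preceq> x \<and> y \<preceq> eqv \<tau> (ck w)"
  shows "weight (\<lambda>w. eqv \<tau> (ck w)) W" "Rep (\<lambda>w. eqv \<tau> (ck w)) W (\<lambda>x. x) \<tau>"
proof -
  let ?h = "\<lambda>w. eqv \<tau> (ck w)"
  have t: "dfun ?h" by (intro tm_val_eq tm_ck def_rules NB_V N refl)
  have iV: "inV {u. \<exists>w\<in>elts W. True \<and> u = ?h w}" by (rule AA_inV[OF t W def_True])
  have c: "\<forall>w\<in>elts W. ?h w \<in> cr" using V_elts[OF W] eq_closed N by simp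
  have "AA ?h W (\<lambda>_. True)"
    unfolding AA_def
  proof (rule U_force1[OF a bsup_closed[OF iV]])
    fix x assume "cond x" "x \<preceq> a"
    from dense[OF this] obtain w y where y: "w \<in> elts W" "cond y" "y \<preceq> x" "y \<preceq> ?h w" by blast
    have "y \<preceq> bsup {u. \<exists>w\<in>elts W. True \<and> u = ?h w}"
      by (rule cond_le_bsup[OF iV cond_cr[OF y(2)] _ _ y(4)]) (use y c in auto)
    then show "\<exists>y. cond y \<and> y \<preceq> x \<and> y \<preceq> bsup {u. \<exists>w\<in>elts W. True \<and> u = ?h w}"
      using y by blast
  qed
  moreover have "\<forall>a\<in>elts W. \<forall>b\<in>elts W. \<forall>c. cond c \<and> c \<preceq> ?h a \<and> c \<preceq> ?h b \<longrightarrow> a = b"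
    using eqv_ck_unique[OF _ N] V_elts[OF W] by blast
  ultimately show w: "weight ?h W" unfolding weight_def using t W c by blast
  show "Rep ?h W (\<lambda>x. x) \<tau>"
    unfolding Rep_def
  proof (rule U_force1[OF a rv_closed[OF w tm_id N]])
    fix x assume "cond x" "x \<preceq> a"
    from dense[OF this] obtain z y where y: "z \<in> elts W" "cond y" "y \<preceq> x" "y \<preceq> ?h z" by blast
    then show "\<exists>y. cond y \<and> y \<preceq> x \<and> y \<preceq> rv ?h W (\<lambda>x. x) \<tau>"
      using le_rv[OF w tm_id N y(1) cond_cr[OF y(2)] y(4) y(4)] by blast
  qed
qed

lemma weight_self:
  assumes "\<tau> \<in> GN"
  shows "weight (\<lambda>w. eqv \<tau> (ck w)) (supp \<tau>)" "Rep (\<lambda>w. eqv \<tau> (ck w)) (supp \<tau>) (\<lambda>x. x) \<tau>"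
proof -
  have dense: "\<exists>w\<in>elts (supp \<tau>). \<exists>y. cond y \<and> y \<preceq> x \<and> y \<preceq> eqv \<tau> (ck w)"
    if x: "cond x" "x \<preceq> val_ground V B \<tau>" for x
  proof -
    from GN_cond[OF assms x] obtain a y where "a \<in> elts (supp \<tau>)" "cond y" "y \<preceq> x" "y \<preceq> eqv \<tau> (ck a)" .
    then show ?thesis by blast
  qed
  note w = weight_values[OF GN_NB[OF assms] supp(1)[OF GN_NB[OF assms]] GN_U[OF assms] dense]
  show "weight (\<lambda>w. eqv \<tau> (ck w)) (supp \<tau>)" "Rep (\<lambda>w. eqv \<tau> (ck w)) (supp \<tau>) (\<lambda>x. x) \<tau>"
    by (rule w; assumption)+
qed

text \<open>
  Two weights have a common refinement, on the product of the index sets.  Names that are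
  represented over different weights can thus be represented over one.
\<close>

definition prodV :: "'a \<Rightarrow> 'a \<Rightarrow> 'a" where
  "prodV X Y = vset (\<Union>x\<in>elts X. elts (vset ((\<lambda>y. vpair x y) ` elts Y)))"

lemma elts_prodV: "elts (prodV X Y) = {vpair x y |x y. x \<in> elts X \<and> y \<in> elts Y}"
proof -
  have "elts (prodV X Y) = (\<Union>x\<in>elts X. (\<lambda>y. vpair x y) ` elts Y)"
    unfolding prodV_def by (simp only: elts_UN) (simp only: elts_image)
  then show ?thesis by blast
qed

lemma vpair_prodV: "vpair x y \<in> elts (prodV X Y) \<longleftrightarrow> x \<in> elts X \<and> y \<in> elts Y"
  by (simp add: elts_prodV)

abbreviation wprod :: "('a \<Rightarrow> 'a) \<Rightarrow> ('a \<Rightarrow> 'a) \<Rightarrow> 'a \<Rightarrow> 'a" where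
  "wprod p q \<equiv> (\<lambda>z. p (vfst0 z) \<cdot> q (vsnd0 z))"

lemma wprod:
  assumes w: "weight p X" and v: "weight q Y"
  shows weight_wprod: "weight (wprod p q) (prodV X Y)"
    and AA_fst: "\<And>P. dpred P \<Longrightarrow> AA p X P \<Longrightarrow> AA (wprod p q) (prodV X Y) (\<lambda>z. P (vfst0 z))"
    and Rep_fst: "\<And>f \<tau>. dfun f \<Longrightarrow> \<tau> \<in> NB \<Longrightarrow> Rep p X f \<tau> \<Longrightarrow>
      Rep (wprod p q) (prodV X Y) (\<lambda>z. f (vfst0 z)) \<tau>"
    and Rep_snd: "\<And>f \<tau>. dfun f \<Longrightarrow> \<tau> \<in> NB \<Longrightarrow> Rep q Y f \<tau> \<Longrightarrow>
      Rep (wprod p q) (prodV X Y) (\<lambda>z. f (vsnd0 z)) \<tau>"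
proof -
  let ?r = "wprod p q" and ?Z = "prodV X Y"
  have t: "dfun ?r"
    by (intro tm_meet tm_fun1[OF weightD(1)[OF w]] tm_fun1[OF weightD(1)[OF v]] tm_vfst0 tm_vsnd0 trm_var)
  have "tm (\<lambda>_. ?Z)"
    unfolding prodV_def by (intro def_rules weightD(2)[OF w] weightD(2)[OF v] refl)
  then have ZV: "?Z \<in> V" by (rule tm_V)
  have c: "p x \<cdot> q y \<in> cr" if "x \<in> elts X" "y \<in> elts Y" for x y
    using weightD(3)[OF w that(1)] weightD(3)[OF v that(2)] by simp
  have le: "c \<preceq> p x \<cdot> q y \<longleftrightarrow> c \<preceq> p x \<and> c \<preceq> q y" if "x \<in> elts X" "y \<in> elts Y" "c \<in> cr" for x y c
    using weightD(3)[OF w that(1)] weightD(3)[OF v that(2)] that(3) by (simp add: le_meet_iff)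
  have fst: "\<exists>y\<in>elts Y. \<exists>d. cond d \<and> d \<preceq> e \<and> d \<preceq> ?r (vpair x y)"
    if x: "x \<in> elts X" and e: "cond e" "e \<preceq> p x" "e \<preceq> jv q Y (\<lambda>_. True)" for x e
  proof -
    from jv_cond[OF v def_True e(1,3)] obtain y d where d: "y \<in> elts Y" "cond d" "d \<preceq> e" "d \<preceq> q y" by metis
    have "d \<preceq> p x" using cle[OF d(2,3) e(2)] e(1) weightD(3)[OF w x] by simp
    then have "d \<preceq> ?r (vpair x y)" using d le[OF x d(1)] by simp
    then show ?thesis using d(1-3) by blast
  qed
  have snd: "\<exists>x\<in>elts X. \<exists>d. cond d \<and> d \<preceq> e \<and> d \<preceq> ?r (vpair x y)"
    if y: "y \<in> elts Y" and e: "cond e" "e \<preceq> q y" "e \<preceq> jv p X (\<lambda>_. True)" for y e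
  proof -
    from jv_cond[OF w def_True e(1,3)] obtain x d where d: "x \<in> elts X" "cond d" "d \<preceq> e" "d \<preceq> p x" by metis
    have "d \<preceq> q y" using cle[OF d(2,3) e(2)] e(1) weightD(3)[OF v y] by simp
    then have "d \<preceq> ?r (vpair x y)" using d le[OF d(1) y] by simp
    then show ?thesis using d(1-3) by blast
  qed
  note pU = weightD(5)[OF w, unfolded AA_def] and qU = weightD(5)[OF v, unfolded AA_def]
  show AA: "AA ?r ?Z (\<lambda>z. P (vfst0 z))" if P: "dpred P" and A: "AA p X P" for P
  proof -
    have dP: "def (\<lambda>e. P (vfst0 (e 0)))" by (intro dfn_subst1[OF P] tm_vfst0 trm_var)
    note i = AA_inV[OF t ZV dP]
    show ?thesis
      unfolding AA_def
    proof (rule U_force2[OF A[unfolded AA_def] qU bsup_closed[OF i]])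
      fix x assume x: "cond x" "x \<preceq> jv p X P" "x \<preceq> jv q Y (\<lambda>_. True)"
      from jv_cond[OF w P x(1,2)] obtain z e where e: "z \<in> elts X" "P z" "cond e" "e \<preceq> x" "e \<preceq> p z" .
      have "e \<preceq> jv q Y (\<lambda>_. True)" using cle[OF e(3,4) x(3)] x(1) jv_closed[OF v def_True] by simp
      from fst[OF e(1,3,5) this] obtain y d where d: "y \<in> elts Y" "cond d" "d \<preceq> e" "d \<preceq> ?r (vpair z y)" by blast
      have "d \<preceq> jv ?r ?Z (\<lambda>z. P (vfst0 z))"
        by (rule cond_le_bsup[OF i cond_cr[OF d(2)] _ _ d(4)])
          (use d e c in \<open>auto simp: vpair_prodV intro!: bexI[of _ "vpair z y"]\<close>)
      moreover have "d \<preceq> x" using le_tr[of d e x] e d x by simp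
      ultimately show "\<exists>y. cond y \<and> y \<preceq> x \<and> y \<preceq> jv ?r ?Z (\<lambda>z. P (vfst0 z))" using d by blast
    qed
  qed
  have "AA ?r ?Z (\<lambda>_. True)" by (rule AA[OF def_True weightD(5)[OF w]])
  moreover have "\<forall>z\<in>elts ?Z. ?r z \<in> cr" using c by (auto simp: elts_prodV)
  moreover have "\<forall>z\<in>elts ?Z. \<forall>z'\<in>elts ?Z. \<forall>c. cond c \<and> c \<preceq> ?r z \<and> c \<preceq> ?r z' \<longrightarrow> z = z'"
  proof (intro ballI allI impI)
    fix z z' c assume "z \<in> elts ?Z" "z' \<in> elts ?Z" and c: "cond c \<and> c \<preceq> ?r z \<and> c \<preceq> ?r z'"
    then obtain x y x' y' where z: "z = vpair x y" "x \<in> elts X" "y \<in> elts Y" "z' = vpair x' y'" "x' \<in> elts X" "y' \<in> elts Y"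
      unfolding elts_prodV by blast
    then have "x = x'" "y = y'"
      using c le[OF z(2,3)] le[OF z(5,6)] weightD(4)[OF w z(2,5)] weightD(4)[OF v z(3,6)] by auto
    then show "z = z'" using z by simp
  qed
  ultimately show W: "weight ?r ?Z" unfolding weight_def using t ZV by blast
  show "Rep ?r ?Z (\<lambda>z. f (vfst0 z)) \<tau>" if f: "dfun f" and N: "\<tau> \<in> NB" and R: "Rep p X f \<tau>" for f \<tau>
    unfolding Rep_def
  proof (rule U_force2[OF R[unfolded Rep_def] qU])
    have f': "tm (\<lambda>e. f (vfst0 (e 0)))" by (intro tm_fun1[OF f] tm_vfst0 trm_var)
    show "rv ?r ?Z (\<lambda>z. f (vfst0 z)) \<tau> \<in> cr" by (rule rv_closed[OF W f' N])
    fix x assume x: "cond x" "x \<preceq> rv p X f \<tau>" "x \<preceq> jv q Y (\<lambda>_. True)"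
    from rv_cond[OF w f N x(1,2)] obtain z e where
      e: "z \<in> elts X" "cond e" "e \<preceq> x" "e \<preceq> p z" "e \<preceq> eqv \<tau> (ck (f z))" .
    have "e \<preceq> jv q Y (\<lambda>_. True)" using cle[OF e(2,3) x(3)] x(1) jv_closed[OF v def_True] by simp
    from fst[OF e(1,2,4) this] obtain y d where d: "y \<in> elts Y" "cond d" "d \<preceq> e" "d \<preceq> ?r (vpair z y)" by blast
    have "d \<preceq> eqv \<tau> (ck (f z))"
      using cle[OF d(2,3) e(5)] e eq_closed[OF NB_V[OF N] ck_V[OF weight_fV[OF w f e(1)]]] by simp
    then have "d \<preceq> rv ?r ?Z (\<lambda>z. f (vfst0 z)) \<tau>"
      using le_rv[OF W f' N, of "vpair z y" d] e d by (simp add: vpair_prodV)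
    moreover have "d \<preceq> x" using le_tr[of d e x] e d x by simp
    ultimately show "\<exists>y. cond y \<and> y \<preceq> x \<and> y \<preceq> rv ?r ?Z (\<lambda>z. f (vfst0 z)) \<tau>" using d by blast
  qed
  show "Rep ?r ?Z (\<lambda>z. f (vsnd0 z)) \<tau>" if f: "dfun f" and N: "\<tau> \<in> NB" and R: "Rep q Y f \<tau>" for f \<tau>
    unfolding Rep_def
  proof (rule U_force2[OF R[unfolded Rep_def] pU])
    have f': "tm (\<lambda>e. f (vsnd0 (e 0)))" by (intro tm_fun1[OF f] tm_vsnd0 trm_var)
    show "rv ?r ?Z (\<lambda>z. f (vsnd0 z)) \<tau> \<in> cr" by (rule rv_closed[OF W f' N])
    fix x assume x: "cond x" "x \<preceq> rv q Y f \<tau>" "x \<preceq> jv p X (\<lambda>_. True)"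
    from rv_cond[OF v f N x(1,2)] obtain z e where
      e: "z \<in> elts Y" "cond e" "e \<preceq> x" "e \<preceq> q z" "e \<preceq> eqv \<tau> (ck (f z))" .
    have "e \<preceq> jv p X (\<lambda>_. True)" using cle[OF e(2,3) x(3)] x(1) jv_closed[OF w def_True] by simp
    from snd[OF e(1,2,4) this] obtain y d where d: "y \<in> elts X" "cond d" "d \<preceq> e" "d \<preceq> ?r (vpair y z)" by blast
    have "d \<preceq> eqv \<tau> (ck (f z))"
      using cle[OF d(2,3) e(5)] e eq_closed[OF NB_V[OF N] ck_V[OF weight_fV[OF v f e(1)]]] by simp
    then have "d \<preceq> rv ?r ?Z (\<lambda>z. f (vsnd0 z)) \<tau>"
      using le_rv[OF W f' N, of "vpair y z" d] e d by (simp add: vpair_prodV)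
    moreover have "d \<preceq> x" using le_tr[of d e x] e d x by simp
    ultimately show "\<exists>y. cond y \<and> y \<preceq> x \<and> y \<preceq> rv ?r ?Z (\<lambda>z. f (vsnd0 z)) \<tau>" using d by blast
  qed
qed

text \<open>The one-point weight represents check names by constant functions.\<close>

lemma one_point:
  shows weight_point: "weight (\<lambda>_. \<one>) (vset {vset {}})"
    and AA_point: "\<And>P. dpred P \<Longrightarrow> AA (\<lambda>_. \<one>) (vset {vset {}}) P \<longleftrightarrow> P (vset {})"
    and Rep_point: "\<And>c. c \<in> V \<Longrightarrow> Rep (\<lambda>_. \<one>) (vset {vset {}}) (\<lambda>_. c) (ck c)"
proof -
  let ?X = "vset {vset {}} :: 'a"
  have "tm (\<lambda>_. ?X)" by (intro def_rules V_empty refl)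
  then have XV: "?X \<in> V" by (rule tm_V)
  have t: "tm (\<lambda>e. (\<lambda>_. \<one>) (e 0))" by (intro trm_const cr_V one_closed refl)
  have sup1: "bsup {u. \<exists>x\<in>elts ?X. P x \<and> u = \<one>} \<in> U" if P: "dpred P" "P (vset {})" for P
  proof -
    have "\<one> \<preceq> bsup {u. \<exists>x\<in>elts ?X. P x \<and> u = \<one>}"
      by (rule bsup_upper[OF AA_inV[OF t XV P(1)]]) (use P(2) in auto)
    then show ?thesis by (rule U_up[OF U_one bsup_closed[OF AA_inV[OF t XV P(1)]]])
  qed
  show W: "weight (\<lambda>_. \<one>) ?X"
    unfolding weight_def AA_def using sup1[OF def_True] t XV by auto
  show "AA (\<lambda>_. \<one>) ?X P \<longleftrightarrow> P (vset {})" if P: "dpred P" for P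
  proof
    assume A: "AA (\<lambda>_. \<one>) ?X P"
    show "P (vset {})"
      by (rule jv_cond[OF W P U_cond[OF A[unfolded AA_def]] le_refl[OF jv_closed[OF W P]]]) simp
  qed (unfold AA_def, rule sup1[OF P])
  show "Rep (\<lambda>_. \<one>) ?X (\<lambda>_. c) (ck c)" if c: "c \<in> V" for c
  proof -
    have f: "tm (\<lambda>e. (\<lambda>_. c) (e 0))" by (intro trm_const c refl)
    have "\<one> \<preceq> rv (\<lambda>_. \<one>) ?X (\<lambda>_. c) (ck c)"
      by (rule le_rv[OF W f ck_NB[OF c], of "vset {}"]) (use c in \<open>auto intro: eqv_refl\<close>)
    then show ?thesis unfolding Rep_def using U_up[OF U_one rv_closed[OF W f ck_NB[OF c]]] by simp
  qed
qed

end

section \<open>Elementary embeddings and the image of the algebra\<close>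

locale boolean_embedding = boolean_ultra +
  fixes M :: "'a set" and j :: "'a \<Rightarrow> 'a"
  assumes transM: "transitive_class M" and elem: "elementary_embedding V M j"
begin

lemma jM: "x \<in> V \<Longrightarrow> j x \<in> M"
  using elem unfolding elementary_embedding_def by blast

sublocale T: two_models V M j
  by unfold_locales (use transV transM jM V_nonempty in auto)

lemma transfer:
  assumes "dfn V M j P Q'" "e \<in> envs V"
  shows "P e \<longleftrightarrow> Q' (\<lambda>n. j (e n))"
proof -
  obtain \<phi> p where p: "p \<in> envs V"
    and 1: "\<And>e. e \<in> envs V \<Longrightarrow> P e \<longleftrightarrow> sat V (mixenv e p) \<phi>"
    and 2: "\<And>e. e \<in> envs M \<Longrightarrow> Q' e \<longleftrightarrow> sat M (mixenv e (\<lambda>n. j (p n))) \<phi>"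
    using assms(1) by (auto simp: dfn_def)
  have "range (mixenv e p) \<subseteq> V" using p assms(2) by (auto simp: mixenv_def)
  then have "sat V (mixenv e p) \<phi> \<longleftrightarrow> sat M (j \<circ> mixenv e p) \<phi>"
    using elem unfolding elementary_embedding_def by blast
  moreover have "j \<circ> mixenv e p = mixenv (\<lambda>n. j (e n)) (\<lambda>n. j (p n))"
    by (auto simp: mixenv_def)
  moreover have "(\<lambda>n. j (e n)) \<in> envs M" using assms(2) jM by (auto intro: envsI)
  ultimately show ?thesis using 1 2 assms(2) by simp
qed

lemma transfer_closed:
  assumes "dfn V M j (\<lambda>_. P) (\<lambda>_. Q')" "P"
  shows "Q'"
proof -
  obtain x where "x \<in> V" using V_nonempty by blast
  then have "(\<lambda>_. x) \<in> envs V" by (simp add: envsI)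
  from transfer[OF assms(1) this] assms(2) show ?thesis by simp
qed

lemma jB: "j B = vpair (j A) (j R)"
proof (rule transfer_closed)
  show "dfn V M j (\<lambda>_. B = vpair A R) (\<lambda>_. j B = vpair (j A) (j R))"
    by (intro T.dfn_rules refl ARV) (use ARV B_eq vpair_V in metis)
qed (rule B_eq)

abbreviation "jL \<equiv> bord (j B)"
abbreviation "jc \<equiv> elts (j A)"
abbreviation jle where "jle x y \<equiv> vpair x y \<in> elts (j R)"

lemma jL: "carrier jL = jc" "x \<sqsubseteq>\<^bsub>jL\<^esub> y \<longleftrightarrow> jle x y" "x .=\<^bsub>jL\<^esub> y \<longleftrightarrow> x = y"
  unfolding bord_def by (simp_all add: jB)

lemma jcM: "x \<in> jc \<Longrightarrow> x \<in> M"
  using transitive_classD[OF transM jM[OF ARV(1)]] .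

lemma zero_V: "\<zero> \<in> V" by (rule cr_V) simp

lemma jle_antisym: "x \<in> jc \<Longrightarrow> y \<in> jc \<Longrightarrow> jle x y \<Longrightarrow> jle y x \<Longrightarrow> x = y"
proof -
  have "\<forall>x\<in>jc. \<forall>y\<in>jc. jle x y \<longrightarrow> jle y x \<longrightarrow> x = y"
  proof (rule transfer_closed)
    show "dfn V M j (\<lambda>_. \<forall>x\<in>elts A. \<forall>y\<in>elts A. vpair x y \<in> elts R \<longrightarrow> vpair y x \<in> elts R \<longrightarrow> x = y)
      (\<lambda>_. \<forall>x\<in>jc. \<forall>y\<in>jc. jle x y \<longrightarrow> jle y x \<longrightarrow> x = y)"
      by (intro T.dfn_rules refl ARV)
    show "\<forall>x\<in>elts A. \<forall>y\<in>elts A. vpair x y \<in> elts R \<longrightarrow> vpair y x \<in> elts R \<longrightarrow> x = y"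
      unfolding cr_elts[symmetric] le_iff[symmetric] using le_antisym by blast
  qed
  then show "x \<in> jc \<Longrightarrow> y \<in> jc \<Longrightarrow> jle x y \<Longrightarrow> jle y x \<Longrightarrow> x = y" by blast
qed

lemma jle_trans: "x \<in> jc \<Longrightarrow> y \<in> jc \<Longrightarrow> z \<in> jc \<Longrightarrow> jle x y \<Longrightarrow> jle y z \<Longrightarrow> jle x z"
proof -
  have "\<forall>x\<in>jc. \<forall>y\<in>jc. \<forall>z\<in>jc. jle x y \<longrightarrow> jle y z \<longrightarrow> jle x z"
  proof (rule transfer_closed)
    show "dfn V M j (\<lambda>_. \<forall>x\<in>elts A. \<forall>y\<in>elts A. \<forall>z\<in>elts A. vpair x y \<in> elts R \<longrightarrow> vpair y z \<in> elts R \<longrightarrow> vpair x z \<in> elts R)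
      (\<lambda>_. \<forall>x\<in>jc. \<forall>y\<in>jc. \<forall>z\<in>jc. jle x y \<longrightarrow> jle y z \<longrightarrow> jle x z)"
      by (intro T.dfn_rules refl ARV)
    show "\<forall>x\<in>elts A. \<forall>y\<in>elts A. \<forall>z\<in>elts A. vpair x y \<in> elts R \<longrightarrow> vpair y z \<in> elts R \<longrightarrow> vpair x z \<in> elts R"
      unfolding cr_elts[symmetric] le_iff[symmetric] using le_tr by blast
  qed
  then show "x \<in> jc \<Longrightarrow> y \<in> jc \<Longrightarrow> z \<in> jc \<Longrightarrow> jle x y \<Longrightarrow> jle y z \<Longrightarrow> jle x z" by blast
qed

lemma j_zero: "j \<zero> \<in> jc" "x \<in> jc \<Longrightarrow> jle (j \<zero>) x"
proof -
  have "j \<zero> \<in> jc \<and> (\<forall>x\<in>jc. jle (j \<zero>) x)"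
  proof (rule transfer_closed)
    show "dfn V M j (\<lambda>_. \<zero> \<in> elts A \<and> (\<forall>x\<in>elts A. vpair \<zero> x \<in> elts R)) (\<lambda>_. j \<zero> \<in> jc \<and> (\<forall>x\<in>jc. jle (j \<zero>) x))"
      by (intro T.dfn_rules refl ARV zero_V)
    show "\<zero> \<in> elts A \<and> (\<forall>x\<in>elts A. vpair \<zero> x \<in> elts R)"
      unfolding cr_elts[symmetric] le_iff[symmetric] using zero_le zero_closed by blast
  qed
  then show "j \<zero> \<in> jc" "x \<in> jc \<Longrightarrow> jle (j \<zero>) x" by blast+
qed

lemma jbottom: "\<bottom>\<^bsub>jL\<^esub> = j \<zero>"
proof -
  have "least jL x jc \<longleftrightarrow> x = j \<zero>" for x
    unfolding least_def jL using j_zero jle_antisym[of x "j \<zero>"] by auto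
  then show ?thesis unfolding bottom_def jL by simp
qed

lemma jmeet:
  assumes "x \<in> jc" "y \<in> jc"
  shows "x \<sqinter>\<^bsub>jL\<^esub> y \<in> jc" "jle (x \<sqinter>\<^bsub>jL\<^esub> y) x" "jle (x \<sqinter>\<^bsub>jL\<^esub> y) y"
    "\<And>w. w \<in> jc \<Longrightarrow> jle w x \<Longrightarrow> jle w y \<Longrightarrow> jle w (x \<sqinter>\<^bsub>jL\<^esub> y)"
proof -
  have "\<forall>x\<in>jc. \<forall>y\<in>jc. \<exists>z\<in>jc. jle z x \<and> jle z y \<and> (\<forall>w\<in>jc. jle w x \<longrightarrow> jle w y \<longrightarrow> jle w z)"
  proof (rule transfer_closed)
    show "dfn V M j (\<lambda>_. \<forall>x\<in>elts A. \<forall>y\<in>elts A. \<exists>z\<in>elts A. vpair z x \<in> elts R \<and> vpair z y \<in> elts R \<and>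
        (\<forall>w\<in>elts A. vpair w x \<in> elts R \<longrightarrow> vpair w y \<in> elts R \<longrightarrow> vpair w z \<in> elts R))
      (\<lambda>_. \<forall>x\<in>jc. \<forall>y\<in>jc. \<exists>z\<in>jc. jle z x \<and> jle z y \<and> (\<forall>w\<in>jc. jle w x \<longrightarrow> jle w y \<longrightarrow> jle w z))"
      by (intro T.dfn_rules refl ARV)
    show "\<forall>x\<in>elts A. \<forall>y\<in>elts A. \<exists>z\<in>elts A. vpair z x \<in> elts R \<and> vpair z y \<in> elts R \<and>
        (\<forall>w\<in>elts A. vpair w x \<in> elts R \<longrightarrow> vpair w y \<in> elts R \<longrightarrow> vpair w z \<in> elts R)"
      unfolding cr_elts[symmetric] le_iff[symmetric]
    proof (intro ballI)
      fix x y assume "x \<in> cr" "y \<in> cr"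
      then show "\<exists>z\<in>cr. z \<preceq> x \<and> z \<preceq> y \<and> (\<forall>w\<in>cr. w \<preceq> x \<longrightarrow> w \<preceq> y \<longrightarrow> w \<preceq> z)"
        by (intro bexI[of _ "x \<cdot> y"]) (simp_all add: BL.meet_left BL.meet_right BL.meet_le)
    qed
  qed
  then obtain z where z: "z \<in> jc" "jle z x" "jle z y" "\<forall>w\<in>jc. jle w x \<longrightarrow> jle w y \<longrightarrow> jle w z"
    using assms by blast
  have "greatest jL u (Lower jL {x, y}) \<longleftrightarrow> u \<in> jc \<and> jle u x \<and> jle u y \<and> (\<forall>w\<in>jc. jle w x \<longrightarrow> jle w y \<longrightarrow> jle w u)" for u
    unfolding greatest_def Lower_def jL using assms by auto
  then have "greatest jL (x \<sqinter>\<^bsub>jL\<^esub> y) (Lower jL {x, y})"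
    unfolding meet_def inf_def using z by (metis (no_types, lifting) someI_ex)
  with \<open>\<And>u. greatest jL u (Lower jL {x, y}) \<longleftrightarrow> _\<close> show "x \<sqinter>\<^bsub>jL\<^esub> y \<in> jc" "jle (x \<sqinter>\<^bsub>jL\<^esub> y) x" "jle (x \<sqinter>\<^bsub>jL\<^esub> y) y"
    "\<And>w. w \<in> jc \<Longrightarrow> jle w x \<Longrightarrow> jle w y \<Longrightarrow> jle w (x \<sqinter>\<^bsub>jL\<^esub> y)" by blast+
qed


section \<open>A generic filter makes the ultrapower well-founded\<close>

lemma prodV_V: "X \<in> V \<Longrightarrow> Y \<in> V \<Longrightarrow> prodV X Y \<in> V"
  by (rule tm_V, unfold prodV_def) (intro def_rules refl)

text \<open>
  The map that sends a condition to the value of \<open>\<tau>\<close> that it decides, and the set of conditions at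
  which it is defined or which force \<open>\<tau>\<close> not to be in the ground model.  Both are elements of \<open>V\<close>,
  so that \<open>j\<close> can be applied to them.
\<close>

definition decide :: "'a \<Rightarrow> 'a" where
  "decide \<tau> = vset {q \<in> elts (prodV (supp \<tau>) A). \<exists>x\<in>V. \<exists>d\<in>V. q = vpair x d \<and> d \<noteq> \<zero> \<and> vpair d (eqv \<tau> (ck x)) \<in> elts R}"

definition deciders :: "'a \<Rightarrow> 'a" where
  "deciders \<tau> = vset {d \<in> elts A. d \<noteq> \<zero> \<and> ((\<exists>x\<in>V. vpair x d \<in> elts (decide \<tau>)) \<or>
     (\<forall>y\<in>elts A. y \<noteq> \<zero> \<longrightarrow> vpair y d \<in> elts R \<longrightarrow> vpair y (val_ground V B \<tau>) \<notin> elts R))}"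

lemma decide:
  assumes "\<tau> \<in> NB"
  shows "decide \<tau> \<in> V" "vpair x d \<in> elts (decide \<tau>) \<longleftrightarrow> x \<in> V \<and> cond d \<and> d \<preceq> eqv \<tau> (ck x)"
proof -
  have "tm (\<lambda>_. decide \<tau>)"
    unfolding decide_def by (intro tm_val_eq tm_ck def_rules NB_V assms ARV zero_V prodV_V supp(1) refl)
  then show "decide \<tau> \<in> V" by (rule tm_V)
  show "vpair x d \<in> elts (decide \<tau>) \<longleftrightarrow> x \<in> V \<and> cond d \<and> d \<preceq> eqv \<tau> (ck x)"
    unfolding decide_def elts_Collect
    using suppI[OF assms, of x d] supp(2)[OF assms] cr_V[of d] by (auto simp: vpair_prodV cond_def cr_elts le_iff)
qed

lemma deciders:
  assumes "\<tau> \<in> NB"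
  shows "deciders \<tau> \<in> V"
    and "\<And>x. cond x \<Longrightarrow> \<exists>d\<in>elts (deciders \<tau>). d \<noteq> \<zero> \<and> d \<preceq> x"
proof -
  have cV: "val_ground V B \<tau> \<in> V" by (rule cr_V[OF val_ground_closed[OF assms]])
  have "tm (\<lambda>_. deciders \<tau>)"
    unfolding deciders_def by (intro def_rules ARV zero_V cV decide(1) assms refl)
  then show "deciders \<tau> \<in> V" by (rule tm_V)
  fix x assume x: "cond x"
  show "\<exists>d\<in>elts (deciders \<tau>). d \<noteq> \<zero> \<and> d \<preceq> x"
  proof (cases "\<exists>y. cond y \<and> y \<preceq> x \<and> y \<preceq> val_ground V B \<tau>")
    case True
    then obtain y where y: "cond y" "y \<preceq> x" "y \<preceq> val_ground V B \<tau>" by blast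
    from val_ground_cond[OF assms y(1,3)] obtain a z where z: "a \<in> V" "cond z" "z \<preceq> y" "z \<preceq> eqv \<tau> (ck a)" .
    have "z \<in> elts (deciders \<tau>)"
      unfolding deciders_def elts_Collect decide(2)[OF assms] using z by (auto simp: cond_def cr_elts)
    moreover have "z \<preceq> x" using le_tr[of z y x] z y x by simp
    ultimately show ?thesis using z(2) by (auto simp: cond_def)
  next
    case False
    then have "x \<in> elts (deciders \<tau>)"
      unfolding deciders_def elts_Collect using x by (auto simp: cond_def cr_elts le_iff)
    then show ?thesis using x le_refl by (auto simp: cond_def)
  qed
qed

text \<open>
  The set \<open>deciders \<tau>\<close> is dense, so \<open>G\<close> meets its image.  As \<open>G\<close> contains the image of the Boolean
  value of \<open>\<tau>\<close> being in the ground model, it selects a value \<open>val \<tau>\<close> in \<open>M\<close>.  In \<open>V\<close>, compatible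
  conditions that decide the values of \<open>\<tau>\<close> and \<open>\<sigma>\<close> and force \<open>\<tau>\<close> to be in \<open>\<sigma>\<close> can only decide values
  that are elements of one another.  By elementarity \<open>val\<close> maps \<open>E\<close> into the membership relation.
\<close>

theorem wf_if_generic:
  assumes G: "generic_filter M jL G" and jU: "j ` U \<subseteq> G"
  shows "wfp_on GN E"
proof -
  note GF = G[unfolded generic_filter_def bfilter_def jL jbottom]
  have Gc: "g \<in> jc" if "g \<in> G" for g using GF that by blast
  have Gz: "j \<zero> \<notin> G" using GF by blast
  have Gmeet: "g \<sqinter>\<^bsub>jL\<^esub> g' \<in> G" if "g \<in> G" "g' \<in> G" for g g' using GF that by blast
  have ex: "\<exists>x. \<exists>d\<in>G. vpair x d \<in> elts (j (decide \<tau>))" if \<tau>: "\<tau> \<in> GN" for \<tau>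
  proof -
    note N = GN_NB[OF \<tau>]
    let ?c = "val_ground V B \<tau>"
    have cV: "?c \<in> V" by (rule cr_V[OF val_ground_closed[OF N]])
    have 1: "(\<forall>d\<in>elts (j (deciders \<tau>)). d \<in> jc) \<and>
      (\<forall>x\<in>jc. x \<noteq> j \<zero> \<longrightarrow> (\<exists>d\<in>elts (j (deciders \<tau>)). d \<noteq> j \<zero> \<and> jle d x))"
    proof (rule transfer_closed)
      show "dfn V M j (\<lambda>_. (\<forall>d\<in>elts (deciders \<tau>). d \<in> elts A) \<and>
          (\<forall>x\<in>elts A. x \<noteq> \<zero> \<longrightarrow> (\<exists>d\<in>elts (deciders \<tau>). d \<noteq> \<zero> \<and> vpair d x \<in> elts R)))
        (\<lambda>_. (\<forall>d\<in>elts (j (deciders \<tau>)). d \<in> jc) \<and>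
          (\<forall>x\<in>jc. x \<noteq> j \<zero> \<longrightarrow> (\<exists>d\<in>elts (j (deciders \<tau>)). d \<noteq> j \<zero> \<and> jle d x)))"
        by (intro T.dfn_rules refl ARV zero_V deciders(1) N)
      have "\<forall>d\<in>elts (deciders \<tau>). d \<in> elts A" unfolding deciders_def by simp
      moreover have "\<forall>x\<in>elts A. x \<noteq> \<zero> \<longrightarrow> (\<exists>d\<in>elts (deciders \<tau>). d \<noteq> \<zero> \<and> vpair d x \<in> elts R)"
        using deciders(2)[OF N] unfolding cr_elts[symmetric] le_iff[symmetric] cond_def by blast
      ultimately show "(\<forall>d\<in>elts (deciders \<tau>). d \<in> elts A) \<and>
          (\<forall>x\<in>elts A. x \<noteq> \<zero> \<longrightarrow> (\<exists>d\<in>elts (deciders \<tau>). d \<noteq> \<zero> \<and> vpair d x \<in> elts R))" ..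
    qed
    then have "bdense jL (elts (j (deciders \<tau>)))"
      unfolding bdense_def jL jbottom by blast
    then obtain d where d: "d \<in> G" "d \<in> elts (j (deciders \<tau>))"
      using G jM[OF deciders(1)[OF N]] unfolding generic_filter_def by blast
    have 2: "\<forall>d\<in>elts (j (deciders \<tau>)). (\<exists>x\<in>M. vpair x d \<in> elts (j (decide \<tau>))) \<or>
        (\<forall>y\<in>jc. y \<noteq> j \<zero> \<longrightarrow> jle y d \<longrightarrow> \<not> jle y (j ?c))"
    proof (rule transfer_closed)
      show "dfn V M j (\<lambda>_. \<forall>d\<in>elts (deciders \<tau>). (\<exists>x\<in>V. vpair x d \<in> elts (decide \<tau>)) \<or>
          (\<forall>y\<in>elts A. y \<noteq> \<zero> \<longrightarrow> vpair y d \<in> elts R \<longrightarrow> vpair y ?c \<notin> elts R))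
        (\<lambda>_. \<forall>d\<in>elts (j (deciders \<tau>)). (\<exists>x\<in>M. vpair x d \<in> elts (j (decide \<tau>))) \<or>
          (\<forall>y\<in>jc. y \<noteq> j \<zero> \<longrightarrow> jle y d \<longrightarrow> \<not> jle y (j ?c)))"
        by (intro T.dfn_rules refl ARV zero_V deciders(1) decide(1) cV N)
    qed (auto simp: deciders_def)
    have jc: "j ?c \<in> G" using jU GN_U[OF \<tau>] by blast
    have "\<not> (\<forall>y\<in>jc. y \<noteq> j \<zero> \<longrightarrow> jle y d \<longrightarrow> \<not> jle y (j ?c))"
      using jmeet[OF Gc[OF d(1)] Gc[OF jc]] Gmeet[OF d(1) jc] Gz by metis
    then show ?thesis using 2 d by blast
  qed
  define val where "val \<tau> = (SOME x. \<exists>d\<in>G. vpair x d \<in> elts (j (decide \<tau>)))" for \<tau>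
  have val: "\<exists>d\<in>G. vpair (val \<tau>) d \<in> elts (j (decide \<tau>))" if "\<tau> \<in> GN" for \<tau>
    unfolding val_def by (rule someI_ex[OF ex[OF that]])
  have E_val: "val \<tau> \<in> elts (val \<sigma>)" if N: "\<tau> \<in> GN" "\<sigma> \<in> GN" and E: "E \<tau> \<sigma>" for \<tau> \<sigma>
  proof -
    note NB = GN_NB[OF N(1)] GN_NB[OF N(2)]
    have V: "memv \<tau> \<sigma> \<in> V" by (rule cr_V[OF U_cr[OF E]])
    have 3: "\<forall>x\<in>M. \<forall>x'\<in>M. \<forall>d\<in>jc. \<forall>d'\<in>jc. vpair x d \<in> elts (j (decide \<tau>)) \<longrightarrow> vpair x' d' \<in> elts (j (decide \<sigma>)) \<longrightarrow>
        (\<forall>y\<in>jc. y \<noteq> j \<zero> \<longrightarrow> jle y d \<longrightarrow> jle y d' \<longrightarrow> jle y (j (memv \<tau> \<sigma>)) \<longrightarrow> x \<in> elts x')"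
    proof (rule transfer_closed)
      show "dfn V M j (\<lambda>_. \<forall>x\<in>V. \<forall>x'\<in>V. \<forall>d\<in>elts A. \<forall>d'\<in>elts A. vpair x d \<in> elts (decide \<tau>) \<longrightarrow>
            vpair x' d' \<in> elts (decide \<sigma>) \<longrightarrow> (\<forall>y\<in>elts A. y \<noteq> \<zero> \<longrightarrow> vpair y d \<in> elts R \<longrightarrow> vpair y d' \<in> elts R \<longrightarrow>
              vpair y (memv \<tau> \<sigma>) \<in> elts R \<longrightarrow> x \<in> elts x'))
          (\<lambda>_. \<forall>x\<in>M. \<forall>x'\<in>M. \<forall>d\<in>jc. \<forall>d'\<in>jc. vpair x d \<in> elts (j (decide \<tau>)) \<longrightarrow> vpair x' d' \<in> elts (j (decide \<sigma>)) \<longrightarrow>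
            (\<forall>y\<in>jc. y \<noteq> j \<zero> \<longrightarrow> jle y d \<longrightarrow> jle y d' \<longrightarrow> jle y (j (memv \<tau> \<sigma>)) \<longrightarrow> x \<in> elts x'))"
        by (intro T.dfn_rules refl ARV zero_V decide(1) V NB)
      show "\<forall>x\<in>V. \<forall>x'\<in>V. \<forall>d\<in>elts A. \<forall>d'\<in>elts A. vpair x d \<in> elts (decide \<tau>) \<longrightarrow>
            vpair x' d' \<in> elts (decide \<sigma>) \<longrightarrow> (\<forall>y\<in>elts A. y \<noteq> \<zero> \<longrightarrow> vpair y d \<in> elts R \<longrightarrow> vpair y d' \<in> elts R \<longrightarrow>
              vpair y (memv \<tau> \<sigma>) \<in> elts R \<longrightarrow> x \<in> elts x')"
        unfolding cr_elts[symmetric] le_iff[symmetric] decide(2)[OF NB(1)] decide(2)[OF NB(2)]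
      proof (intro ballI impI)
        fix x x' d d' y
        assume d: "x \<in> V \<and> cond d \<and> d \<preceq> eqv \<tau> (ck x)" "x' \<in> V \<and> cond d' \<and> d' \<preceq> eqv \<sigma> (ck x')"
          and y: "y \<in> cr" "y \<noteq> \<zero>" "y \<preceq> d" "y \<preceq> d'" "y \<preceq> memv \<tau> \<sigma>"
        have c: "cond y" using y by (simp add: cond_def)
        have "y \<preceq> eqv \<tau> (ck x)" "y \<preceq> eqv \<sigma> (ck x')"
          using cle[OF c y(3)] cle[OF c y(4)] d eq_closed NB by auto
        then have "y \<preceq> memv (ck x) (ck x')"
          using memv_subst_right[OF ck_NB NB(2) ck_NB c memv_subst_left[OF NB(1) ck_NB NB(2) c y(5)]] d by blast
        then show "x \<in> elts x'" using memv_ckD[OF c] d by blast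
      qed
    qed
    obtain d d' where d: "d \<in> G" "vpair (val \<tau>) d \<in> elts (j (decide \<tau>))"
      "d' \<in> G" "vpair (val \<sigma>) d' \<in> elts (j (decide \<sigma>))"
      using val N by blast
    have inM: "x \<in> M" if "vpair x d \<in> elts (j (decide \<rho>))" "\<rho> \<in> NB" for x d \<rho>
    proof -
      have p: "vpair x d \<in> M" by (rule transitive_classD[OF transM jM[OF decide(1)[OF that(2)]] that(1)])
      have "vset {x} \<in> M" by (rule transitive_classD[OF transM p]) (simp add: elts_vpair)
      then show ?thesis by (rule transitive_classD[OF transM]) simp
    qed
    let ?b = "j (memv \<tau> \<sigma>)"
    have b: "?b \<in> G" using jU E by blast
    let ?m = "d \<sqinter>\<^bsub>jL\<^esub> d'"
    have m: "?m \<in> G" by (rule Gmeet[OF d(1,3)])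
    let ?y = "?m \<sqinter>\<^bsub>jL\<^esub> ?b"
    have y: "?y \<in> G" by (rule Gmeet[OF m b])
    note mm = jmeet[OF Gc[OF d(1)] Gc[OF d(3)]] and yy = jmeet[OF Gc[OF m] Gc[OF b]]
    have "jle ?y d" "jle ?y d'"
      using jle_trans[OF Gc[OF y] Gc[OF m] Gc[OF d(1)] yy(2) mm(2)]
        jle_trans[OF Gc[OF y] Gc[OF m] Gc[OF d(3)] yy(2) mm(3)] by blast+
    moreover have "?y \<noteq> j \<zero>" using y Gz by metis
    ultimately show ?thesis
      using 3[rule_format, OF inM[OF d(2) NB(1)] inM[OF d(4) NB(2)] Gc[OF d(1)] Gc[OF d(3)] d(2,4) Gc[OF y]] yy(3) by blast
  qed
  show ?thesis
    unfolding wfp_on_def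
  proof (intro allI impI ballI)
    fix P \<tau> assume step: "\<forall>x\<in>GN. (\<forall>y\<in>GN. E y x \<longrightarrow> P y) \<longrightarrow> P x" and "\<tau> \<in> GN"
    have "\<forall>\<tau>\<in>GN. val \<tau> = x \<longrightarrow> P \<tau>" for x
    proof (induction x rule: elts_induct)
      case (step x)
      then show ?case using E_val \<open>\<forall>x\<in>GN. (\<forall>y\<in>GN. E y x \<longrightarrow> P y) \<longrightarrow> P x\<close> by blast
    qed
    then show "P \<tau>" using \<open>\<tau> \<in> GN\<close> by blast
  qed
qed

end

section \<open>The collapse of a well-founded ultrapower\<close>

context zf_class
begin

lemma def_sat:
  assumes "\<And>i. tm (t i)"
  shows "def (\<lambda>e. sat V (\<lambda>i. t i e) \<phi>)"
  using assms
proof (induction \<phi> arbitrary: t)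
  case (Forall n \<phi>)
  have t': "tm (\<lambda>e. if i = n then e 0 else t i (\<lambda>n. e (Suc n)))" for i
    by (cases "i = n") (simp_all add: trm_var trm_shift[OF Forall.prems])
  have "(\<lambda>i. t i (\<lambda>n. e (Suc n)))(n := e 0) = (\<lambda>i. if i = n then e 0 else t i (\<lambda>n. e (Suc n)))" for e
    by auto
  then have "def (\<lambda>e. sat V ((\<lambda>i. t i (\<lambda>n. e (Suc n)))(n := e 0)) \<phi>)"
    using Forall.IH[OF t'] by simp
  then show ?case unfolding sat.simps by (rule dfn_Forall)
qed (simp_all only: sat.simps, (intro dfn_Mem dfn_Eq dfn_Neg dfn_Conj; blast)+)

end

locale wf_ultrapower = boolean_ultra +
  assumes wfE: "wfp_on GN E"
begin

definition Er :: "('a \<times> 'a) set" where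
  "Er = {(\<sigma>, \<tau>). \<sigma> \<in> GN \<and> \<tau> \<in> GN \<and> E \<sigma> \<tau>}"

lemma wf_Er: "wf Er"
  unfolding wf_def
proof (intro allI impI)
  fix P x assume *: "\<forall>x. (\<forall>y. (y, x) \<in> Er \<longrightarrow> P y) \<longrightarrow> P x"
  have "\<forall>x\<in>GN. P x"
    using wfE[unfolded wfp_on_def, rule_format, of P] * unfolding Er_def by blast
  then show "P x" using * unfolding Er_def by blast
qed

definition \<pi> :: "'a \<Rightarrow> 'a" where
  "\<pi> = wfrec Er (\<lambda>f \<tau>. vset (f ` {\<sigma>. (\<sigma>, \<tau>) \<in> Er}))"

lemma \<pi>_eq: "\<pi> \<tau> = vset (\<pi> ` {\<sigma>. (\<sigma>, \<tau>) \<in> Er})"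
proof -
  have "\<pi> \<tau> = vset (cut \<pi> Er \<tau> ` {\<sigma>. (\<sigma>, \<tau>) \<in> Er})"
    unfolding \<pi>_def by (subst wfrec[OF wf_Er]) (rule refl)
  also have "cut \<pi> Er \<tau> ` {\<sigma>. (\<sigma>, \<tau>) \<in> Er} = \<pi> ` {\<sigma>. (\<sigma>, \<tau>) \<in> Er}"
    by (rule image_cong) (auto simp: cut_apply)
  finally show ?thesis .
qed

lemma \<pi>_Q:
  assumes "\<sigma> \<in> GN" "\<tau> \<in> GN" "Q \<sigma> \<tau>"
  shows "\<pi> \<sigma> = \<pi> \<tau>"
proof -
  have "(\<rho>, \<sigma>) \<in> Er \<longleftrightarrow> (\<rho>, \<tau>) \<in> Er" for \<rho>
    using E_Q_right[of \<rho> \<sigma> \<tau>] E_Q_right[of \<rho> \<tau> \<sigma>] Q_sym[OF assms(3)] assms GN_NB unfolding Er_def by blast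
  then show ?thesis using \<pi>_eq[of \<sigma>] \<pi>_eq[of \<tau>] by simp
qed

text \<open>
  The predecessors of \<open>\<tau>\<close> take values in the union of the possible values of \<open>\<tau>\<close>, so up to
  equality modulo \<open>U\<close> they are mixtures over one fixed set, which form a set.
\<close>

lemma small_pred:
  assumes \<tau>: "\<tau> \<in> GN"
  shows "small (\<pi> ` {\<sigma>. (\<sigma>, \<tau>) \<in> Er})"
proof -
  note NT = GN_NB[OF \<tau>]
  let ?W = "vset (\<Union>x\<in>elts (supp \<tau>). elts x)"
  let ?K = "prodV (vset (ck ` elts (vset (\<Union>w\<in>elts ?W. elts w)))) A"
  have eW: "elts ?W = (\<Union>x\<in>elts (supp \<tau>). elts x)"
    and eW2: "elts (vset (\<Union>w\<in>elts ?W. elts w)) = (\<Union>w\<in>elts ?W. elts w)"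
    by (intro elts_vset_small small_Union small_elts)+
  have "tm (\<lambda>_. ?W)" by (intro def_rules supp(1) NT refl)
  then have WV: "?W \<in> V" by (rule tm_V)
  have "tm (\<lambda>_. ?K)" unfolding prodV_def by (intro tm_ck def_rules supp(1) NT ARV refl)
  then have KV: "?K \<in> V" by (rule tm_V)
  have "\<pi> \<sigma> \<in> \<pi> ` elts (vpow ?K)" if \<sigma>: "(\<sigma>, \<tau>) \<in> Er" for \<sigma>
  proof -
    have \<sigma>N: "\<sigma> \<in> GN" and E: "E \<sigma> \<tau>" using \<sigma> unfolding Er_def by auto
    note NS = GN_NB[OF \<sigma>N]
    let ?a = "memv \<sigma> \<tau> \<cdot> (val_ground V B \<sigma> \<cdot> val_ground V B \<tau>)"
    note cs = U_cr[OF E] U_cr[OF GN_U[OF \<sigma>N]] U_cr[OF GN_U[OF \<tau>]]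
    have aU: "?a \<in> U" by (intro U_meet E GN_U \<sigma>N \<tau>)
    have dense: "\<exists>w\<in>elts ?W. \<exists>y. cond y \<and> y \<preceq> x \<and> y \<preceq> eqv \<sigma> (ck w)" if x: "cond x" "x \<preceq> ?a" for x
    proof -
      have x': "x \<preceq> memv \<sigma> \<tau>" "x \<preceq> val_ground V B \<sigma>" "x \<preceq> val_ground V B \<tau>"
        using x cs by (simp_all add: le_meet_iff)
      from GN_cond[OF \<tau> x(1) x'(3)] obtain v y where y: "v \<in> elts (supp \<tau>)" "cond y" "y \<preceq> x" "y \<preceq> eqv \<tau> (ck v)" .
      have "y \<preceq> val_ground V B \<sigma>" using cle[OF y(2,3) x'(2)] x(1) cs by simp
      from val_ground_cond[OF NS y(2) this] obtain u z where z: "u \<in> V" "cond z" "z \<preceq> y" "z \<preceq> eqv \<sigma> (ck u)" .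
      have v: "v \<in> V" using y(1) supp(2)[OF NT] by simp
      have zx: "z \<preceq> x" using le_tr[of z y x] z y x by simp
      have "z \<preceq> memv \<sigma> \<tau>" using cle[OF z(2) zx x'(1)] x(1) cs by simp
      then have "z \<preceq> memv (ck u) \<tau>" by (rule memv_subst_left[OF NS ck_NB[OF z(1)] NT z(2) _ z(4)])
      moreover have "z \<preceq> eqv \<tau> (ck v)" using cle[OF z(2,3) y(4)] y eq_closed NT v by simp
      ultimately have "z \<preceq> memv (ck u) (ck v)"
        by (rule memv_subst_right[OF ck_NB[OF z(1)] NT ck_NB[OF v] z(2)])
      then have "u \<in> elts v" by (rule memv_ckD[OF z(2) _ z(1) v])
      then have "u \<in> elts ?W" unfolding eW using y(1) by blast
      then show ?thesis using z(2,4) zx by blast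
    qed
    have w: "weight (\<lambda>w. eqv \<sigma> (ck w)) ?W" "Rep (\<lambda>w. eqv \<sigma> (ck w)) ?W (\<lambda>x. x) \<sigma>"
      by (rule weight_values[OF NS WV aU]; rule dense; assumption)+
    let ?m = "mixture (\<lambda>w. eqv \<sigma> (ck w)) ?W (\<lambda>x. x)"
    note m = Rep_mixture[OF w(1) tm_id]
    have "Q \<sigma> ?m"
      using Rep_eq_iff[OF w(1) tm_id tm_id NS GN_NB[OF m(1)] w(2) m(2)] weightD(5)[OF w(1)] by simp
    then have "\<pi> \<sigma> = \<pi> ?m" by (rule \<pi>_Q[OF \<sigma>N m(1)])
    moreover have "elts ?m \<subseteq> elts ?K"
    proof
      fix q assume "q \<in> elts ?m"
      then obtain w y where q: "w \<in> elts ?W" "y \<in> elts w" "q = vpair (ck y) (eqv \<sigma> (ck w))"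
        unfolding elts_mixture by blast
      then have "y \<in> elts (vset (\<Union>w\<in>elts ?W. elts w))" unfolding eW2 by blast
      then have "ck y \<in> elts (vset (ck ` elts (vset (\<Union>w\<in>elts ?W. elts w))))"
        unfolding elts_image by (rule imageI)
      then show "q \<in> elts ?K" using weightD(3)[OF w(1) q(1)] by (simp only: q(3) vpair_prodV cr_elts simp_thms)
    qed
    ultimately show ?thesis using vpow(2)[OF KV] NB_V[OF GN_NB[OF m(1)]] by blast
  qed
  then have "\<pi> ` {\<sigma>. (\<sigma>, \<tau>) \<in> Er} \<subseteq> \<pi> ` elts (vpow ?K)" by blast
  then show ?thesis by (rule small_subset[OF _ small_image[OF small_elts]])
qed

lemma elts_\<pi>: "\<tau> \<in> GN \<Longrightarrow> elts (\<pi> \<tau>) = \<pi> ` {\<sigma> \<in> GN. E \<sigma> \<tau>}"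
  by (subst \<pi>_eq) (simp add: elts_vset_small[OF small_pred], auto simp: Er_def)

text \<open>
  If two names differed modulo \<open>U\<close>, their values would differ almost everywhere over the common
  weight, and the mixture of chosen elements of the symmetric differences would be an element of
  just one of them.
\<close>

lemma Q_extensional:
  assumes N: "\<sigma> \<in> GN" "\<tau> \<in> GN" and ext: "\<And>\<rho>. \<rho> \<in> GN \<Longrightarrow> E \<rho> \<sigma> \<longleftrightarrow> E \<rho> \<tau>"
  shows "Q \<sigma> \<tau>"
proof -
  note NB = GN_NB[OF N(1)] GN_NB[OF N(2)]
  define p where "p = wprod (\<lambda>w. eqv \<sigma> (ck w)) (\<lambda>w. eqv \<tau> (ck w))"
  define Z where "Z = prodV (supp \<sigma>) (supp \<tau>)"
  note w1 = weight_self[OF N(1)] and w2 = weight_self[OF N(2)]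
  note W = weight_wprod[OF w1(1) w2(1), folded p_def Z_def]
  note R1 = Rep_fst[OF w1(1) w2(1) tm_id NB(1) w1(2), folded p_def Z_def]
  note R2 = Rep_snd[OF w1(1) w2(1) tm_id NB(2) w2(2), folded p_def Z_def]
  let ?k = "\<lambda>z t. (t \<in> elts (vfst0 z) \<longleftrightarrow> t \<notin> elts (vsnd0 z)) \<or> vfst0 z = vsnd0 z"
  have dk: "def (\<lambda>e. ?k (e (Suc 0)) (e 0))" by (intro def_rules tm_vfst0 tm_vsnd0)
  have ex: "\<forall>z\<in>elts Z. \<exists>t\<in>V. ?k z t"
  proof
    fix z assume z: "z \<in> elts Z"
    have zV: "z \<in> V" using weight_V[OF W z] .
    show "\<exists>t\<in>V. ?k z t"
    proof (cases "vfst0 z = vsnd0 z")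
      case False
      then obtain t where "t \<in> elts (vfst0 z) \<longleftrightarrow> t \<notin> elts (vsnd0 z)" using extensionality by blast
      moreover from this have "t \<in> V" using V_elts[OF vfst0_V[OF zV]] V_elts[OF vsnd0_V[OF zV]] by blast
      ultimately show ?thesis by blast
    qed (use zV in blast)
  qed
  from definable_choice[where Q = ?k, OF dk weightD(2)[OF W] ex] obtain g where g: "dfun g" "\<And>z. z \<in> elts Z \<Longrightarrow> ?k z (g z)"
    by (elim exE conjE) (rule that, assumption, elim ballE; blast)
  note m = Rep_mixture[OF W g(1)]
  let ?P1 = "\<lambda>z. g z \<in> elts (vfst0 z)" and ?P2 = "\<lambda>z. g z \<in> elts (vsnd0 z)"
  have d1: "dpred ?P1" and d2: "dpred ?P2" and d3: "def (\<lambda>e. vfst0 (e 0) = vsnd0 (e 0))"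
    by (intro def_rules tm_fun1[OF g(1)] tm_vfst0 tm_vsnd0)+
  have t1: "dfun vfst0" and t2: "dfun vsnd0" by (intro tm_vfst0 tm_vsnd0 trm_var)+
  have "AA p Z ?P1 \<longleftrightarrow> AA p Z ?P2"
    using ext[OF m(1)] Rep_mem_iff[OF W g(1) t1 GN_NB[OF m(1)] NB(1) m(2) R1]
      Rep_mem_iff[OF W g(1) t2 GN_NB[OF m(1)] NB(2) m(2) R2] by simp
  then have "AA p Z (\<lambda>z. ?P1 z \<and> ?P2 z) \<or> AA p Z (\<lambda>z. \<not> ?P1 z \<and> \<not> ?P2 z)"
    using AA_conj[OF W d1 d2] AA_conj[OF W dfn_Neg[OF d1] dfn_Neg[OF d2]] AA_not[OF W d1] AA_not[OF W d2] by blast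
  then have "AA p Z (\<lambda>z. vfst0 z = vsnd0 z)"
    using AA_mono[OF W dfn_Conj[OF d1 d2] d3] AA_mono[OF W dfn_Conj[OF dfn_Neg[OF d1] dfn_Neg[OF d2]] d3] g(2) by blast
  then show ?thesis using Rep_eq_iff[OF W t1 t2 NB R1 R2] by simp
qed

lemma \<pi>_inj: "\<sigma> \<in> GN \<Longrightarrow> \<tau> \<in> GN \<Longrightarrow> \<pi> \<sigma> = \<pi> \<tau> \<Longrightarrow> Q \<sigma> \<tau>"
  using wf_Er
proof (induction \<sigma> arbitrary: \<tau> rule: wf_induct_rule)
  case (less \<sigma>)
  note N = less.prems(1,2)
  have eq: "\<pi> ` {\<rho> \<in> GN. E \<rho> \<sigma>} = \<pi> ` {\<rho> \<in> GN. E \<rho> \<tau>}"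
    using less.prems(3) elts_\<pi>[OF N(1)] elts_\<pi>[OF N(2)] by simp
  show ?case
  proof (rule Q_extensional[OF N])
    fix \<rho> assume \<rho>: "\<rho> \<in> GN"
    show "E \<rho> \<sigma> \<longleftrightarrow> E \<rho> \<tau>"
    proof
      assume E: "E \<rho> \<sigma>"
      then obtain \<rho>' where r: "\<rho>' \<in> GN" "E \<rho>' \<tau>" "\<pi> \<rho> = \<pi> \<rho>'" using eq \<rho> by blast
      have "Q \<rho> \<rho>'" by (rule less.IH[OF _ \<rho> r(1,3)]) (use E \<rho> N in \<open>simp add: Er_def\<close>)
      then show "E \<rho> \<tau>"
        by (intro E_Q_left[OF r(2) Q_sym] GN_NB[OF r(1)] GN_NB[OF \<rho>] GN_NB[OF N(2)])
    next
      assume E: "E \<rho> \<tau>"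
      then have "\<pi> \<rho> \<in> \<pi> ` {\<rho> \<in> GN. E \<rho> \<sigma>}" unfolding eq using \<rho> by blast
      then obtain \<rho>' where r: "\<rho>' \<in> GN" "E \<rho>' \<sigma>" "\<pi> \<rho> = \<pi> \<rho>'" by blast
      have "Q \<rho>' \<rho>" by (rule less.IH[OF _ r(1) \<rho> r(3)[symmetric]]) (use r N in \<open>simp add: Er_def\<close>)
      then show "E \<rho> \<sigma>"
        by (intro E_Q_left[OF r(2)] GN_NB[OF r(1)] GN_NB[OF \<rho>] GN_NB[OF N(1)])
    qed
  qed
qed

lemma \<pi>_eq_iff: "\<sigma> \<in> GN \<Longrightarrow> \<tau> \<in> GN \<Longrightarrow> \<pi> \<sigma> = \<pi> \<tau> \<longleftrightarrow> Q \<sigma> \<tau>"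
  using \<pi>_inj \<pi>_Q by blast

lemma \<pi>_mem_iff:
  assumes "\<sigma> \<in> GN" "\<tau> \<in> GN"
  shows "\<pi> \<sigma> \<in> elts (\<pi> \<tau>) \<longleftrightarrow> E \<sigma> \<tau>"
proof
  assume "\<pi> \<sigma> \<in> elts (\<pi> \<tau>)"
  then obtain \<rho> where r: "\<rho> \<in> GN" "E \<rho> \<tau>" "\<pi> \<sigma> = \<pi> \<rho>" using elts_\<pi>[OF assms(2)] by auto
  have "Q \<rho> \<sigma>" using \<pi>_inj[OF r(1) assms(1)] r(3) by simp
  then show "E \<sigma> \<tau>" using E_Q_left[OF r(2)] GN_NB r(1) assms by blast
qed (use elts_\<pi>[OF assms(2)] assms(1) in auto)


section \<open>The theorem of Los\<close>

definition M :: "'a set" where "M = \<pi> ` GN"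

definition jj :: "'a \<Rightarrow> 'a" where "jj x = \<pi> (ck x)"

lemma transitive_M: "transitive_class M"
  unfolding transitive_class_def M_def using elts_\<pi> by auto

text \<open>
  Only the quantifier is interesting.  If \<open>\<forall>x. \<phi>\<close> fails almost everywhere, choose counterexamples in
  \<open>V\<close> by a definable function \<open>g\<close>; their mixture is a counterexample in \<open>M\<close>.  Conversely, an
  element of \<open>M\<close> may come from a name that is not represented over the given weight, so the weight
  is first refined by the values of that name.
\<close>

theorem Los:
  assumes "weight p X" "\<And>i. tm (\<lambda>e. f i (e 0))" "\<And>i. \<tau> i \<in> GN" "\<And>i. Rep p X (f i) (\<tau> i)"
  shows "sat M (\<lambda>i. \<pi> (\<tau> i)) \<phi> \<longleftrightarrow> AA p X (\<lambda>x. sat V (\<lambda>i. f i x) \<phi>)"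
  using assms
proof (induction \<phi> arbitrary: p X f \<tau>)
  case (Mem m n)
  show ?case
    unfolding sat.simps \<pi>_mem_iff[OF Mem.prems(3) Mem.prems(3)]
    by (rule Rep_mem_iff[OF Mem.prems(1,2,2) GN_NB[OF Mem.prems(3)] GN_NB[OF Mem.prems(3)] Mem.prems(4,4)])
next
  case (Eq m n)
  show ?case
    unfolding sat.simps \<pi>_eq_iff[OF Eq.prems(3) Eq.prems(3)]
    by (rule Rep_eq_iff[OF Eq.prems(1,2,2) GN_NB[OF Eq.prems(3)] GN_NB[OF Eq.prems(3)] Eq.prems(4,4)])
next
  case (Neg \<phi>)
  show ?case
    unfolding sat.simps AA_not[OF Neg.prems(1) def_sat[of "\<lambda>i e. f i (e 0)", OF Neg.prems(2)]]
    using Neg.IH[of p X f \<tau>, OF Neg.prems] by blast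
next
  case (Conj \<phi> \<psi>)
  note d = def_sat[of "\<lambda>i e. f i (e 0)", OF Conj.prems(2)]
  show ?case
    unfolding sat.simps AA_conj[OF Conj.prems(1) d d]
    using Conj.IH(1)[of p X f \<tau>, OF Conj.prems] Conj.IH(2)[of p X f \<tau>, OF Conj.prems] by blast
next
  case (Forall n \<phi>)
  note W = Forall.prems(1) and t = Forall.prems(2) and N = Forall.prems(3) and R = Forall.prems(4)
  have upd: "(\<lambda>i. h (k i))(n := h a) = (\<lambda>i. h ((k(n := a)) i))" for h :: "'a \<Rightarrow> 'a" and k a by auto
  have dall: "def (\<lambda>e. sat V (\<lambda>i. f i (e 0)) (Forall n \<phi>))" by (rule def_sat) (rule t)
  show ?case
  proof
    assume *: "sat M (\<lambda>i. \<pi> (\<tau> i)) (Forall n \<phi>)"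
    show "AA p X (\<lambda>x. sat V (\<lambda>i. f i x) (Forall n \<phi>))"
    proof (rule ccontr)
      assume "\<not> ?thesis"
      then have neg': "AA p X (\<lambda>x. \<not> sat V (\<lambda>i. f i x) (Forall n \<phi>))" using AA_not[OF W dall] by simp
      \<comment> \<open>a counterexample wherever there is one; \<open>y\<close> is arbitrary elsewhere\<close>
      let ?k = "\<lambda>x y. sat V (\<lambda>i. f i x) (Forall n \<phi>) \<or> \<not> sat V (\<lambda>i. if i = n then y else f i x) \<phi>"
      have "def (\<lambda>e. sat V (\<lambda>i. f i (e (Suc 0))) (Forall n \<phi>))"
        by (rule def_sat) (rule tm_fun1[OF t trm_var])
      moreover have "def (\<lambda>e. sat V (\<lambda>i. if i = n then e 0 else f i (e (Suc 0))) \<phi>)"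
      proof (rule def_sat)
        show "tm (\<lambda>e. if i = n then e 0 else f i (e (Suc 0)))" for i
          by (cases "i = n") (simp_all add: trm_var tm_fun1[OF t trm_var])
      qed
      ultimately have dk: "def (\<lambda>e. ?k (e (Suc 0)) (e 0))" by (intro dfn_Disj dfn_Neg)
      have ud: "(\<lambda>i. f i x)(n := y) = (\<lambda>i. if i = n then y else f i x)" for x y by auto
      have ex: "\<forall>x\<in>elts X. \<exists>y\<in>V. ?k x y"
        using V_nonempty unfolding sat.simps ud by blast
      from definable_choice[where Q = ?k, OF dk weightD(2)[OF W] ex] obtain g where g: "dfun g" "\<And>x. x \<in> elts X \<Longrightarrow> ?k x (g x)"
        by (elim exE conjE) (rule that, assumption, elim ballE; blast)
      note m = Rep_mixture[OF W g(1)]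
      let ?m = "mixture p X g"
      have tg: "tm (\<lambda>e. (f(n := g)) i (e 0))" for i using t g(1) by simp
      have "sat M (\<lambda>i. \<pi> ((\<tau>(n := ?m)) i)) \<phi> \<longleftrightarrow> AA p X (\<lambda>x. sat V (\<lambda>i. (f(n := g)) i x) \<phi>)"
        by (rule Forall.IH[OF W tg]) (use N R m in auto)
      moreover have "sat M (\<lambda>i. \<pi> ((\<tau>(n := ?m)) i)) \<phi>"
        using * m(1) unfolding sat.simps upd[symmetric] M_def by blast
      ultimately have "AA p X (\<lambda>x. sat V (\<lambda>i. (f(n := g)) i x) \<phi>)" by blast
      moreover have dg: "def (\<lambda>e. sat V (\<lambda>i. (f(n := g)) i (e 0)) \<phi>)" by (rule def_sat) (rule tg)
      moreover have "AA p X (\<lambda>x. \<not> sat V (\<lambda>i. (f(n := g)) i x) \<phi>)"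
      proof (rule AA_mono[OF W dfn_Neg[OF dall] dfn_Neg[OF dg] neg'])
        fix x assume x: "x \<in> elts X" "\<not> sat V (\<lambda>i. f i x) (Forall n \<phi>)"
        have "(\<lambda>i. (f(n := g)) i x) = (\<lambda>i. if i = n then g x else f i x)" by auto
        moreover have "\<not> sat V (\<lambda>i. if i = n then g x else f i x) \<phi>" using g(2)[OF x(1)] x(2) by blast
        ultimately show "\<not> sat V (\<lambda>i. (f(n := g)) i x) \<phi>" by (simp only: not_False_eq_True)
      qed
      ultimately show False using AA_not[OF W dg] by blast
    qed
  next
    assume *: "AA p X (\<lambda>x. sat V (\<lambda>i. f i x) (Forall n \<phi>))"
    have "sat M (\<lambda>i. \<pi> ((\<tau>(n := \<rho>)) i)) \<phi>" if \<rho>: "\<rho> \<in> GN" for \<rho>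
    proof -
      note w = weight_self[OF \<rho>]
      define r where "r = wprod p (\<lambda>w. eqv \<rho> (ck w))"
      define Z where "Z = prodV X (supp \<rho>)"
      note W' = weight_wprod[OF W w(1), folded r_def Z_def]
      define g where "g i = (if i = n then vsnd0 else (\<lambda>z. f i (vfst0 z)))" for i
      have tg: "tm (\<lambda>e. g i (e 0))" for i
        by (cases "i = n") (simp_all add: g_def tm_vsnd0_aux tm_fun1[OF t tm_vfst0_aux])
      have Rg: "Rep r Z (g i) ((\<tau>(n := \<rho>)) i)" for i
        using Rep_fst[OF W w(1) t GN_NB[OF N] R, folded r_def Z_def, of i]
          Rep_snd[OF W w(1) tm_id GN_NB[OF \<rho>] w(2), folded r_def Z_def] by (simp add: g_def)
      have dg: "def (\<lambda>e. sat V (\<lambda>i. g i (e 0)) \<phi>)" by (rule def_sat) (rule tg)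
      have df: "def (\<lambda>e. sat V (\<lambda>i. f i (vfst0 (e 0))) (Forall n \<phi>))"
        by (rule def_sat) (rule tm_fun1[OF t tm_vfst0_aux])
      have "AA r Z (\<lambda>z. sat V (\<lambda>i. f i (vfst0 z)) (Forall n \<phi>))"
        using AA_fst[OF W w(1) dall *] unfolding r_def Z_def .
      then have "AA r Z (\<lambda>z. sat V (\<lambda>i. g i z) \<phi>)"
      proof (rule AA_mono[OF W' df dg])
        fix z assume z: "z \<in> elts Z" "sat V (\<lambda>i. f i (vfst0 z)) (Forall n \<phi>)"
        have "(\<lambda>i. f i (vfst0 z))(n := vsnd0 z) = (\<lambda>i. g i z)" by (auto simp: g_def)
        then show "sat V (\<lambda>i. g i z) \<phi>"
          using z(2) vsnd0_V[OF weight_V[OF W' z(1)]] unfolding sat.simps by metis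
      qed
      moreover have "sat M (\<lambda>i. \<pi> ((\<tau>(n := \<rho>)) i)) \<phi> \<longleftrightarrow> AA r Z (\<lambda>z. sat V (\<lambda>i. g i z) \<phi>)"
        by (rule Forall.IH[OF W' tg _ Rg]) (use N \<rho> in simp)
      ultimately show ?thesis by blast
    qed
    then show "sat M (\<lambda>i. \<pi> (\<tau> i)) (Forall n \<phi>)"
      unfolding sat.simps M_def ball_simps upd by blast
  qed
qed

lemma elementary_jj: "elementary_embedding V M jj"
  unfolding elementary_embedding_def
proof (intro conjI allI impI)
  show "jj ` V \<subseteq> M" unfolding jj_def M_def using ck_GN by blast
  fix \<phi> and e :: "nat \<Rightarrow> 'a" assume "range e \<subseteq> V"
  then have e: "e i \<in> V" for i by auto
  have t: "tm (\<lambda>e'. (\<lambda>_. e i) (e' 0))" for i by (intro trm_const e refl)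
  have "sat M (\<lambda>i. \<pi> (ck (e i))) \<phi> \<longleftrightarrow> AA (\<lambda>_. \<one>) (vset {vset {}}) (\<lambda>x. sat V (\<lambda>i. (\<lambda>_. e i) x) \<phi>)"
    by (rule Los[OF weight_point t ck_GN[OF e] Rep_point[OF e]])
  also have "\<dots> \<longleftrightarrow> sat V e \<phi>"
    by (rule AA_point) (rule def_sat, rule t)
  finally show "sat V e \<phi> \<longleftrightarrow> sat M (jj \<circ> e) \<phi>"
    by (simp add: jj_def comp_def)
qed

sublocale boolean_embedding V B U M jj
  by unfold_locales (rule transitive_M elementary_jj)+

text \<open>
  The same for statements with parameters, in the form in which definability is derived.
\<close>

lemma Los_dfn:
  assumes d: "dfn V M jj P P'" and "weight p X" and t: "\<And>i. tm (\<lambda>e. f i (e 0))" and N: "\<And>i. \<tau> i \<in> GN"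
    and R: "\<And>i. Rep p X (f i) (\<tau> i)"
  shows "P' (\<lambda>i. \<pi> (\<tau> i)) \<longleftrightarrow> AA p X (\<lambda>x. P (\<lambda>i. f i x))"
proof -
  obtain \<phi> c where c: "c \<in> envs V"
    and 1: "\<And>e. e \<in> envs V \<Longrightarrow> P e \<longleftrightarrow> sat V (mixenv e c) \<phi>"
    and 2: "\<And>e. e \<in> envs M \<Longrightarrow> P' e \<longleftrightarrow> sat M (mixenv e (\<lambda>n. jj (c n))) \<phi>"
    using d by (auto simp: dfn_def)
  \<comment> \<open>parameters become constant functions, which over any weight represent check names\<close>
  have Rc: "Rep p X (\<lambda>_. b) (ck b)" if b: "b \<in> V" for b
    unfolding Rep_def
  proof (rule U_force1[OF weightD(5)[OF assms(2), unfolded AA_def]])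
    have tb: "tm (\<lambda>e. (\<lambda>_. b) (e 0))" by (intro trm_const b refl)
    show "rv p X (\<lambda>_. b) (ck b) \<in> cr" by (rule rv_closed[OF assms(2) tb ck_NB[OF b]])
    fix x assume "cond x" "x \<preceq> jv p X (\<lambda>_. True)"
    from jv_cond[OF assms(2) def_True this] obtain z y where y: "z \<in> elts X" "cond y" "y \<preceq> x" "y \<preceq> p z" by metis
    have "y \<preceq> rv p X (\<lambda>_. b) (ck b)"
      by (rule le_rv[OF assms(2) tb ck_NB[OF b] y(1) cond_cr[OF y(2)] y(4)]) (use y b in \<open>simp add: eqv_refl\<close>)
    then show "\<exists>y. cond y \<and> y \<preceq> x \<and> y \<preceq> rv p X (\<lambda>_. b) (ck b)" using y by blast
  qed
  define g where "g i = (if even i then f (i div 2) else (\<lambda>_. c (i div 2)))" for i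
  define \<rho> where "\<rho> i = (if even i then \<tau> (i div 2) else ck (c (i div 2)))" for i
  have "sat M (\<lambda>i. \<pi> (\<rho> i)) \<phi> \<longleftrightarrow> AA p X (\<lambda>x. sat V (\<lambda>i. g i x) \<phi>)"
  proof (rule Los[OF assms(2)])
    show "tm (\<lambda>e. g i (e 0))" for i using t c by (cases "even i") (auto simp: g_def intro: trm_const)
  qed (use N R c Rc ck_GN in \<open>auto simp: g_def \<rho>_def\<close>)
  moreover have "(\<lambda>i. \<pi> (\<rho> i)) = mixenv (\<lambda>i. \<pi> (\<tau> i)) (\<lambda>n. jj (c n))"
    by (auto simp: mixenv_def \<rho>_def jj_def)
  moreover have "(\<lambda>i. g i x) = mixenv (\<lambda>i. f i x) c" for x
    by (auto simp: mixenv_def g_def)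
  moreover have "(\<lambda>i. \<pi> (\<tau> i)) \<in> envs M" using N by (auto intro: envsI simp: M_def)
  moreover have sP: "sat V (mixenv (\<lambda>i. f i x) c) \<phi> \<longleftrightarrow> P (\<lambda>i. f i x)" if "x \<in> elts X" for x
    using 1[of "\<lambda>i. f i x"] weight_fV[OF assms(2) t that] by (auto intro: envsI)
  have "{u. \<exists>x\<in>elts X. sat V (mixenv (\<lambda>i. f i x) c) \<phi> \<and> u = p x} = {u. \<exists>x\<in>elts X. P (\<lambda>i. f i x) \<and> u = p x}"
    using sP by blast
  then have "AA p X (\<lambda>x. sat V (mixenv (\<lambda>i. f i x) c) \<phi>) \<longleftrightarrow> AA p X (\<lambda>x. P (\<lambda>i. f i x))"
    unfolding AA_def by simp
  ultimately show ?thesis using 2 by simp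
qed

end

section \<open>The canonical generic filter\<close>

context wf_ultrapower
begin

text \<open>\<open>gv \<tau>\<close> is the Boolean value of the statement that \<open>\<tau>\<close> belongs to the generic filter.\<close>

abbreviation "gvS \<tau> \<equiv> {u. \<exists>b\<in>elts A. u = eqv \<tau> (ck b) \<cdot> b}"

definition gv :: "'a \<Rightarrow> 'a" where
  "gv \<tau> = bsup (gvS \<tau>)"

lemma gv_inV: "\<tau> \<in> NB \<Longrightarrow> inV (gvS \<tau>)"
  by (rule inV_of_def, unfold mem_Collect_eq) (intro def_rules tm_meet tm_val_eq tm_ck NB_V ARV refl)

lemma gv_closed: "\<tau> \<in> NB \<Longrightarrow> gv \<tau> \<in> cr"
  unfolding gv_def by (intro bsup_closed gv_inV)

lemma gv_cond:
  assumes "\<tau> \<in> NB" "cond x" "x \<preceq> gv \<tau>"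
  obtains b y where "b \<in> cr" "cond y" "y \<preceq> x" "y \<preceq> eqv \<tau> (ck b)" "y \<preceq> b"
proof -
  obtain b y where b: "b \<in> cr" and y: "cond y" "y \<preceq> x" "y \<preceq> eqv \<tau> (ck b) \<cdot> b"
    using bsup_cond[OF gv_inV[OF assms(1)] assms(2)] assms(3) unfolding gv_def cr_elts by blast
  have "eqv \<tau> (ck b) \<in> cr" using eq_closed assms(1) cr_V[OF b] by simp
  then show ?thesis using that[OF b y(1,2)] y b le_meet_iff by simp
qed

lemma le_gv:
  assumes "\<tau> \<in> NB" "b \<in> cr" "x \<in> cr" "x \<preceq> eqv \<tau> (ck b)" "x \<preceq> b"
  shows "x \<preceq> gv \<tau>"
proof -
  have c: "eqv \<tau> (ck b) \<in> cr" using eq_closed assms(1) cr_V[OF assms(2)] by simp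
  show ?thesis
    unfolding gv_def
    by (rule cond_le_bsup[OF gv_inV[OF assms(1)] assms(3), of "eqv \<tau> (ck b) \<cdot> b"])
      (use c assms le_meet_iff in \<open>auto simp: cr_elts[symmetric]\<close>)
qed

lemma AA_I:
  assumes w: "weight p X" and d: "dpred P" and a: "a \<in> U"
    and P: "\<And>z y. z \<in> elts X \<Longrightarrow> cond y \<Longrightarrow> y \<preceq> p z \<Longrightarrow> y \<preceq> a \<Longrightarrow> P z"
  shows "AA p X P"
  unfolding AA_def
proof (rule U_force2[OF a weightD(5)[OF w, unfolded AA_def] jv_closed[OF w d]])
  fix x assume x: "cond x" "x \<preceq> a" "x \<preceq> jv p X (\<lambda>_. True)"
  from jv_cond[OF w def_True x(1,3)] obtain z y where y: "z \<in> elts X" "cond y" "y \<preceq> x" "y \<preceq> p z" by metis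
  have "y \<preceq> a" using cle[OF y(2,3) x(2)] x(1) U_cr[OF a] by simp
  then have "y \<preceq> jv p X P" using le_jv[OF w d y(1) P[OF y(1,2,4)] cond_cr[OF y(2)] y(4)] by blast
  then show "\<exists>y. cond y \<and> y \<preceq> x \<and> y \<preceq> jv p X P" using y by blast
qed

text \<open>
  Over a weight, \<open>gv \<tau> \<in> U\<close> means that almost everywhere \<open>p z\<close> lies below the value \<open>f z\<close> of \<open>\<tau>\<close>.
  The next two lemmas are the two directions of this, with an \<open>a\<close> in \<open>U\<close> that collects what else is
  assumed or obtained on the way.
\<close>

lemma gv_I:
  assumes w: "weight p X" and f: "dfun f" and N: "\<tau> \<in> NB" and R: "Rep p X f \<tau>" and a: "a \<in> U"
    and in_f: "\<And>z y. z \<in> elts X \<Longrightarrow> cond y \<Longrightarrow> y \<preceq> p z \<Longrightarrow> y \<preceq> a \<Longrightarrow> f z \<in> cr \<and> (\<exists>v. cond v \<and> v \<preceq> y \<and> v \<preceq> f z)"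
  shows "gv \<tau> \<in> U"
proof (rule U_force2[OF a R[unfolded Rep_def] gv_closed[OF N]])
  fix x assume x: "cond x" "x \<preceq> a" "x \<preceq> rv p X f \<tau>"
  from rv_cond[OF w f N x(1,3)] obtain z y where
    y: "z \<in> elts X" "cond y" "y \<preceq> x" "y \<preceq> p z" "y \<preceq> eqv \<tau> (ck (f z))" .
  have "y \<preceq> a" using cle[OF y(2,3) x(2)] x(1) U_cr[OF a] by simp
  from in_f[OF y(1,2,4) this] obtain v where v: "f z \<in> cr" "cond v" "v \<preceq> y" "v \<preceq> f z" by blast
  have "v \<preceq> eqv \<tau> (ck (f z))" using cle[OF v(2,3) y(5)] y(2) eq_closed N cr_V[OF v(1)] by simp
  then have "v \<preceq> gv \<tau>" using le_gv[OF N v(1) cond_cr[OF v(2)] _ v(4)] by blast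
  moreover have "v \<preceq> x" using le_tr[of v y x] v y x by simp
  ultimately show "\<exists>y. cond y \<and> y \<preceq> x \<and> y \<preceq> gv \<tau>" using v by blast
qed

lemma gv_D:
  assumes w: "weight p X" and f: "dfun f" and N: "\<tau> \<in> NB" and R: "Rep p X f \<tau>" and g: "gv \<tau> \<in> U"
  shows "\<exists>a\<in>U. \<forall>z\<in>elts X. \<forall>y. cond y \<and> y \<preceq> p z \<and> y \<preceq> a \<longrightarrow> f z \<in> cr \<and> y \<preceq> f z"
proof (intro bexI[of _ "gv \<tau> \<cdot> rv p X f \<tau>"] ballI allI impI)
  note RU = R[unfolded Rep_def]
  show "gv \<tau> \<cdot> rv p X f \<tau> \<in> U" by (rule U_meet[OF g RU])
  fix z y assume z: "z \<in> elts X" and y: "cond y \<and> y \<preceq> p z \<and> y \<preceq> gv \<tau> \<cdot> rv p X f \<tau>"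
  have shrink: "f z \<in> cr \<and> (\<exists>u. cond u \<and> u \<preceq> v \<and> u \<preceq> f z)" if v: "cond v" "v \<preceq> y" for v
  proof -
    have yy: "y \<preceq> gv \<tau>" "y \<preceq> rv p X f \<tau>"
      using y le_meet_iff[OF cond_cr U_cr[OF g] U_cr[OF RU], of y] by blast+
    have "v \<preceq> rv p X f \<tau>" using cle[OF v yy(2)] y U_cr[OF RU] by simp
    from rv_cond[OF w f N v(1) this] obtain z' s where
      s: "z' \<in> elts X" "cond s" "s \<preceq> v" "s \<preceq> p z'" "s \<preceq> eqv \<tau> (ck (f z'))" .
    have sy: "s \<preceq> y" using le_tr[of s v y] s v y by simp
    have "s \<preceq> p z" using cle[OF s(2) sy] y weightD(3)[OF w z] by simp
    then have "z' = z" using weightD(4)[OF w s(1) z s(2,4)] by blast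
    have "s \<preceq> gv \<tau>" using cle[OF s(2) sy yy(1)] y gv_closed[OF N] by simp
    from gv_cond[OF N s(2) this] obtain b u where
      u: "b \<in> cr" "cond u" "u \<preceq> s" "u \<preceq> eqv \<tau> (ck b)" "u \<preceq> b" .
    have "u \<preceq> eqv \<tau> (ck (f z))"
      using cle[OF u(2,3) s(5)] s(2) eq_closed N weight_fV[OF w f z] \<open>z' = z\<close> by simp
    then have "b = f z" using eqv_ck_unique[OF u(2) N cr_V[OF u(1)] weight_fV[OF w f z] u(4)] by blast
    moreover have "u \<preceq> v" using le_tr[of u s v] u s v by simp
    ultimately show ?thesis using u by blast
  qed
  have fz: "f z \<in> cr" using shrink[of y] y le_refl by auto
  have "y \<preceq> f z"
    by (rule forcing_le[OF _ fz]) (use y shrink in auto)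
  then show "f z \<in> cr \<and> y \<preceq> f z" using fz by blast
qed

definition G :: "'a set" where
  "G = {\<pi> \<tau> |\<tau>. \<tau> \<in> GN \<and> gv \<tau> \<in> U}"

lemma \<pi>_jc: "\<tau> \<in> GN \<Longrightarrow> gv \<tau> \<in> U \<Longrightarrow> \<pi> \<tau> \<in> jc"
proof -
  assume \<tau>: "\<tau> \<in> GN" and g: "gv \<tau> \<in> U"
  note N = GN_NB[OF \<tau>]
  have "E \<tau> (ck A)"
  proof (rule U_force1[OF g mem_closed[OF NB_V[OF N] ck_V[OF ARV(1)]]])
    fix x assume "cond x" "x \<preceq> gv \<tau>"
    from gv_cond[OF N this] obtain b y where y: "b \<in> cr" "cond y" "y \<preceq> x" "y \<preceq> eqv \<tau> (ck b)" .
    have "y \<preceq> memv (ck b) (ck A)" using le_mem_ck[OF cond_cr[OF y(2)] _ ARV(1)] y(1) by (simp add: cr_elts)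
    then have "y \<preceq> memv \<tau> (ck A)"
      using memv_subst_left[OF ck_NB[OF cr_V[OF y(1)]] N ck_NB[OF ARV(1)] y(2)] y(4) eqv_sym by simp
    then show "\<exists>y. cond y \<and> y \<preceq> x \<and> y \<preceq> memv \<tau> (ck A)" using y by blast
  qed
  then show ?thesis unfolding jj_def \<pi>_mem_iff[OF \<tau> ck_GN[OF ARV(1)]] .
qed

lemma G_mono:
  assumes g: "x \<in> G" and y: "y \<in> jc" "jle x y"
  shows "y \<in> G"
proof -
  obtain \<tau> where \<tau>: "\<tau> \<in> GN" "gv \<tau> \<in> U" "x = \<pi> \<tau>" using g unfolding G_def by blast
  obtain \<sigma> where \<sigma>: "\<sigma> \<in> GN" "y = \<pi> \<sigma>" using jcM[OF y(1)] unfolding M_def by blast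
  note NT = GN_NB[OF \<tau>(1)] and NS = GN_NB[OF \<sigma>(1)]
  note w1 = weight_self[OF \<tau>(1)] and w2 = weight_self[OF \<sigma>(1)]
  define p where "p = wprod (\<lambda>w. eqv \<tau> (ck w)) (\<lambda>w. eqv \<sigma> (ck w))"
  define Z where "Z = prodV (supp \<tau>) (supp \<sigma>)"
  note W = weight_wprod[OF w1(1) w2(1), folded p_def Z_def]
  note R1 = Rep_fst[OF w1(1) w2(1) tm_id NT w1(2), folded p_def Z_def]
  note R2 = Rep_snd[OF w1(1) w2(1) tm_id NS w2(2), folded p_def Z_def]
  have t1: "dfun vfst0" and t2: "dfun vsnd0" by (intro tm_vfst0 tm_vsnd0 trm_var)+
  let ?f = "\<lambda>i::nat. if i = 0 then vfst0 else vsnd0" and ?t = "\<lambda>i::nat. if i = 0 then \<tau> else \<sigma>"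
  have D: "dfn V M jj (\<lambda>e. e 1 \<in> elts A \<and> vpair (e 0) (e 1) \<in> elts R) (\<lambda>e. e 1 \<in> jc \<and> jle (e 0) (e 1))"
    by (intro T.dfn_rules ARV refl)
  let ?P = "\<lambda>z. vsnd0 z \<in> elts A \<and> vpair (vfst0 z) (vsnd0 z) \<in> elts R"
  have dP: "dpred ?P" by (intro def_rules tm_vfst0 tm_vsnd0 ARV refl)
  have "\<pi> (?t 1) \<in> jc \<and> jle (\<pi> (?t 0)) (\<pi> (?t 1)) \<longleftrightarrow>
      AA p Z (\<lambda>z. ?f 1 z \<in> elts A \<and> vpair (?f 0 z) (?f 1 z) \<in> elts R)"
    by (rule Los_dfn[OF D W, of ?f ?t]) (use t1 t2 \<tau> \<sigma> R1 R2 in simp_all)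
  then have "AA p Z ?P" using y \<tau>(3) \<sigma>(2) by simp
  then have PU: "jv p Z ?P \<in> U" unfolding AA_def .
  obtain a where a: "a \<in> U" "\<forall>z\<in>elts Z. \<forall>y. cond y \<and> y \<preceq> p z \<and> y \<preceq> a \<longrightarrow> vfst0 z \<in> cr \<and> y \<preceq> vfst0 z"
    using gv_D[OF W t1 NT R1 \<tau>(2)] by blast
  have "gv \<sigma> \<in> U"
  proof (rule gv_I[OF W t2 NS R2 U_meet[OF PU a(1)]])
    fix z y assume z: "z \<in> elts Z" "cond y" "y \<preceq> p z" "y \<preceq> jv p Z ?P \<cdot> a"
    then have y: "y \<preceq> jv p Z ?P" "y \<preceq> a" using U_cr[OF PU] U_cr[OF a(1)] by (simp_all add: le_meet_iff)
    have "?P z" by (rule jv_at[OF W dP z(1-3) y(1)])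
    then have P: "vsnd0 z \<in> cr" "vfst0 z \<preceq> vsnd0 z" by (simp_all add: cr_elts le_iff)
    have "vfst0 z \<in> cr" "y \<preceq> vfst0 z" using a(2) z y by blast+
    then have "y \<preceq> vsnd0 z" using le_tr[of y "vfst0 z" "vsnd0 z"] P z(2) by simp
    then show "vsnd0 z \<in> cr \<and> (\<exists>v. cond v \<and> v \<preceq> y \<and> v \<preceq> vsnd0 z)" using P z(2) dense_refl by blast
  qed
  then show ?thesis using \<sigma> unfolding G_def by blast
qed

text \<open>
  The mixture of the meets of the values is a lower bound in the filter, and the filter is closed
  upwards.
\<close>

lemma G_meet:
  assumes "x \<in> G" "y \<in> G"
  shows "x \<sqinter>\<^bsub>jL\<^esub> y \<in> G"
proof -
  obtain \<tau> where \<tau>: "\<tau> \<in> GN" "gv \<tau> \<in> U" "x = \<pi> \<tau>" using assms(1) unfolding G_def by blast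
  obtain \<sigma> where \<sigma>: "\<sigma> \<in> GN" "gv \<sigma> \<in> U" "y = \<pi> \<sigma>" using assms(2) unfolding G_def by blast
  note NT = GN_NB[OF \<tau>(1)] and NS = GN_NB[OF \<sigma>(1)]
  note w1 = weight_self[OF \<tau>(1)] and w2 = weight_self[OF \<sigma>(1)]
  define p where "p = wprod (\<lambda>w. eqv \<tau> (ck w)) (\<lambda>w. eqv \<sigma> (ck w))"
  define Z where "Z = prodV (supp \<tau>) (supp \<sigma>)"
  note W = weight_wprod[OF w1(1) w2(1), folded p_def Z_def]
  note R1 = Rep_fst[OF w1(1) w2(1) tm_id NT w1(2), folded p_def Z_def]
  note R2 = Rep_snd[OF w1(1) w2(1) tm_id NS w2(2), folded p_def Z_def]
  have t1: "dfun vfst0" and t2: "dfun vsnd0" by (intro tm_vfst0 tm_vsnd0 trm_var)+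
  have t3: "tm (\<lambda>e. (\<lambda>z. vfst0 z \<cdot> vsnd0 z) (e 0))" by (intro tm_meet tm_vfst0 tm_vsnd0 trm_var)
  note m = Rep_mixture[OF W t3]
  define \<rho> where "\<rho> = mixture p Z (\<lambda>z. vfst0 z \<cdot> vsnd0 z)"
  have \<rho>: "\<rho> \<in> GN" "Rep p Z (\<lambda>z. vfst0 z \<cdot> vsnd0 z) \<rho>" using m unfolding \<rho>_def by blast+
  obtain a where a: "a \<in> U" "\<forall>z\<in>elts Z. \<forall>y. cond y \<and> y \<preceq> p z \<and> y \<preceq> a \<longrightarrow> vfst0 z \<in> cr \<and> y \<preceq> vfst0 z"
    using gv_D[OF W t1 NT R1 \<tau>(2)] by blast
  obtain b where b: "b \<in> U" "\<forall>z\<in>elts Z. \<forall>y. cond y \<and> y \<preceq> p z \<and> y \<preceq> b \<longrightarrow> vsnd0 z \<in> cr \<and> y \<preceq> vsnd0 z"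
    using gv_D[OF W t2 NS R2 \<sigma>(2)] by blast
  have ab: "vfst0 z \<in> cr \<and> vsnd0 z \<in> cr \<and> y \<preceq> vfst0 z \<and> y \<preceq> vsnd0 z"
    if z: "z \<in> elts Z" "cond y" "y \<preceq> p z" "y \<preceq> a \<cdot> b" for z y
  proof -
    have "y \<preceq> a" "y \<preceq> b" using z(4) le_meet_iff[OF cond_cr[OF z(2)] U_cr[OF a(1)] U_cr[OF b(1)]] by blast+
    then show ?thesis using a(2) b(2) z(1-3) by simp
  qed
  have gr: "gv \<rho> \<in> U"
  proof (rule gv_I[OF W t3 GN_NB[OF \<rho>(1)] \<rho>(2) U_meet[OF a(1) b(1)]])
    fix z y assume z: "z \<in> elts Z" "cond y" "y \<preceq> p z" "y \<preceq> a \<cdot> b"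
    then have "y \<preceq> vfst0 z \<cdot> vsnd0 z" "vfst0 z \<cdot> vsnd0 z \<in> cr" using ab[OF z] by (simp_all add: le_meet_iff)
    then show "vfst0 z \<cdot> vsnd0 z \<in> cr \<and> (\<exists>v. cond v \<and> v \<preceq> y \<and> v \<preceq> vfst0 z \<cdot> vsnd0 z)"
      using dense_refl[OF z(2)] by blast
  qed
  then have rG: "\<pi> \<rho> \<in> G" using \<rho>(1) unfolding G_def by blast
  let ?f = "\<lambda>i::nat. if i = 0 then (\<lambda>z. vfst0 z \<cdot> vsnd0 z) else if i = 1 then vfst0 else vsnd0"
  let ?t = "\<lambda>i::nat. if i = 0 then \<rho> else if i = 1 then \<tau> else \<sigma>"
  have D: "dfn V M jj (\<lambda>e. vpair (e 0) (e 1) \<in> elts R \<and> vpair (e 0) (e 2) \<in> elts R)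
      (\<lambda>e. jle (e 0) (e 1) \<and> jle (e 0) (e 2))"
    by (intro T.dfn_rules ARV refl)
  let ?P = "\<lambda>z. vpair (vfst0 z \<cdot> vsnd0 z) (vfst0 z) \<in> elts R \<and> vpair (vfst0 z \<cdot> vsnd0 z) (vsnd0 z) \<in> elts R"
  have dP: "dpred ?P" by (intro def_rules tm_meet tm_vfst0 tm_vsnd0 ARV refl)
  have "jle (\<pi> (?t 0)) (\<pi> (?t 1)) \<and> jle (\<pi> (?t 0)) (\<pi> (?t 2)) \<longleftrightarrow>
      AA p Z (\<lambda>z. vpair (?f 0 z) (?f 1 z) \<in> elts R \<and> vpair (?f 0 z) (?f 2 z) \<in> elts R)"
    by (rule Los_dfn[OF D W, of ?f ?t]) (use t1 t2 t3 \<tau> \<sigma> R1 R2 \<rho> in simp_all)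
  moreover have "AA p Z ?P"
    by (rule AA_I[OF W dP U_meet[OF a(1) b(1)]], unfold le_iff[symmetric])
      (use ab in \<open>blast intro: BL.meet_left BL.meet_right\<close>)
  ultimately have le: "jle (\<pi> \<rho>) x" "jle (\<pi> \<rho>) y" using \<tau>(3) \<sigma>(3) by simp_all
  have c: "x \<in> jc" "y \<in> jc" "\<pi> \<rho> \<in> jc" using \<pi>_jc \<tau> \<sigma> \<rho> gr by blast+
  show ?thesis
    by (rule G_mono[OF rG jmeet(1)[OF c(1,2)] jmeet(4)[OF c le]])
qed

lemma jU_G: "jj ` U \<subseteq> G"
proof
  fix x assume "x \<in> jj ` U"
  then obtain b where b: "b \<in> U" "x = \<pi> (ck b)" unfolding jj_def by blast
  note c = U_cr[OF b(1)]
  have "b \<preceq> gv (ck b)"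
    by (rule le_gv[OF ck_NB[OF cr_V[OF c]] c c]) (use c cr_V[OF c] le_refl eqv_refl in auto)
  then have "gv (ck b) \<in> U" by (rule U_up[OF b(1) gv_closed[OF ck_NB[OF cr_V[OF c]]]])
  then show "x \<in> G" using b ck_GN[OF cr_V[OF c]] unfolding G_def by blast
qed

lemma G_zero: "jj \<zero> \<notin> G"
proof
  assume "jj \<zero> \<in> G"
  then obtain \<tau> where \<tau>: "\<tau> \<in> GN" "gv \<tau> \<in> U" "\<pi> \<tau> = \<pi> (ck \<zero>)" unfolding G_def jj_def by auto
  note N = GN_NB[OF \<tau>(1)]
  have "Q \<tau> (ck \<zero>)" using \<pi>_eq_iff[OF \<tau>(1) ck_GN[OF zero_V]] \<tau>(3) by blast
  then have "\<zero> \<in> U"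
  proof (rule U_force2[OF \<tau>(2) _ zero_closed])
    fix x assume x: "cond x" "x \<preceq> gv \<tau>" "x \<preceq> eqv \<tau> (ck \<zero>)"
    from gv_cond[OF N x(1,2)] obtain b y where y: "b \<in> cr" "cond y" "y \<preceq> x" "y \<preceq> eqv \<tau> (ck b)" "y \<preceq> b" .
    have "y \<preceq> eqv \<tau> (ck \<zero>)" using cle[OF y(2,3) x(3)] x(1) eq_closed N zero_V by simp
    then have "b = \<zero>" using eqv_ck_unique[OF y(2) N cr_V[OF y(1)] zero_V y(4)] by blast
    then show "\<exists>y. cond y \<and> y \<preceq> x \<and> y \<preceq> \<zero>" using y by blast
  qed
  then show False using U_zero by blast
qed

text \<open>
  Genericity.  A name \<open>\<delta>\<close> for a dense set is met by a name for a member of the generic filter: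
  along an enumeration of the algebra, \<open>c \<beta>\<close> is the value of \<open>fn \<beta>\<close> being a member of both, and
  removing from each \<open>c \<beta>\<close> the earlier ones leaves a weight \<open>q\<close>, over which \<open>fn\<close> represents the
  name that is sought.
\<close>

lemma G_dense:
  assumes D: "D \<in> M" "bdense jL (elts D)"
  shows "G \<inter> elts D \<noteq> {}"
proof -
  obtain \<delta> where \<delta>: "\<delta> \<in> GN" "D = \<pi> \<delta>" using D(1) unfolding M_def by blast
  note N = GN_NB[OF \<delta>(1)]
  note w = weight_self[OF \<delta>(1)]
  let ?h = "\<lambda>w. eqv \<delta> (ck w)" and ?S = "supp \<delta>"
  define Pd where "Pd d \<longleftrightarrow> (\<forall>b\<in>elts d. b \<in> elts A) \<and>
    (\<forall>x\<in>elts A. x \<noteq> \<zero> \<longrightarrow> (\<exists>b\<in>elts d. b \<noteq> \<zero> \<and> vpair b x \<in> elts R))" for d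
  have dPd: "dpred Pd" unfolding Pd_def by (intro def_rules ARV zero_V refl)
  have hU: "jv ?h ?S Pd \<in> U"
  proof -
    have DP: "dfn V M jj (\<lambda>e. (\<forall>b\<in>elts (e 0). b \<in> elts A) \<and>
        (\<forall>x\<in>elts A. x \<noteq> \<zero> \<longrightarrow> (\<exists>b\<in>elts (e 0). b \<noteq> \<zero> \<and> vpair b x \<in> elts R)))
      (\<lambda>e. (\<forall>b\<in>elts (e 0). b \<in> jc) \<and> (\<forall>x\<in>jc. x \<noteq> jj \<zero> \<longrightarrow> (\<exists>b\<in>elts (e 0). b \<noteq> jj \<zero> \<and> jle b x)))"
      by (intro T.dfn_rules ARV zero_V refl)
    have "(\<forall>b\<in>elts D. b \<in> jc) \<and> (\<forall>x\<in>jc. x \<noteq> jj \<zero> \<longrightarrow> (\<exists>b\<in>elts D. b \<noteq> jj \<zero> \<and> jle b x)) \<longleftrightarrow> AA ?h ?S Pd"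
      unfolding Pd_def \<delta>(2) by (rule Los_dfn[OF DP w(1), of "\<lambda>_ x. x" "\<lambda>_. \<delta>"]) (use w(2) \<delta>(1) tm_id in simp_all)
    moreover have "(\<forall>b\<in>elts D. b \<in> jc) \<and> (\<forall>x\<in>jc. x \<noteq> jj \<zero> \<longrightarrow> (\<exists>b\<in>elts D. b \<noteq> jj \<zero> \<and> jle b x))"
      using D(2) unfolding bdense_def jL jbottom by blast
    ultimately show ?thesis unfolding AA_def by blast
  qed
  obtain fn \<alpha> where fn: "dfun fn" and \<alpha>: "\<alpha> \<in> V" "ord \<alpha>" "elts A \<subseteq> fn ` elts \<alpha>"
    by (rule enumeration[OF ARV(1)])
  define cS where "cS \<beta> = {u. \<exists>d\<in>elts ?S. Pd d \<and> fn \<beta> \<in> elts d \<and> u = ?h d \<cdot> fn \<beta>}" for \<beta>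
  define c where "c \<beta> = bsup (cS \<beta>)" for \<beta>
  have "def (\<lambda>e. e 0 \<in> cS (e (Suc 0)))"
    unfolding cS_def mem_Collect_eq
    by (intro def_rules dfn_subst1[OF dPd] tm_meet tm_val_eq tm_ck tm_fun1[OF fn] supp(1) N NB_V refl)
  then have dcS: "def (\<lambda>e. e 0 \<in> cS (t (\<lambda>n. e (Suc n))))" if "tm t" for t
    by (rule dfn_subst2[where P = "\<lambda>\<beta> u. u \<in> cS \<beta>" and Q = "\<lambda>\<beta> u. u \<in> cS \<beta>", OF _ trm_shift[OF that] trm_var])
  have tc: "tm (\<lambda>e. c (t e))" if "tm t" for t
    unfolding c_def by (rule tm_bsup) (rule dcS[OF that])
  have fnV: "fn \<beta> \<in> V" if "\<beta> \<in> V" for \<beta> by (rule tm_closed1[OF fn that])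
  have icS: "inV (cS \<beta>)" if "\<beta> \<in> V" for \<beta>
    by (rule inV_of_def) (rule dcS[OF trm_const[OF that refl]])
  have cc: "c \<beta> \<in> cr" if "\<beta> \<in> V" for \<beta> unfolding c_def by (rule bsup_closed[OF icS[OF that]])
  have SV: "d \<in> V" if "d \<in> elts ?S" for d using that supp(2)[OF N] by simp
  have hc: "?h d \<in> cr" if "d \<in> elts ?S" for d using eq_closed N SV[OF that] by simp
  have c_cond: "\<exists>d y. d \<in> elts ?S \<and> Pd d \<and> fn \<beta> \<in> elts d \<and> fn \<beta> \<in> cr \<and> cond y \<and> y \<preceq> x \<and> y \<preceq> ?h d \<and> y \<preceq> fn \<beta>"
    if \<beta>: "\<beta> \<in> V" and x: "cond x" "x \<preceq> c \<beta>" for x \<beta>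
  proof -
    obtain u y where "u \<in> cS \<beta>" and y: "cond y" "y \<preceq> x" "y \<preceq> u"
      using bsup_cond[OF icS[OF \<beta>] x(1)] x(2) unfolding c_def by blast
    then obtain d where d: "d \<in> elts ?S" "Pd d" "fn \<beta> \<in> elts d" "u = ?h d \<cdot> fn \<beta>" unfolding cS_def by blast
    have "fn \<beta> \<in> cr" using d(2,3) unfolding Pd_def cr_elts by blast
    then show ?thesis using y d hc[OF d(1)] le_meet_iff[of y "?h d" "fn \<beta>"] by auto
  qed
  have le_c: "x \<preceq> c \<beta>" if \<beta>: "\<beta> \<in> V" and d: "d \<in> elts ?S" "Pd d" "fn \<beta> \<in> elts d" and x: "x \<in> cr" "x \<preceq> ?h d" "x \<preceq> fn \<beta>"
    for x \<beta> d
  proof -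
    have f: "fn \<beta> \<in> cr" using d(2,3) unfolding Pd_def cr_elts by blast
    show ?thesis
      unfolding c_def
      by (rule cond_le_bsup[OF icS[OF \<beta>] x(1), of "?h d \<cdot> fn \<beta>"])
        (use d x f hc[OF d(1)] le_meet_iff in \<open>auto simp: cS_def\<close>)
  qed
  define eS where "eS \<beta> = {u. \<exists>\<gamma>\<in>elts \<beta>. u = c \<gamma>}" for \<beta>
  have deS: "def (\<lambda>e. e 0 \<in> eS (t (\<lambda>n. e (Suc n))))" if "tm t" for t
    unfolding eS_def mem_Collect_eq by (intro def_rules tc trm_shift that)
  have ieS: "inV (eS \<beta>)" if "\<beta> \<in> V" for \<beta>
    by (rule inV_of_def) (rule deS[OF trm_const[OF that refl]])
  define q where "q \<beta> = c \<beta> \<cdot> cneg (bsup (eS \<beta>))" for \<beta>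
  have tq: "dfun q"
    unfolding q_def by (intro tm_meet tm_cneg tc trm_var tm_bsup) (rule deS[OF trm_var])
  have ec: "bsup (eS \<beta>) \<in> cr" if "\<beta> \<in> V" for \<beta> by (rule bsup_closed[OF ieS[OF that]])
  have \<alpha>V: "\<beta> \<in> V" if "\<beta> \<in> elts \<alpha>" for \<beta> by (rule V_elts[OF \<alpha>(1) that])
  have le_q: "x \<preceq> q \<beta> \<longleftrightarrow> x \<preceq> c \<beta> \<and> (\<forall>\<gamma>\<in>elts \<beta>. \<forall>y. cond y \<and> y \<preceq> x \<longrightarrow> \<not> y \<preceq> c \<gamma>)"
    if \<beta>: "\<beta> \<in> elts \<alpha>" and x: "x \<in> cr" for x \<beta>
  proof -
    note bV = \<alpha>V[OF \<beta>]
    have gV: "\<gamma> \<in> V" if "\<gamma> \<in> elts \<beta>" for \<gamma> by (rule V_elts[OF bV that])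
    have "x \<preceq> q \<beta> \<longleftrightarrow> x \<preceq> c \<beta> \<and> x \<preceq> neg (bsup (eS \<beta>))"
      using le_meet_iff[OF x cc[OF bV] neg(1)[OF ec[OF bV]]] ec[OF bV] by (simp add: q_def cneg_def)
    also have "x \<preceq> neg (bsup (eS \<beta>)) \<longleftrightarrow> (\<forall>y. cond y \<and> y \<preceq> x \<longrightarrow> \<not> y \<preceq> bsup (eS \<beta>))"
      by (rule le_neg_iff[OF ec[OF bV] x])
    also have "\<dots> \<longleftrightarrow> (\<forall>\<gamma>\<in>elts \<beta>. \<forall>y. cond y \<and> y \<preceq> x \<longrightarrow> \<not> y \<preceq> c \<gamma>)"
    proof (intro iffI ballI allI impI)
      fix \<gamma> y assume *: "\<forall>y. cond y \<and> y \<preceq> x \<longrightarrow> \<not> y \<preceq> bsup (eS \<beta>)" and g: "\<gamma> \<in> elts \<beta>" and y: "cond y \<and> y \<preceq> x"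
      show "\<not> y \<preceq> c \<gamma>"
      proof
        assume "y \<preceq> c \<gamma>"
        then have "y \<preceq> bsup (eS \<beta>)"
          using cond_le_bsup[OF ieS[OF bV], of y "c \<gamma>"] y g cc[OF gV[OF g]] unfolding eS_def by auto
        then show False using * y by blast
      qed
    next
      fix y assume *: "\<forall>\<gamma>\<in>elts \<beta>. \<forall>y. cond y \<and> y \<preceq> x \<longrightarrow> \<not> y \<preceq> c \<gamma>" and y: "cond y \<and> y \<preceq> x"
      show "\<not> y \<preceq> bsup (eS \<beta>)"
      proof
        assume "y \<preceq> bsup (eS \<beta>)"
        then obtain u v where "u \<in> eS \<beta>" and v: "cond v" "v \<preceq> y" "v \<preceq> u"
          using bsup_cond[OF ieS[OF bV]] y by blast
        then obtain \<gamma> where "\<gamma> \<in> elts \<beta>" "v \<preceq> c \<gamma>" unfolding eS_def by blast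
        moreover have "v \<preceq> x" using le_tr[of v y x] v y x by simp
        ultimately show False using * v by blast
      qed
    qed
    finally show ?thesis .
  qed
  have qc: "q \<beta> \<in> cr" if "\<beta> \<in> elts \<alpha>" for \<beta>
    using cc[OF \<alpha>V[OF that]] neg(1)[OF ec[OF \<alpha>V[OF that]]] ec[OF \<alpha>V[OF that]] by (simp add: q_def cneg_def)
  have "AA q \<alpha> (\<lambda>_. True)"
    unfolding AA_def
  proof (rule U_force1[OF hU])
    have iq: "inV {u. \<exists>x\<in>elts \<alpha>. True \<and> u = q x}" by (rule AA_inV[OF tq \<alpha>(1) def_True])
    show "jv q \<alpha> (\<lambda>_. True) \<in> cr" by (rule bsup_closed[OF iq])
    fix x assume x: "cond x" "x \<preceq> jv ?h ?S Pd"
    from jv_cond[OF w(1) dPd x] obtain d y where y: "d \<in> elts ?S" "Pd d" "cond y" "y \<preceq> x" "y \<preceq> ?h d" .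
    obtain b where b: "b \<in> elts d" "b \<noteq> \<zero>" "b \<preceq> y"
      using y(2,3) unfolding Pd_def cr_elts[symmetric] le_iff[symmetric] cond_def by blast
    have bA: "b \<in> cr" using b(1) y(2) unfolding Pd_def cr_elts by blast
    then obtain \<beta>0 where b0: "\<beta>0 \<in> elts \<alpha>" "b = fn \<beta>0" using \<alpha>(3) unfolding cr_elts by blast
    have cb: "cond b" using bA b(2) by (simp add: cond_def)
    have "b \<preceq> ?h d" using cle[OF cb b(3) y(5)] y hc by simp
    then have "b \<preceq> c \<beta>0"
      using le_c[OF \<alpha>V[OF b0(1)] y(1,2) _ bA] b(1) b0(2) le_refl[OF bA] by simp
    moreover have "b \<preceq> x" using le_tr[of b y x] b(3) y x bA by simp
    ultimately have ex: "\<exists>v. cond v \<and> v \<preceq> x \<and> v \<preceq> c \<beta>0" using cb by blast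
    let ?T = "{\<beta> \<in> elts \<alpha>. \<exists>v. cond v \<and> v \<preceq> x \<and> v \<preceq> c \<beta>}"
    have "\<beta>0 \<in> ?T" using b0(1) ex by blast
    then obtain \<beta> where \<beta>T: "\<beta> \<in> ?T" and least: "\<And>\<gamma>. (\<gamma>, \<beta>) \<in> {(y, x). y \<in> elts x} \<Longrightarrow> \<gamma> \<notin> ?T"
      by (rule wfE_min[OF foundation]) (rule that; assumption)
    have \<beta>: "\<beta> \<in> ?T" "\<And>\<gamma>. \<gamma> \<in> elts \<beta> \<Longrightarrow> \<gamma> \<notin> ?T"
      using \<beta>T least by simp_all
    obtain v where v: "cond v" "v \<preceq> x" "v \<preceq> c \<beta>" using \<beta>T by blast
    have "v \<preceq> q \<beta>"
      unfolding le_q[OF CollectD[OF \<beta>(1), THEN conjunct1] cond_cr[OF v(1)]]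
    proof (intro conjI v ballI allI impI)
      fix \<gamma> y assume g: "\<gamma> \<in> elts \<beta>" and y: "cond y \<and> y \<preceq> v"
      have "\<gamma> \<in> elts \<alpha>" using ord_trans[OF \<alpha>(2) _ g] \<beta>(1) by blast
      moreover have "y \<preceq> x" using le_tr[of y v x] y v x by simp
      ultimately show "\<not> y \<preceq> c \<gamma>" using \<beta>(2)[OF g] y by blast
    qed
    then have "v \<preceq> jv q \<alpha> (\<lambda>_. True)"
      using cond_le_bsup[OF iq cond_cr[OF v(1)], of "q \<beta>"] \<beta>(1) qc by blast
    then show "\<exists>y. cond y \<and> y \<preceq> x \<and> y \<preceq> jv q \<alpha> (\<lambda>_. True)" using v by blast
  qed
  moreover have "\<beta> = \<gamma>" if \<beta>: "\<beta> \<in> elts \<alpha>" and \<gamma>: "\<gamma> \<in> elts \<alpha>" and y: "cond y" "y \<preceq> q \<beta>" "y \<preceq> q \<gamma>" for \<beta> \<gamma> y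
  proof (rule ccontr)
    assume "\<beta> \<noteq> \<gamma>"
    then have "\<beta> \<in> elts \<gamma> \<or> \<gamma> \<in> elts \<beta>"
      using ord_linear[OF ord_elts[OF \<alpha>(2) \<beta>] ord_elts[OF \<alpha>(2) \<gamma>]] by blast
    then show False
      using y le_q[OF \<beta> cond_cr[OF y(1)]] le_q[OF \<gamma> cond_cr[OF y(1)]] le_refl[OF cond_cr[OF y(1)]] by blast
  qed
  ultimately have W: "weight q \<alpha>"
    unfolding weight_def using tq \<alpha>(1) qc by blast
  note m = Rep_mixture[OF W fn]
  define \<rho> where "\<rho> = mixture q \<alpha> fn"
  have \<rho>: "\<rho> \<in> GN" "Rep q \<alpha> fn \<rho>" using m unfolding \<rho>_def by blast+
  note NR = GN_NB[OF \<rho>(1)]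
  have "gv \<rho> \<in> U"
  proof (rule gv_I[OF W fn NR \<rho>(2) U_one])
    fix z y assume z: "z \<in> elts \<alpha>" "cond y" "y \<preceq> q z"
    then have "y \<preceq> c z" using le_q by simp
    from c_cond[OF \<alpha>V[OF z(1)] z(2) this] show "fn z \<in> cr \<and> (\<exists>v. cond v \<and> v \<preceq> y \<and> v \<preceq> fn z)" by blast
  qed
  then have "\<pi> \<rho> \<in> G" using \<rho>(1) unfolding G_def by blast
  moreover have "E \<rho> \<delta>"
  proof (rule U_force1[OF \<rho>(2)[unfolded Rep_def] mem_closed[OF NB_V[OF NR] NB_V[OF N]]])
    fix x assume "cond x" "x \<preceq> rv q \<alpha> fn \<rho>"
    from rv_cond[OF W fn NR this] obtain z y where
      y: "z \<in> elts \<alpha>" "cond y" "y \<preceq> x" "y \<preceq> q z" "y \<preceq> eqv \<rho> (ck (fn z))" .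
    have "y \<preceq> c z" using le_q y by simp
    from c_cond[OF \<alpha>V[OF y(1)] y(2) this] obtain d v where
      v: "d \<in> elts ?S" "fn z \<in> elts d" "cond v" "v \<preceq> y" "v \<preceq> ?h d" by blast
    note dV = SV[OF v(1)] and fV = fnV[OF \<alpha>V[OF y(1)]]
    have "v \<preceq> eqv \<rho> (ck (fn z))" using cle[OF v(3,4) y(5)] y(2) eq_closed NR fV by simp
    then have "v \<preceq> memv \<rho> (ck d)"
      using memv_subst_left[OF ck_NB[OF fV] NR ck_NB[OF dV] v(3) le_mem_ck[OF cond_cr[OF v(3)] v(2) dV]] eqv_sym by simp
    then have "v \<preceq> memv \<rho> \<delta>"
      using memv_subst_right[OF NR ck_NB[OF dV] N v(3)] v(5) eqv_sym by simp
    moreover have "v \<preceq> x" using le_tr[of v y x] v y \<open>cond x\<close> by simp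
    ultimately show "\<exists>y. cond y \<and> y \<preceq> x \<and> y \<preceq> memv \<rho> \<delta>" using v by blast
  qed
  then have "\<pi> \<rho> \<in> elts D" unfolding \<delta>(2) using \<pi>_mem_iff[OF \<rho>(1) \<delta>(1)] by blast
  ultimately show ?thesis by blast
qed

theorem generic_G: "generic_filter M jL G"
  unfolding generic_filter_def bfilter_def jL jbottom
proof (intro conjI ballI impI)
  show "G \<subseteq> jc" using \<pi>_jc unfolding G_def by blast
  show "G \<noteq> {}" using jU_G U_ne by blast
qed (use G_zero G_mono G_meet G_dense in auto)

end


section \<open>The equivalence\<close>

theorem theorem25:
  fixes V U :: "'a::set_universe set" and B :: 'a
  assumes "transitive_class V" and "zfc_model V"
    and "complete_boolean_algebra_in V B"
    and "bultrafilter (bord B) U"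
  shows "wfp_on (boolean_ultrapower V B U) (ultrapower_mem B U) \<longleftrightarrow>
    (\<exists>j M G. transitive_class M \<and> elementary_embedding V M j \<and>
       generic_filter M (bord (j B)) G \<and> j ` U \<subseteq> G)"
proof -
  interpret boolean_ultra V B U
    by unfold_locales (rule assms)+
  show ?thesis
    unfolding wfp_on_ultrapower_iff
  proof
    assume "wfp_on GN E"
    then interpret wf_ultrapower V B U
      by unfold_locales
    show "\<exists>j M G. transitive_class M \<and> elementary_embedding V M j \<and>
       generic_filter M (bord (j B)) G \<and> j ` U \<subseteq> G"
      using transitive_M elementary_jj generic_G jU_G by blast
  next
    assume "\<exists>j M G. transitive_class M \<and> elementary_embedding V M j \<and>
       generic_filter M (bord (j B)) G \<and> j ` U \<subseteq> G"
    then obtain j M G where M: "transitive_class M" "elementary_embedding V M j"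
      and G: "generic_filter M (bord (j B)) G" "j ` U \<subseteq> G" by blast
    interpret boolean_embedding V B U M j
      by unfold_locales (rule M)+
    show "wfp_on GN E" by (rule wf_if_generic[OF G])
  qed
qed

end
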